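(* Let $\{(y_i,X_i)\in\mathbb{R}^{1+p}: i=1,\ldots,n\}$ be i.i.d., with $p$ fixed, satisfying $y_i=X_i^T\beta_0+e_i$ for an unknown $\beta_0\in\mathbb{R}^p$, where $\mathbb{E}(y_i^4)<\infty$, $\mathbb{E}(\|X_i\|^4)<\infty$, $\mathbb{E}(X_iX_i^T)$ has full rank $p$, and $\mathbb{E}(e_iX_i)=0$. Let $\Pi$ be a random sketching matrix independent of the data, and let $m=m_n\to\infty$ with $m/n\to 0$ as $n\to\infty$. Let $\widehat\beta_{OLS}=(X^TX)^{-1}X^Ty$ and $\widetilde\beta_{OLS}=(X^T\Pi^T\Pi X)^{-1}X^T\Pi^T\Pi y$, and define $V_1:=[\mathbb{E}(X_iX_i^T)]^{-1}\mathbb{E}(e_i^2X_iX_i^T)[\mathbb{E}(X_iX_i^T)]^{-1}$ and $V_0:=\mathbb{E}(e_i^2)[\mathbb{E}(X_iX_i^T)]^{-1}$. Then, as $n\to\infty$: (i) if $\Pi$ is a Bernoulli sampling matrix, $m^{1/2}(\widetilde\beta_{OLS}-\widehat\beta_{OLS})\to_d N(0,V_1)$; (ii) if $\Pi$ is a countsketch matrix, $m^{1/2}(\widetilde\beta_{OLS}-\widehat\beta_{OLS})\to_d N(0,V_0)$.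
   Context: $y\in\mathbb{R}^n$ and $X\in\mathbb{R}^{n\times p}$ stack $y_i$ and $X_i^T$ as rows; $e$ stacks $e_i$. Bernoulli sampling (BS): $\Pi=\sqrt{n/m}\,B$, where $B$ is an $n\times n$ diagonal matrix whose diagonal entries are i.i.d. Bernoulli random variables with success probability $m/n$. Countsketch (CS): $\Pi$ is an $m\times n$ matrix whose columns are i.i.d.; each column has exactly one nonzero entry, located in a row chosen uniformly at random from $\{1,\ldots,m\}$, and taking the values $+1$ or $-1$ with equal probability (sign independent of location). *)

theory Defs
  imports "HOL-Analysis.Analysis" "HOL-Probability.Probability"
begin

definition outer :: "real^'p \<Rightarrow> real^'p \<Rightarrow> real^'p^'p" where
  "outer x z = (\<chi> j k. x $ j * z $ k)"

text \<open>Matrix inverse, with the convention that a singular matrix is mapped to 0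
  (the paper leaves the estimator undefined in that case).\<close>
definition inv0 :: "real^'p^'p \<Rightarrow> real^'p^'p" where
  "inv0 A = (if invertible A then matrix_inv A else 0)"

definition ols :: "nat \<Rightarrow> (nat \<Rightarrow> real^'p) \<Rightarrow> (nat \<Rightarrow> real) \<Rightarrow> real^'p" where
  "ols n X y = inv0 (\<Sum>i<n. outer (X i) (X i)) *v (\<Sum>i<n. y i *\<^sub>R X i)"

text \<open>Sketched OLS: Pi is an r x n matrix given by its entries S k i (k<r, i<n);
  result is (X^T Pi^T Pi X)^{-1} X^T Pi^T Pi y.\<close>
definition sketched_ols :: "nat \<Rightarrow> nat \<Rightarrow> (nat \<Rightarrow> nat \<Rightarrow> real) \<Rightarrow>
    (nat \<Rightarrow> real^'p) \<Rightarrow> (nat \<Rightarrow> real) \<Rightarrow> real^'p" where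
  "sketched_ols r n S X y =
     (let PX = (\<lambda>k. \<Sum>i<n. S k i *\<^sub>R X i); Py = (\<lambda>k. \<Sum>i<n. S k i * y i)
      in inv0 (\<Sum>k<r. outer (PX k) (PX k)) *v (\<Sum>k<r. Py k *\<^sub>R PX k))"

text \<open>Bernoulli sampling: Pi = sqrt(n/m) B (n x n), B diagonal with i.i.d. Bernoulli(m/n) entries.\<close>
definition bern_sketch :: "nat \<Rightarrow> nat \<Rightarrow> (nat \<Rightarrow> bool) pmf" where
  "bern_sketch n m = Pi_pmf {..<n} False (\<lambda>_. bernoulli_pmf (real m / real n))"

definition bern_Pi :: "nat \<Rightarrow> nat \<Rightarrow> (nat \<Rightarrow> bool) \<Rightarrow> nat \<Rightarrow> nat \<Rightarrow> real" where
  "bern_Pi n m b k i = (if k = i then sqrt (real n / real m) * (if b i then 1 else 0) else 0)"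

text \<open>Countsketch: Pi is m x n; column i has a single nonzero entry, in row h_i
  uniform on {0..<m}, with value s_i uniform on {-1,1}; all independent.\<close>
definition cs_sketch :: "nat \<Rightarrow> nat \<Rightarrow> (nat \<Rightarrow> nat \<times> real) pmf" where
  "cs_sketch n m = Pi_pmf {..<n} (0, 1)
     (\<lambda>_. pair_pmf (pmf_of_set {..<m}) (pmf_of_set {-1, 1}))"

definition cs_Pi :: "(nat \<Rightarrow> nat \<times> real) \<Rightarrow> nat \<Rightarrow> nat \<Rightarrow> real" where
  "cs_Pi c k i = (if fst (c i) = k then snd (c i) else 0)"

text \<open>Multivariate normal N(0,V) on R^p (possibly degenerate), via its characteristic function.\<close>
definition normal_vec :: "real^'p^'p \<Rightarrow> (real^'p) measure \<Rightarrow> bool" where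
  "normal_vec V G \<longleftrightarrow> prob_space G \<and> sets G = sets borel \<and>
     (\<forall>t. integral\<^sup>L G (\<lambda>x. cis (t \<bullet> x)) = complex_of_real (exp (- (t \<bullet> (V *v t)) / 2)))"

definition conv_distr :: "(nat \<Rightarrow> 'b measure) \<Rightarrow> (nat \<Rightarrow> 'b \<Rightarrow> real^'p) \<Rightarrow> (real^'p) measure \<Rightarrow> bool" where
  "conv_distr P Z G \<longleftrightarrow> (\<forall>n. prob_space (P n) \<and> Z n \<in> borel_measurable (P n)) \<and>
     (\<forall>f :: real^'p \<Rightarrow> real. continuous_on UNIV f \<longrightarrow> bounded (range f) \<longrightarrow>
        (\<lambda>n. \<integral>\<omega>. f (Z n \<omega>) \<partial>P n) \<longlonglongrightarrow> (\<integral>x. f x \<partial>G))"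

end

theory Submission
  imports Defs "HOL-Real_Asymp.Real_Asymp"
begin

text \<open>
  Wherever both Gram matrices are invertible, the rescaled difference equals
  \<open>A\<^sup>-\<^sup>1 T - B\<^sup>-\<^sup>1 r\<close>, where \<open>A\<close> and \<open>B\<close> are the normalised sketched and full Gram matrices,
  \<open>T = m\<^sup>1\<^sup>/\<^sup>2 n\<^sup>-\<^sup>1 X\<^sup>T \<Pi>\<^sup>T \<Pi> e\<close> and \<open>r = m\<^sup>1\<^sup>/\<^sup>2 n\<^sup>-\<^sup>1 X\<^sup>T e\<close>. Second moments give \<open>A, B \<rightarrow> E(X X\<^sup>T)\<close> in
  probability, and \<open>r \<rightarrow> 0\<close> because \<open>m/n \<rightarrow> 0\<close>; so only the limit law of \<open>T\<close> matters.

  For Bernoulli sampling \<open>T\<close> is a sum of \<open>n\<close> independent centred vectors and the Lindeberg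
  estimate applies directly. For countsketch, condition on the rows: \<open>T\<close> becomes a sum over the
  \<open>m\<close> rows of independent products \<open>(\<Sum> s\<^sub>i X\<^sub>i)(\<Sum> s\<^sub>i e\<^sub>i)\<close>, which are centred since \<open>E(e X) = 0\<close>.
  The signs make fourth moments explicit, truncation yields the Lindeberg condition from fourth
  moments only, and the sum of squared row occupancies concentrates around \<open>n\<^sup>2/m\<close>.

  Passing from characteristic functions to weak convergence in several dimensions uses
  \<open>exp (- c |z - x|\<^sup>2 / 2) = E cis (\<Gamma> \<bullet> (z - x))\<close> for a Gaussian vector \<open>\<Gamma>\<close>, so that expectations of
  Gaussian bumps converge, and every compactly supported continuous function is a uniform limit
  of mixtures of such bumps.
\<close>

section \<open>Inverse Gram matrices and the least squares error\<close>

text \<open>The two limits differ because different pairs of observations dominate. A diagonal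
  sketch produces only terms with equal indices, so \<open>e\<close> and \<open>X\<close> enter
  jointly through \<open>Omg\<close>. In countsketch a row also produces products of distinct
  observations: about n^2/m ordered pairs share a row, against n diagonal ones, and each contributes
  E(e^2) E(X X^T). After scaling by m/n^2 the diagonal share is m/n and disappears.

  The obstacle is integrability. Under fourth moments a product of two row sums has a second moment
  but in general no third one, so no Lyapunov bound is available. Truncating each linear functional
  at a level K gives a part with sixth moments, whose error vanishes as n grows, and a tail that is
  small uniformly in n without vanishing; hence K is fixed before n tends to infinity.

  The signs are absorbed into the data: s_i (e_i, X_i) is symmetric with the same even moments.
  Normality is defined by a characteristic function and the covariance may be singular, so the
  existence of the limit law is itself to be proved.\<close>

lemma borel_measurable_vecI:
  fixes f :: "'a \<Rightarrow> real^'n"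
  assumes "\<And>i. (\<lambda>x. f x $ i) \<in> borel_measurable M"
  shows "f \<in> borel_measurable M"
proof (subst borel_measurable_euclidean_space, rule ballI)
  fix b :: "real^'n" assume "b \<in> Basis"
  then obtain i where "b = axis i 1" by (auto simp: Basis_vec_def)
  then show "(\<lambda>x. f x \<bullet> b) \<in> borel_measurable M"
    using assms[of i] by (simp add: inner_axis)
qed

lemma borel_measurable_matI:
  fixes f :: "'a \<Rightarrow> real^'n^'k"
  assumes "\<And>i j. (\<lambda>x. f x $ i $ j) \<in> borel_measurable M"
  shows "f \<in> borel_measurable M"
proof (subst borel_measurable_euclidean_space, rule ballI)
  fix b :: "real^'n^'k" assume "b \<in> Basis"
  then obtain i j where "b = axis i (axis j 1)" by (auto simp: Basis_vec_def)
  then show "(\<lambda>x. f x \<bullet> b) \<in> borel_measurable M"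
    using assms[of i j] by (simp add: inner_axis)
qed

lemma borel_measurable_nth [measurable (raw)]:
  fixes f :: "'a \<Rightarrow> ('b::euclidean_space)^'k"
  assumes "f \<in> borel_measurable M"
  shows "(\<lambda>x. f x $ i) \<in> borel_measurable M"
proof -
  have "(\<lambda>v::'b^'k. v $ i) \<in> borel_measurable borel"
    by (intro borel_measurable_continuous_onI continuous_intros)
  from measurable_compose[OF assms this] show ?thesis .
qed

lemma borel_measurable_matrix_vector_mult [measurable (raw)]:
  fixes A :: "'a \<Rightarrow> real^'n^'k"
  assumes [measurable]: "A \<in> borel_measurable M" "x \<in> borel_measurable M"
  shows "(\<lambda>w. A w *v x w) \<in> borel_measurable M"
  by (rule borel_measurable_vecI) (simp add: matrix_vector_mult_def)

lemma borel_measurable_outer [measurable (raw)]: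
  fixes x :: "'a \<Rightarrow> real^'n"
  assumes [measurable]: "x \<in> borel_measurable M" "z \<in> borel_measurable M"
  shows "(\<lambda>w. outer (x w) (z w)) \<in> borel_measurable M"
  by (rule borel_measurable_matI) (simp add: outer_def)

section \<open>The matrix inverse as a measurable map, continuous at invertible matrices\<close>

lemma matrix_inv_mult:
  fixes A :: "real^'n^'n"
  assumes "invertible A"
  shows "A ** matrix_inv A = mat 1" "matrix_inv A ** A = mat 1"
  using someI_ex[OF assms[unfolded invertible_def]] by (auto simp: matrix_inv_def)

text \<open>Cramer's rule writes each entry of the inverse as a quotient of polynomials in the
  entries of \<open>A\<close>, from which continuity and measurability of \<open>inv0\<close> are
  read off.\<close>

lemma inv0_cramer:
  fixes A :: "real^'n^'n"
  assumes "det A \<noteq> 0"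
  shows "inv0 A = (\<chi> k l. det (\<chi> i j. if j = k then axis l 1 $ i else A $ i $ j) / det A)"
proof -
  have inv: "invertible A" using assms invertible_det_nz by blast
  have "matrix_inv A $ k $ l = det (\<chi> i j. if j = k then axis l 1 $ i else A $ i $ j) / det A" for k l
  proof -
    have "A *v (matrix_inv A *v axis l 1) = axis l 1"
      by (simp add: matrix_vector_mul_assoc matrix_inv_mult[OF inv])
    from this[unfolded cramer[OF assms]]
    have "(matrix_inv A *v axis l 1) $ k = det (\<chi> i j. if j = k then axis l 1 $ i else A $ i $ j) / det A"
      by simp
    moreover have "(matrix_inv A *v axis l 1) $ k = matrix_inv A $ k $ l"
      by (simp add: matrix_vector_mult_basis column_def)
    ultimately show ?thesis by simp
  qed
  then show ?thesis using inv by (simp add: inv0_def vec_eq_iff)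
qed

lemma continuous_on_det: "continuous_on S (det :: real^'n^'n \<Rightarrow> real)"
  unfolding det_def by (intro continuous_intros)

lemma continuous_on_cofactor:
  "continuous_on S (\<lambda>A::real^'n^'n. det (\<chi> i j. if j = k then axis l 1 $ i else A $ i $ j))"
proof -
  have "continuous_on S (\<lambda>A::real^'n^'n. if j = k then (axis l 1 :: real^'n) $ i else A $ i $ j)" for i j
    by (cases "j = k") (auto intro!: continuous_intros)
  then have "continuous_on S (\<lambda>A::real^'n^'n. (\<chi> i j. if j = k then (axis l 1 :: real^'n) $ i else A $ i $ j))"
    by (intro continuous_on_vec_lambda)
  from continuous_on_compose2[OF continuous_on_det this subset_UNIV] show ?thesis .
qed

lemma isCont_inv0:
  fixes A :: "real^'n^'n"
  assumes "invertible A"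
  shows "isCont inv0 A"
proof -
  let ?U = "{A::real^'n^'n. det A \<noteq> 0}"
  have U: "open ?U"
    using open_Collect_neq[OF continuous_on_det continuous_on_const[of _ 0]] by simp
  have "continuous_on ?U (\<lambda>A. (\<chi> k l. det (\<chi> i j. if j = k then (axis l 1 :: real^'n) $ i else A $ i $ j) / det A) :: real^'n^'n)"
    by (intro continuous_on_vec_lambda continuous_on_divide continuous_on_cofactor continuous_on_det) auto
  then have "continuous_on ?U (inv0 :: real^'n^'n \<Rightarrow> _)"
    by (rule continuous_on_eq) (simp add: inv0_cramer)
  then show ?thesis
    using U assms by (auto simp: continuous_on_eq_continuous_at invertible_det_nz)
qed

lemma borel_measurable_inv0 [measurable]:
  "(inv0 :: real^'n^'n \<Rightarrow> real^'n^'n) \<in> borel_measurable borel"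
proof -
  have [measurable]: "(det :: real^'n^'n \<Rightarrow> real) \<in> borel_measurable borel"
    by (intro borel_measurable_continuous_onI continuous_on_det)
  have [measurable]: "(\<lambda>A::real^'n^'n. det (\<chi> i j. if j = k then (axis l 1 :: real^'n) $ i else A $ i $ j)) \<in> borel_measurable borel"
    for k l by (intro borel_measurable_continuous_onI continuous_on_cofactor)
  \<comment> \<open>On \<open>det A = 0\<close> the default value 0 of \<open>inv0\<close> applies,
    so the entry is a quotient cut off on a measurable set; continuity alone would not reach the
    singular matrices.\<close>
  have eq: "inv0 A $ k $ l = (if det A \<noteq> 0 then det (\<chi> i j. if j = k then (axis l 1 :: real^'n) $ i else A $ i $ j) / det A else 0)"
    for A :: "real^'n^'n" and k l
    by (cases "det A = 0") (simp_all add: inv0_cramer, simp add: inv0_def invertible_det_nz)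
  show ?thesis
    by (rule borel_measurable_matI) (simp add: eq)
qed

lemma borel_measurable_ols:
  fixes X :: "nat \<Rightarrow> 'a \<Rightarrow> real^'n"
  assumes [measurable]: "\<And>i. X i \<in> borel_measurable M" "\<And>i. y i \<in> borel_measurable M"
  shows "(\<lambda>w. ols n (\<lambda>i. X i w) (\<lambda>i. y i w)) \<in> borel_measurable M"
  unfolding ols_def by measurable

lemma borel_measurable_sketched_ols:
  fixes X :: "nat \<Rightarrow> 'a \<Rightarrow> real^'n"
  assumes [measurable]: "\<And>i. X i \<in> borel_measurable M" "\<And>i. y i \<in> borel_measurable M"
    "\<And>k i. S k i \<in> borel_measurable M"
  shows "(\<lambda>w. sketched_ols r n (\<lambda>k i. S k i w) (\<lambda>i. X i w) (\<lambda>i. y i w)) \<in> borel_measurable M"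
  unfolding sketched_ols_def Let_def by measurable

section \<open>The estimation error of least squares\<close>

lemma outer_mult_vec: "outer x z *v t = (z \<bullet> t) *\<^sub>R x"
  by (vector outer_def matrix_vector_mult_def inner_vec_def)
    (simp add: sum_distrib_left sum_distrib_right mult_ac)

lemma matrix_vector_mult_sum_left:
  fixes A :: "'i \<Rightarrow> real^'n^'k"
  shows "(\<Sum>i\<in>I. A i) *v t = (\<Sum>i\<in>I. A i *v t)"
  by (induction I rule: infinite_finite_induct)
    (simp_all add: matrix_vector_mult_add_rdistrib)

lemma inv0_scale:
  fixes A :: "real^'n^'n"
  assumes "c \<noteq> 0" "invertible A"
  shows "inv0 (c *\<^sub>R A) *v t = (1 / c) *\<^sub>R (inv0 A *v t)"
    and "invertible (c *\<^sub>R A)"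
proof -
  have cA: "c *\<^sub>R A ** ((1/c) *\<^sub>R matrix_inv A) = mat 1" "((1/c) *\<^sub>R matrix_inv A) ** (c *\<^sub>R A) = mat 1"
    using assms matrix_inv_mult[OF assms(2)]
    by (simp_all add: matrix_matrix_mult_def vec_eq_iff)
  then show inv: "invertible (c *\<^sub>R A)" unfolding invertible_def by blast
  have "matrix_inv (c *\<^sub>R A) = matrix_inv (c *\<^sub>R A) ** (c *\<^sub>R A ** ((1/c) *\<^sub>R matrix_inv A))"
    using cA by simp
  also have "\<dots> = (1/c) *\<^sub>R matrix_inv A"
    by (simp only: matrix_mul_assoc matrix_inv_mult[OF inv] matrix_mul_lid)
  finally show "inv0 (c *\<^sub>R A) *v t = (1 / c) *\<^sub>R (inv0 A *v t)"
    using inv assms by (simp add: inv0_def scaleR_matrix_vector_assoc)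
qed

text \<open>Inserting the model turns the right-hand side of the normal equations into
  \<open>A *v \<beta> + T\<close>, and the inverse of \<open>A\<close> gives back
  \<open>\<beta>\<close> exactly. The two factors 1/n cancel; they are kept because the normalised
  Gram matrix is the one with an invertible limit.\<close>

lemma sketched_ols_error:
  fixes X :: "nat \<Rightarrow> real^'n"
  assumes model: "\<And>i. y i = X i \<bullet> \<beta> + e i" and n: "n \<noteq> 0"
    and inv: "invertible ((1 / real n) *\<^sub>R (\<Sum>k<r. outer (\<Sum>i<n. S k i *\<^sub>R X i) (\<Sum>i<n. S k i *\<^sub>R X i)))"
  shows "sketched_ols r n S X y - \<beta> =
    inv0 ((1 / real n) *\<^sub>R (\<Sum>k<r. outer (\<Sum>i<n. S k i *\<^sub>R X i) (\<Sum>i<n. S k i *\<^sub>R X i)))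
      *v ((1 / real n) *\<^sub>R (\<Sum>k<r. (\<Sum>i<n. S k i * e i) *\<^sub>R (\<Sum>i<n. S k i *\<^sub>R X i)))"
proof -
  define PX where "PX = (\<lambda>k. \<Sum>i<n. S k i *\<^sub>R X i)"
  define A where "A = (\<Sum>k<r. outer (PX k) (PX k))"
  define T where "T = (\<Sum>k<r. (\<Sum>i<n. S k i * e i) *\<^sub>R PX k)"
  have invA: "invertible A"
    using inv0_scale(2)[OF _ inv, of "real n"] n by (simp add: A_def PX_def)
  have Py: "(\<Sum>i<n. S k i * y i) = PX k \<bullet> \<beta> + (\<Sum>i<n. S k i * e i)" for k
    by (simp add: PX_def model inner_sum_left distrib_left sum.distrib mult.assoc)
  have "(\<Sum>k<r. (\<Sum>i<n. S k i * y i) *\<^sub>R PX k) = A *v \<beta> + T"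
    unfolding Py A_def T_def
    by (simp add: matrix_vector_mult_sum_left outer_mult_vec scaleR_add_left sum.distrib)
  then have "sketched_ols r n S X y = inv0 A *v (A *v \<beta> + T)"
    by (simp add: sketched_ols_def Let_def A_def PX_def)
  also have "\<dots> = \<beta> + inv0 A *v T"
    using invA by (simp add: inv0_def matrix_vector_right_distrib matrix_vector_mul_assoc matrix_inv_mult)
  also have "inv0 A *v T = inv0 ((1 / real n) *\<^sub>R A) *v ((1 / real n) *\<^sub>R T)"
    using n inv0_scale(1)[of "1 / real n" A "(1 / real n) *\<^sub>R T"] invA
    by (simp add: matrix_vector_mult_scaleR)
  finally show ?thesis by (simp add: A_def T_def PX_def)
qed

text \<open>OLS is the sketch by the identity matrix, so one error formula serves both
  estimators.\<close>

lemma ols_eq_sketched_ols: "ols n X y = sketched_ols n n (\<lambda>k i. if k = i then 1 else 0) X y"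
proof -
  have "(\<Sum>i<n. (if k = i then 1 else 0) *\<^sub>R X i) = (if k < n then X k else 0)" for k
    using sum.delta'[of "{..<n}" k X] by (simp add: if_distrib[of "\<lambda>c. c *\<^sub>R _"] cong: if_cong)
  moreover have "(\<Sum>i<n. (if k = i then 1 else 0) * y i) = (if k < n then y k else 0)" for k
    using sum.delta'[of "{..<n}" k y] by (simp add: if_distrib[of "\<lambda>c. c * _"] cong: if_cong)
  ultimately show ?thesis by (simp add: ols_def sketched_ols_def)
qed

section \<open>Gaussian vectors and Levy continuity in several dimensions\<close>

text \<open>Along the line \<open>v + l *\<^sub>R (V *v v)\<close> the form has no constant term,
  and its linear coefficient is twice the squared norm of \<open>V *v v\<close>; a nonnegative
  quadratic without constant term has no linear part either.\<close>

lemma psd_mult_eq_0: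
  fixes V :: "real^'n^'n"
  assumes sym: "transpose V = V" and psd: "\<And>t. 0 \<le> t \<bullet> (V *v t)" and v: "v \<bullet> (V *v v) = 0"
  shows "V *v v = 0"
proof -
  let ?u = "V *v v"
  have eq: "s \<bullet> (V *v t) = t \<bullet> (V *v s)" for s t
    by (metis sym dot_lmul_matrix inner_commute vector_transpose_matrix)
  have ineq: "0 \<le> 2 * l * (?u \<bullet> ?u) + l\<^sup>2 * (?u \<bullet> (V *v ?u))" for l
  proof -
    have "(v + l *\<^sub>R ?u) \<bullet> (V *v (v + l *\<^sub>R ?u)) = v \<bullet> ?u + l * (?u \<bullet> ?u) + l * (v \<bullet> (V *v ?u)) + l * l * (?u \<bullet> (V *v ?u))"
      by (simp add: matrix_vector_right_distrib matrix_vector_mult_scaleR inner_add_left inner_add_right algebra_simps)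
    then show ?thesis
      using psd[of "v + l *\<^sub>R ?u"] v eq[of v ?u] by (simp add: power2_eq_square)
  qed
  define q where "q = ?u \<bullet> (V *v ?u)"
  define a where "a = ?u \<bullet> ?u"
  have q: "0 \<le> q" using psd by (simp add: q_def)
  have a: "0 \<le> a" by (simp add: a_def)
  have "a = 0"
  proof (rule ccontr)
    assume "a \<noteq> 0"
    with a have a: "a > 0" by simp
    \<comment> \<open>The choice l = -a/(q + 1) makes the quadratic negative: with q + 1 in place of
      q the quotient is defined also for q = 0, and the factor q - 2(q + 1) stays negative.\<close>
    have "0 \<le> 2 * (- a / (q + 1)) * a + (- a / (q + 1))\<^sup>2 * q"
      using ineq[of "- a / (q + 1)"] by (simp add: a_def q_def)
    also have "\<dots> = (a / (q + 1))\<^sup>2 * (q - 2 * (q + 1))"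
    proof -
      have "a = a / (q + 1) * (q + 1)" using q by simp
      then obtain s where s: "a = s * (q + 1)" "s = a / (q + 1)" by blast
      show ?thesis unfolding minus_divide_left[symmetric] s(2)[symmetric]
        by (subst s(1)) (simp add: algebra_simps power2_eq_square)
    qed
    also have "\<dots> < 0" using a q by (intro mult_pos_neg) auto
    finally show False by simp
  qed
  then show ?thesis by (simp add: a_def)
qed

text \<open>Adding an independent standard normal multiple of \<open>w\<close> multiplies the
  characteristic function by exp(-(t \<bullet> w)^2 / 2), the factor belonging to
  \<open>outer w w\<close>.\<close>

lemma normal_vec_add_rank_one:
  fixes V :: "real^'n^'n"
  assumes G: "normal_vec V G"
  shows "normal_vec (V + outer w w) (distr (G \<Otimes>\<^sub>M std_normal_distribution) borel (\<lambda>(x, g). x + g *\<^sub>R w))"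
proof -
  interpret G: prob_space G using G by (simp add: normal_vec_def)
  have [measurable_cong]: "sets G = sets borel" using G by (simp add: normal_vec_def)
  interpret N: prob_space std_normal_distribution
    by (simp add: prob_space_normal_density)
  have [measurable_cong]: "sets std_normal_distribution = sets borel" by simp
  interpret PP: pair_prob_space G std_normal_distribution ..
  have "(\<integral>z. cis (t \<bullet> z) \<partial>distr (G \<Otimes>\<^sub>M std_normal_distribution) borel (\<lambda>(x, g). x + g *\<^sub>R w))
    = complex_of_real (exp (- (t \<bullet> ((V + outer w w) *v t)) / 2))" for t
  proof -
    have [measurable]: "(cis :: real \<Rightarrow> complex) \<in> borel_measurable borel"
      by (intro borel_measurable_continuous_onI continuous_intros)
    have N: "(\<integral>g. cis (s * g) \<partial>std_normal_distribution) = complex_of_real (exp (- s\<^sup>2 / 2))" for s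
      using fun_cong[OF char_std_normal_distribution, of s] by (simp add: char_def cis_conv_exp)
    have "(\<integral>z. cis (t \<bullet> z) \<partial>distr (G \<Otimes>\<^sub>M std_normal_distribution) borel (\<lambda>(x, g). x + g *\<^sub>R w))
       = (\<integral>p. cis (t \<bullet> fst p) * cis ((t \<bullet> w) * snd p) \<partial>(G \<Otimes>\<^sub>M std_normal_distribution))"
      by (subst integral_distr) (auto simp: inner_add_right cis_mult split_beta mult.commute)
    also have "\<dots> = (\<integral>x. \<integral>g. cis (t \<bullet> x) * cis ((t \<bullet> w) * g) \<partial>std_normal_distribution \<partial>G)"
    proof -
      have "integrable (G \<Otimes>\<^sub>M std_normal_distribution) (\<lambda>p. cis (t \<bullet> fst p) * cis ((t \<bullet> w) * snd p))"
        by (rule PP.integrable_const_bound[where B=1]) (auto simp: norm_mult)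
      from PP.integral_fst'[OF this] show ?thesis by simp
    qed
    also have "\<dots> = (\<integral>x. cis (t \<bullet> x) \<partial>G) * complex_of_real (exp (- (t \<bullet> w)\<^sup>2 / 2))"
      by (simp add: N)
    also have "\<dots> = complex_of_real (exp (- (t \<bullet> (V *v t)) / 2) * exp (- (t \<bullet> w)\<^sup>2 / 2))"
      using G by (simp add: normal_vec_def)
    also have "exp (- (t \<bullet> (V *v t)) / 2) * exp (- (t \<bullet> w)\<^sup>2 / 2) = exp (- (t \<bullet> ((V + outer w w) *v t)) / 2)"
      by (simp add: exp_add[symmetric] matrix_vector_mult_add_rdistrib outer_mult_vec inner_add_right
          power2_eq_square inner_commute field_simps del: exp_add)
    finally show ?thesis .
  qed
  moreover have "prob_space (distr (G \<Otimes>\<^sub>M std_normal_distribution) borel (\<lambda>(x, g). x + g *\<^sub>R w))"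
    by (rule PP.prob_space_distr) measurable
  ultimately show ?thesis by (simp add: normal_vec_def)
qed

text \<open>Induction on the rank: a direction \<open>v\<close> with \<open>v \<bullet> V v > 0\<close> splits off the rank-one part
  \<open>V v (V v)\<^sup>T / (v \<bullet> V v)\<close>, and the remainder stays positive semidefinite with a larger kernel.\<close>

lemma normal_vec_exists:
  fixes V :: "real^'n^'n"
  assumes "transpose V = V" "\<And>t. 0 \<le> t \<bullet> (V *v t)"
  shows "\<exists>G. normal_vec V G"
  using assms
proof (induction "CARD('n) - dim {t. V *v t = 0}" arbitrary: V rule: less_induct)
  case less
  note sym = less.prems(1) and psd = less.prems(2)
  have eq: "s \<bullet> (V *v t) = t \<bullet> (V *v s)" for s t
    by (metis sym dot_lmul_matrix inner_commute vector_transpose_matrix)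
  show ?case
  proof (cases "\<forall>v. v \<bullet> (V *v v) = 0")
    case True
    have "V = 0"
    proof -
      have "V *v v = 0 *v v" for v using psd_mult_eq_0[OF sym psd] True by simp
      then show ?thesis by (simp add: matrix_eq)
    qed
    have [measurable]: "(cis :: real \<Rightarrow> complex) \<in> borel_measurable borel"
      by (intro borel_measurable_continuous_onI continuous_intros)
    have "normal_vec V (return borel 0)"
      unfolding normal_vec_def \<open>V = 0\<close>
      by (simp add: prob_space_return integral_return)
    then show ?thesis by blast
  next
    case False
    then obtain v where v: "v \<bullet> (V *v v) \<noteq> 0" by blast
    define d where "d = v \<bullet> (V *v v)"
    have d: "d > 0" using v psd[of v] by (simp add: d_def)
    define w where "w = (1 / sqrt d) *\<^sub>R (V *v v)"
    define V' where "V' = V - outer w w"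
    have V': "V' *v t = V *v t - (w \<bullet> t) *\<^sub>R w" for t
      by (simp add: V'_def matrix_vector_mult_diff_rdistrib outer_mult_vec)
    have wt: "(w \<bullet> t) = (v \<bullet> (V *v t)) / sqrt d" for t
      by (simp add: w_def inner_commute[of "V *v v"] eq[of t v])
    have sym': "transpose V' = V'"
      using sym by (simp add: V'_def transpose_def outer_def vec_eq_iff mult.commute)
    have psd': "0 \<le> t \<bullet> (V' *v t)" for t
    proof -
      \<comment> \<open>This \<open>l\<close> minimises the form along
        \<open>t - l *\<^sub>R v\<close>. Nonnegativity at the minimum is the Cauchy-Schwarz
        inequality for \<open>V\<close>, which is what positivity of \<open>V'\<close> says.\<close>
      define l where "l = (v \<bullet> (V *v t)) / d"
      have "0 \<le> (t - l *\<^sub>R v) \<bullet> (V *v (t - l *\<^sub>R v))" by (rule psd)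
      also have "\<dots> = t \<bullet> (V *v t) - 2 * l * (v \<bullet> (V *v t)) + l * l * d"
        by (simp add: matrix_vector_mult_diff_distrib matrix_vector_mult_scaleR inner_diff_left
            inner_diff_right eq[of t v] d_def algebra_simps)
      also have "\<dots> = t \<bullet> (V *v t) - (v \<bullet> (V *v t))\<^sup>2 / d"
        using d by (simp add: l_def field_simps power2_eq_square)
      also have "\<dots> = t \<bullet> (V' *v t)"
        using d wt[of t] by (simp add: V' inner_diff_right inner_commute[of t w] power2_eq_square)
      finally show ?thesis .
    qed
    \<comment> \<open>The kernel grows: \<open>w \<bullet> t\<close> vanishes wherever
      \<open>V *v t\<close> does, and \<open>v\<close> itself is new.\<close>
    have "{t. V *v t = 0} \<subset> {t. V' *v t = 0}"
    proof
      show "{t. V *v t = 0} \<subseteq> {t. V' *v t = 0}" by (auto simp: V' wt)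
      have "V' *v v = 0"
        using d by (simp add: V' wt d_def[symmetric]) (simp add: w_def real_div_sqrt)
      moreover have "V *v v \<noteq> 0" using v by auto
      ultimately show "{t. V *v t = 0} \<noteq> {t. V' *v t = 0}" by blast
    qed
    moreover have "subspace {t. A *v t = 0}" for A :: "real^'n^'n"
      by (auto simp: subspace_def matrix_vector_right_distrib matrix_vector_mult_scaleR)
    ultimately have "dim {t. V *v t = 0} < dim {t. V' *v t = 0}"
      by (intro dim_psubset) (metis span_eq_iff)
    moreover have "dim {t. V' *v t = 0} \<le> CARD('n)"
      using dim_subset_UNIV[of "{t. V' *v t = 0}"] by simp
    ultimately obtain G where "normal_vec V' G"
      using less.hyps[of V'] sym' psd' by fastforce
    from normal_vec_add_rank_one[OF this, of w] show ?thesis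
      by (auto simp: V'_def)
  qed
qed

section \<open>Gaussian smoothing of test functions\<close>

lemma borel_measurable_cis [measurable]: "cis \<in> borel_measurable borel"
  by (intro borel_measurable_continuous_onI continuous_intros)

lemma normal_vec_kernel:
  assumes "c > 0"
  obtains \<Gamma> :: "(real^'n) measure" where "prob_space \<Gamma>" "sets \<Gamma> = sets borel"
    "\<And>x. (\<integral>u. cis (u \<bullet> x) \<partial>\<Gamma>) = complex_of_real (exp (- (c * (norm x)\<^sup>2) / 2))"
proof -
  have mv: "((c *\<^sub>R mat 1 :: real^'n^'n) *v t) = c *\<^sub>R t" for t
    by (simp add: scaleR_matrix_vector_assoc[symmetric])
  have "\<exists>\<Gamma>. normal_vec (c *\<^sub>R mat 1 :: real^'n^'n) \<Gamma>"
  proof (rule normal_vec_exists)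
    show "transpose (c *\<^sub>R mat 1 :: real^'n^'n) = c *\<^sub>R mat 1"
      by (simp add: transpose_def mat_def vec_eq_iff)
    show "0 \<le> t \<bullet> ((c *\<^sub>R mat 1 :: real^'n^'n) *v t)" for t
      using assms by (simp add: mv)
  qed
  then show ?thesis
    using that by (auto simp: normal_vec_def mv power2_norm_eq_inner inner_commute)
qed

text \<open>Fubini turns the expectation of a bump into a \<open>\<Gamma>\<close>-average of
  characteristic functions. These are bounded by 1, so their pointwise convergence passes through
  the average by dominated convergence, before anything is known about tightness.\<close>

lemma gauss_expectation_tendsto:
  fixes \<mu> :: "nat \<Rightarrow> (real^'n) measure"
  assumes \<mu>: "\<And>n. prob_space (\<mu> n)" "\<And>n. sets (\<mu> n) = sets borel"
    and G: "prob_space G" "sets G = sets borel"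
    and conv: "\<And>t. (\<lambda>n. \<integral>x. cis (t \<bullet> x) \<partial>\<mu> n) \<longlonglongrightarrow> (\<integral>x. cis (t \<bullet> x) \<partial>G)"
    and c: "c > 0"
  shows "(\<lambda>n. \<integral>z. exp (- (c * (norm (z - x))\<^sup>2) / 2) \<partial>\<mu> n) \<longlonglongrightarrow> (\<integral>z. exp (- (c * (norm (z - x))\<^sup>2) / 2) \<partial>G)"
proof -
  obtain \<Gamma> :: "(real^'n) measure" where \<Gamma>: "prob_space \<Gamma>" and sets\<Gamma>[measurable_cong]: "sets \<Gamma> = sets borel"
    and ch: "\<And>x. (\<integral>u. cis (u \<bullet> x) \<partial>\<Gamma>) = complex_of_real (exp (- (c * (norm x)\<^sup>2) / 2))"
    using normal_vec_kernel[OF c] by blast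
  interpret \<Gamma>: prob_space \<Gamma> by fact
  have key: "complex_of_real (\<integral>z. exp (- (c * (norm (z - x))\<^sup>2) / 2) \<partial>\<nu>)
      = (\<integral>u. cis (- (u \<bullet> x)) * (\<integral>z. cis (u \<bullet> z) \<partial>\<nu>) \<partial>\<Gamma>)"
    if "prob_space \<nu>" and s[measurable_cong]: "sets \<nu> = sets borel" for \<nu> :: "(real^'n) measure"
  proof -
    interpret \<nu>: prob_space \<nu> by fact
    interpret PP: pair_prob_space \<nu> \<Gamma> ..
    have "complex_of_real (\<integral>z. exp (- (c * (norm (z - x))\<^sup>2) / 2) \<partial>\<nu>)
       = (\<integral>z. \<integral>u. cis (u \<bullet> (z - x)) \<partial>\<Gamma> \<partial>\<nu>)"
      by (simp add: ch del: of_real_exp)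
    also have "\<dots> = (\<integral>u. \<integral>z. cis (u \<bullet> (z - x)) \<partial>\<nu> \<partial>\<Gamma>)"
      by (rule PP.Fubini_integral[symmetric])
        (auto intro!: PP.integrable_const_bound[where B=1] simp: split_beta)
    also have "\<dots> = (\<integral>u. cis (- (u \<bullet> x)) * (\<integral>z. cis (u \<bullet> z) \<partial>\<nu>) \<partial>\<Gamma>)"
    proof -
      have "cis (u \<bullet> (z - x)) = cis (- (u \<bullet> x)) * cis (u \<bullet> z)" for u z
        by (simp add: cis_mult inner_diff_right)
      then show ?thesis by simp
    qed
    finally show ?thesis .
  qed
  have "(\<lambda>n. \<integral>u. cis (- (u \<bullet> x)) * (\<integral>z. cis (u \<bullet> z) \<partial>\<mu> n) \<partial>\<Gamma>) \<longlonglongrightarrow>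
      (\<integral>u. cis (- (u \<bullet> x)) * (\<integral>z. cis (u \<bullet> z) \<partial>G) \<partial>\<Gamma>)"
  proof (rule integral_dominated_convergence[where w="\<lambda>_. 1"])
    show "(\<lambda>u. cis (- (u \<bullet> x)) * (\<integral>z. cis (u \<bullet> z) \<partial>G)) \<in> borel_measurable \<Gamma>"
    proof -
      interpret G: prob_space G by fact
      have [measurable_cong]: "sets G = sets borel" by fact
      show ?thesis by measurable
    qed
    show "(\<lambda>u. cis (- (u \<bullet> x)) * (\<integral>z. cis (u \<bullet> z) \<partial>\<mu> n)) \<in> borel_measurable \<Gamma>" for n
    proof -
      interpret G: prob_space "\<mu> n" by (rule \<mu>)
      have [measurable_cong]: "sets (\<mu> n) = sets borel" by (rule \<mu>)
      show ?thesis by measurable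
    qed
    show "AE u in \<Gamma>. norm (cis (- (u \<bullet> x)) * (\<integral>z. cis (u \<bullet> z) \<partial>\<mu> n)) \<le> 1" for n
    proof (rule AE_I2)
      fix u
      interpret G: prob_space "\<mu> n" by (rule \<mu>)
      have [measurable_cong]: "sets (\<mu> n) = sets borel" by (rule \<mu>)
      have "norm (\<integral>z. cis (u \<bullet> z) \<partial>\<mu> n) \<le> (\<integral>z. norm (cis (u \<bullet> z)) \<partial>\<mu> n)"
        by (rule integral_norm_bound)
      then show "norm (cis (- (u \<bullet> x)) * (\<integral>z. cis (u \<bullet> z) \<partial>\<mu> n)) \<le> 1"
        by (simp add: norm_mult G.prob_space)
    qed
  qed (auto intro!: tendsto_intros conv)
  then have "(\<lambda>n. complex_of_real (\<integral>z. exp (- (c * (norm (z - x))\<^sup>2) / 2) \<partial>\<mu> n))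
     \<longlonglongrightarrow> complex_of_real (\<integral>z. exp (- (c * (norm (z - x))\<^sup>2) / 2) \<partial>G)"
    by (simp only: key[OF \<mu>] key[OF G])
  then show ?thesis by (simp only: tendsto_of_real_iff)
qed

text \<open>The density of N(0, \<sigma>^2 I), as a product over coordinates so that its Lebesgue
  integral factorises; \<open>gauss_kernel_eq\<close> gives the radial form.\<close>

definition gauss_kernel :: "real \<Rightarrow> 'a::euclidean_space \<Rightarrow> real" where
  "gauss_kernel \<sigma> x = (\<Prod>b\<in>Basis. normal_density 0 \<sigma> (x \<bullet> b))"

lemma gauss_kernel_eq:
  "gauss_kernel \<sigma> (x::'a::euclidean_space) = (1 / sqrt (2 * pi * \<sigma>\<^sup>2)) ^ DIM('a) * exp (- (norm x)\<^sup>2 / (2 * \<sigma>\<^sup>2))"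
proof -
  have "(norm x)\<^sup>2 = (\<Sum>b\<in>Basis. (x \<bullet> b)\<^sup>2)"
    unfolding power2_norm_eq_inner by (subst euclidean_inner) (simp add: power2_eq_square)
  then show ?thesis
    unfolding gauss_kernel_def normal_density_def
    by (simp only: prod.distrib prod_constant diff_0_right flip: exp_sum[OF finite_Basis])
      (simp add: sum_divide_distrib sum_negf)
qed

lemma gauss_kernel_nonneg: "0 \<le> gauss_kernel \<sigma> x"
  by (simp add: gauss_kernel_def prod_nonneg)

lemma borel_measurable_gauss_kernel [measurable]: "gauss_kernel \<sigma> \<in> borel_measurable borel"
  unfolding gauss_kernel_def[abs_def] by measurable

lemma has_bochner_integral_gauss_kernel:
  assumes "\<sigma> > 0"
  shows "has_bochner_integral lborel (gauss_kernel \<sigma>) 1"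
proof (rule has_bochner_integral_nn_integral)
  have "(\<integral>\<^sup>+ x. ennreal (gauss_kernel \<sigma> (x::'a)) \<partial>lborel)
      = (\<integral>\<^sup>+ x. (\<Prod>b\<in>Basis. ennreal (normal_density 0 \<sigma> ((x::'a) \<bullet> b))) \<partial>lborel)"
    by (simp add: gauss_kernel_def prod_ennreal)
  also have "\<dots> = (\<Prod>b\<in>(Basis::'a set). (\<integral>\<^sup>+x. ennreal (normal_density 0 \<sigma> x) \<partial>lborel))"
    by (rule nn_integral_lborel_prod) auto
  also have "(\<integral>\<^sup>+x. ennreal (normal_density 0 \<sigma> x) \<partial>lborel) = 1"
    using assms by (subst nn_integral_eq_integral) auto
  finally show "(\<integral>\<^sup>+ x. ennreal (gauss_kernel \<sigma> (x::'a)) \<partial>lborel) = ennreal 1" by simp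
qed (auto simp: gauss_kernel_nonneg)

text \<open>Half of the exponent is spent on \<open>\<delta> \<le> norm u\<close>. The other half is
  again a Gaussian kernel, of width sqrt 2 times \<sigma> and hence with integral 1; the power of
  \<open>sqrt 2\<close> is the ratio of the two normalising constants.\<close>

lemma gauss_kernel_tail:
  fixes u :: "'a::euclidean_space"
  assumes \<sigma>: "\<sigma> > 0" and \<delta>: "\<delta> > 0" and u: "\<delta> \<le> norm u"
  shows "gauss_kernel \<sigma> u \<le> exp (- \<delta>\<^sup>2 / (4 * \<sigma>\<^sup>2)) * sqrt 2 ^ DIM('a) * gauss_kernel (sqrt 2 * \<sigma>) u"
proof -
  have "\<delta>\<^sup>2 \<le> (norm u)\<^sup>2" using u \<delta> by (intro power_mono) auto
  then have "- (norm u)\<^sup>2 / (2 * \<sigma>\<^sup>2) \<le> - \<delta>\<^sup>2 / (4 * \<sigma>\<^sup>2) - (norm u)\<^sup>2 / (4 * \<sigma>\<^sup>2)"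
    using \<sigma> by (simp add: field_simps)
  then have "exp (- (norm u)\<^sup>2 / (2 * \<sigma>\<^sup>2)) \<le> exp (- \<delta>\<^sup>2 / (4 * \<sigma>\<^sup>2)) * exp (- (norm u)\<^sup>2 / (4 * \<sigma>\<^sup>2))"
    by (simp add: exp_add[symmetric] del: exp_add)
  moreover have "(1 / sqrt (2 * pi * \<sigma>\<^sup>2)) ^ DIM('a) = sqrt 2 ^ DIM('a) * (1 / sqrt (2 * pi * (sqrt 2 * \<sigma>)\<^sup>2)) ^ DIM('a)"
  proof -
    have "1 / sqrt (2 * pi * \<sigma>\<^sup>2) = sqrt 2 * (1 / sqrt (2 * pi * (sqrt 2 * \<sigma>)\<^sup>2))"
      using \<sigma> by (simp add: real_sqrt_mult)
    then show ?thesis by (simp only: power_mult_distrib)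
  qed
  ultimately show ?thesis
    unfolding gauss_kernel_eq using \<sigma>
    by (simp add: mult_ac power_mult_distrib mult_left_mono)
qed

text \<open>After exchanging the integrals the inner expectation converges for each
  \<open>z\<close>, and the bounded support of \<open>f\<close> turns the maximum \<open>K\<close>
  of the kernel into an integrable majorant.\<close>

lemma gauss_smoothing_tendsto:
  fixes \<mu> :: "nat \<Rightarrow> (real^'n) measure" and f :: "real^'n \<Rightarrow> real"
  assumes \<mu>: "\<And>n. prob_space (\<mu> n)" "\<And>n. sets (\<mu> n) = sets borel"
    and G: "prob_space G" "sets G = sets borel"
    and conv: "\<And>t. (\<lambda>n. \<integral>x. cis (t \<bullet> x) \<partial>\<mu> n) \<longlonglongrightarrow> (\<integral>x. cis (t \<bullet> x) \<partial>G)"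
    and \<sigma>: "\<sigma> > 0" and f[measurable]: "f \<in> borel_measurable borel"
    and B: "\<And>x. \<bar>f x\<bar> \<le> B" and R: "\<And>x. norm x > R \<Longrightarrow> f x = 0"
  shows "(\<lambda>n. \<integral>x. (\<integral>z. f z * gauss_kernel \<sigma> (x - z) \<partial>lborel) \<partial>\<mu> n)
     \<longlonglongrightarrow> (\<integral>x. (\<integral>z. f z * gauss_kernel \<sigma> (x - z) \<partial>lborel) \<partial>G)"
proof -
  define K where "K = (1 / sqrt (2 * pi * \<sigma>\<^sup>2)) ^ CARD('n)"
  have K0: "K \<ge> 0" by (simp add: K_def)
  have gk: "gauss_kernel \<sigma> (x::real^'n) = K * exp (- (norm x)\<^sup>2 / (2 * \<sigma>\<^sup>2))" for x
    by (simp add: gauss_kernel_eq K_def)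
  have gkK: "gauss_kernel \<sigma> (x::real^'n) \<le> K" for x
    using K0 by (simp add: gk mult_left_le)
  have dom: "\<bar>f z * g\<bar> \<le> B * K * indicator (cball 0 R) z" if "0 \<le> g" "g \<le> K" for g z
  proof (cases "norm z > R")
    case False
    have "\<bar>f z\<bar> * \<bar>g\<bar> \<le> B * K"
      using B[of z] that by (intro mult_mono) auto
    then show ?thesis using False by (simp add: abs_mult)
  qed (simp add: R)
  have intdom: "integrable lborel (\<lambda>z::real^'n. B * K * indicator (cball 0 R) z)"
    by (intro integrable_mult_right integrable_real_indicator) (simp_all add: emeasure_bounded_finite[unfolded infinity_ennreal_def])
  have swap: "(\<integral>x. (\<integral>z. f z * gauss_kernel \<sigma> (x - z) \<partial>lborel) \<partial>\<nu>) = (\<integral>z. f z * (\<integral>x. gauss_kernel \<sigma> (x - z) \<partial>\<nu>) \<partial>lborel)"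
    if "prob_space \<nu>" and s[measurable_cong]: "sets \<nu> = sets borel" for \<nu> :: "(real^'n) measure"
  proof -
    interpret \<nu>: prob_space \<nu> by fact
    interpret PP: pair_sigma_finite \<nu> "lborel :: (real^'n) measure" ..
    have "integrable (\<nu> \<Otimes>\<^sub>M lborel) (\<lambda>p. f (snd p) * gauss_kernel \<sigma> (fst p - snd p))"
    proof (rule PP.Fubini_integrable)
      have abs: "norm (f z * gauss_kernel \<sigma> (x - z)) \<le> B * K * indicator (cball 0 R) z" for x z
        using dom[OF gauss_kernel_nonneg gkK, of z "x - z"] by simp
      have i: "integrable lborel (\<lambda>z. f z * gauss_kernel \<sigma> (x - z))" for x
        by (rule Bochner_Integration.integrable_bound[OF intdom]) (use order.trans[OF abs abs_ge_self] in auto)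
      then show "AE x in \<nu>. integrable lborel (\<lambda>z. f (snd (x, z)) * gauss_kernel \<sigma> (fst (x, z) - snd (x, z)))"
        by simp
      have "norm (\<integral>z. norm (f z * gauss_kernel \<sigma> (x - z)) \<partial>lborel) \<le> (\<integral>z. B * K * indicator (cball 0 R) (z::real^'n) \<partial>lborel)" for x
        using integral_mono[OF integrable_norm[OF i] intdom abs] by simp
      then show "integrable \<nu> (\<lambda>x. \<integral>z. norm (f (snd (x, z)) * gauss_kernel \<sigma> (fst (x, z) - snd (x, z))) \<partial>lborel)"
        by (intro \<nu>.integrable_const_bound[where B="\<integral>z. B * K * indicator (cball 0 R) (z::real^'n) \<partial>lborel"]) auto
    qed measurable
    then have "integrable (\<nu> \<Otimes>\<^sub>M lborel) (\<lambda>(x, z). f z * gauss_kernel \<sigma> (x - z))"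
      by (simp only: case_prod_unfold)
    from PP.Fubini_integral[OF this] show ?thesis by simp
  qed
  have conv': "(\<lambda>n. \<integral>x. gauss_kernel \<sigma> (x - z) \<partial>\<mu> n) \<longlonglongrightarrow> (\<integral>x. gauss_kernel \<sigma> (x - z) \<partial>G)" for z
    using tendsto_mult_left[OF gauss_expectation_tendsto[OF \<mu> G conv, of "1 / \<sigma>\<^sup>2" z], of K] \<sigma>
    by (simp add: gk field_simps)
  have ker: "0 \<le> (\<integral>x. gauss_kernel \<sigma> (x - z) \<partial>\<nu>) \<and> (\<integral>x. gauss_kernel \<sigma> (x - z) \<partial>\<nu>) \<le> K"
    if "prob_space \<nu>" and s[measurable_cong]: "sets \<nu> = sets borel" for z and \<nu> :: "(real^'n) measure"
  proof -
    interpret \<nu>: prob_space \<nu> by fact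
    have "integrable \<nu> (\<lambda>x. gauss_kernel \<sigma> (x - z))"
      by (rule \<nu>.integrable_const_bound[where B=K]) (auto simp: gkK gauss_kernel_nonneg)
    from integral_mono[OF this \<nu>.integrable_const[of K]] show ?thesis
      by (simp add: gkK gauss_kernel_nonneg \<nu>.prob_space)
  qed
  have "(\<lambda>n. \<integral>z. f z * (\<integral>x. gauss_kernel \<sigma> (x - z) \<partial>\<mu> n) \<partial>lborel)
      \<longlonglongrightarrow> (\<integral>z. f z * (\<integral>x. gauss_kernel \<sigma> (x - z) \<partial>G) \<partial>lborel)"
  proof (rule integral_dominated_convergence[OF _ _ intdom])
    show "(\<lambda>z. f z * (\<integral>x. gauss_kernel \<sigma> (x - z) \<partial>G)) \<in> borel_measurable lborel"
    proof -
      interpret G: prob_space G by fact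
      have [measurable_cong]: "sets G = sets borel" by fact
      show ?thesis by measurable
    qed
    show "(\<lambda>z. f z * (\<integral>x. gauss_kernel \<sigma> (x - z) \<partial>\<mu> n)) \<in> borel_measurable lborel" for n
    proof -
      interpret G: prob_space "\<mu> n" by (rule \<mu>)
      have [measurable_cong]: "sets (\<mu> n) = sets borel" by (rule \<mu>)
      show ?thesis by measurable
    qed
    show "AE z in lborel. (\<lambda>n. f z * (\<integral>x. gauss_kernel \<sigma> (x - z) \<partial>\<mu> n)) \<longlonglongrightarrow> f z * (\<integral>x. gauss_kernel \<sigma> (x - z) \<partial>G)"
      by (intro AE_I2 tendsto_mult_left conv')
    show "AE z in lborel. norm (f z * (\<integral>x. gauss_kernel \<sigma> (x - z) \<partial>\<mu> n)) \<le> B * K * indicator (cball 0 R) z" for n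
      using ker[OF \<mu>] dom by (intro AE_I2) auto
  qed
  then show ?thesis by (simp only: swap[OF \<mu>] swap[OF G])
qed

lemma gauss_smoothing_uniform:
  fixes f :: "'a::euclidean_space \<Rightarrow> real"
  assumes f[measurable]: "f \<in> borel_measurable borel" and B: "\<And>x. \<bar>f x\<bar> \<le> B"
    and uc: "uniformly_continuous_on UNIV f" and \<epsilon>: "\<epsilon> > 0"
  obtains \<sigma> where "\<sigma> > 0" "\<And>x. \<bar>(\<integral>z. f z * gauss_kernel \<sigma> (x - z) \<partial>lborel) - f x\<bar> \<le> \<epsilon>"
proof -
  have B0: "B \<ge> 0" using B[of 0] by linarith
  obtain \<delta> where \<delta>: "\<delta> > 0" and uc': "\<And>x y. dist y x < \<delta> \<Longrightarrow> dist (f y) (f x) < \<epsilon> / 2"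
    using uc[unfolded uniformly_continuous_on_def, rule_format, of "\<epsilon> / 2"] \<epsilon> by auto
  \<comment> \<open>\<open>2 * B\<close> bounds the oscillation of \<open>f\<close>, and the power
    of \<open>sqrt 2\<close> is the one in \<open>gauss_kernel_tail\<close>. The exponential factor
    tends to 0 with \<sigma>, so a small \<sigma> brings the far part below
    \<open>\<epsilon> / 2\<close>.\<close>
  define C where "C = 2 * B * sqrt 2 ^ DIM('a)"
  have "((\<lambda>\<sigma>. exp (- \<delta>\<^sup>2 / (4 * \<sigma>\<^sup>2)) * C) \<longlongrightarrow> 0) (at_right 0)"
    using \<delta> by real_asymp
  then have "eventually (\<lambda>\<sigma>. exp (- \<delta>\<^sup>2 / (4 * \<sigma>\<^sup>2)) * C < \<epsilon> / 2) (at_right 0)"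
    using \<epsilon> by (intro order_tendstoD) auto
  moreover have "eventually (\<lambda>\<sigma>::real. \<sigma> > 0) (at_right 0)" by (simp add: eventually_at_right_less)
  ultimately have "eventually (\<lambda>\<sigma>. exp (- \<delta>\<^sup>2 / (4 * \<sigma>\<^sup>2)) * C < \<epsilon> / 2 \<and> \<sigma> > 0) (at_right 0)"
    by (rule eventually_conj)
  then obtain \<sigma> where \<sigma>: "\<sigma> > 0" "exp (- \<delta>\<^sup>2 / (4 * \<sigma>\<^sup>2)) * C < \<epsilon> / 2"
    using eventually_happens'[OF trivial_limit_at_right_real] by blast
  have intk: "integrable lborel (gauss_kernel s :: 'a \<Rightarrow> real)" and valk: "integral\<^sup>L lborel (gauss_kernel s :: 'a \<Rightarrow> real) = 1"
    if "s > 0" for s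
    using has_bochner_integral_gauss_kernel[OF that, where 'a='a] by (auto simp: has_bochner_integral_iff)
  have "\<bar>(\<integral>z. f z * gauss_kernel \<sigma> (x - z) \<partial>lborel) - f x\<bar> \<le> \<epsilon>" for x
  proof -
    have sym: "gauss_kernel \<sigma> (- u) = gauss_kernel \<sigma> u" for u :: 'a by (simp add: gauss_kernel_eq)
    \<comment> \<open>Translation invariance of Lebesgue measure moves \<open>x\<close> from the
      kernel into \<open>f\<close>, where uniform continuity can act.\<close>
    have "(\<integral>z. f z * gauss_kernel \<sigma> (x - z) \<partial>lborel) = (\<integral>z. f z * gauss_kernel \<sigma> (x - z) \<partial>distr lborel borel ((+) x))"
      by (simp add: lborel_distr_plus)
    also have "\<dots> = (\<integral>u. f (x + u) * gauss_kernel \<sigma> u \<partial>lborel)"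
      by (subst integral_distr) (auto simp: sym)
    finally have 1: "(\<integral>z. f z * gauss_kernel \<sigma> (x - z) \<partial>lborel) = (\<integral>u. f (x + u) * gauss_kernel \<sigma> u \<partial>lborel)" .
    have i1: "integrable lborel (\<lambda>u. f (x + u) * gauss_kernel \<sigma> u)"
      by (rule Bochner_Integration.integrable_bound[OF integrable_mult_right[OF intk[OF \<sigma>(1)], of B]])
        (auto simp: abs_mult gauss_kernel_nonneg intro!: mult_right_mono order.trans[OF B])
    have i2: "integrable lborel (\<lambda>u. f x * gauss_kernel \<sigma> (u::'a))"
      by (rule integrable_mult_right[OF intk[OF \<sigma>(1)]])
    have 2: "(\<integral>u. f (x + u) * gauss_kernel \<sigma> u \<partial>lborel) - f x = (\<integral>u. f (x + u) * gauss_kernel \<sigma> u - f x * gauss_kernel \<sigma> u \<partial>lborel)"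
      using valk[OF \<sigma>(1)] by (simp add: Bochner_Integration.integral_diff[OF i1 i2])
    \<comment> \<open>A majorant with known integral: the first summand covers displacements below
      \<open>\<delta>\<close> by uniform continuity, the second covers the rest by the tail
      bound.\<close>
    let ?w = "\<lambda>u::'a. \<epsilon> / 2 * gauss_kernel \<sigma> u + exp (- \<delta>\<^sup>2 / (4 * \<sigma>\<^sup>2)) * C * gauss_kernel (sqrt 2 * \<sigma>) u"
    have iw: "integrable lborel ?w"
      using \<sigma> by (intro Bochner_Integration.integrable_add integrable_mult_right intk) auto
    have bd: "norm (f (x + u) * gauss_kernel \<sigma> u - f x * gauss_kernel \<sigma> u) \<le> ?w u" for u
    proof (cases "norm u < \<delta>")
      case True
      then have "\<bar>f (x + u) - f x\<bar> \<le> \<epsilon> / 2"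
        using uc'[of "x + u" x] by (simp add: dist_norm less_imp_le)
      then have "\<bar>f (x + u) - f x\<bar> * gauss_kernel \<sigma> u \<le> \<epsilon> / 2 * gauss_kernel \<sigma> u"
        by (intro mult_right_mono gauss_kernel_nonneg)
      moreover have "0 \<le> exp (- \<delta>\<^sup>2 / (4 * \<sigma>\<^sup>2)) * C * gauss_kernel (sqrt 2 * \<sigma>) u"
        using B0 by (auto simp: C_def intro!: mult_nonneg_nonneg gauss_kernel_nonneg)
      ultimately show ?thesis
        by (simp add: left_diff_distrib[symmetric] abs_mult gauss_kernel_nonneg)
    next
      case False
      have "\<bar>f (x + u) - f x\<bar> \<le> 2 * B" using B[of "x + u"] B[of x] by linarith
      then have "\<bar>f (x + u) - f x\<bar> * gauss_kernel \<sigma> u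
          \<le> 2 * B * (exp (- \<delta>\<^sup>2 / (4 * \<sigma>\<^sup>2)) * sqrt 2 ^ DIM('a) * gauss_kernel (sqrt 2 * \<sigma>) u)"
        using False B0 by (intro mult_mono gauss_kernel_tail \<sigma> \<delta> gauss_kernel_nonneg) auto
      also have "\<dots> = exp (- \<delta>\<^sup>2 / (4 * \<sigma>\<^sup>2)) * C * gauss_kernel (sqrt 2 * \<sigma>) u"
        by (simp add: C_def)
      finally show ?thesis using \<epsilon>
        by (simp add: left_diff_distrib[symmetric] abs_mult gauss_kernel_nonneg add_increasing)
    qed
    have "\<bar>(\<integral>u. f (x + u) * gauss_kernel \<sigma> u - f x * gauss_kernel \<sigma> u \<partial>lborel)\<bar> \<le> integral\<^sup>L lborel ?w"
      using Bochner_Integration.integral_norm_bound_integral[OF Bochner_Integration.integrable_diff[OF i1 i2] iw bd] by simp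
    also have "\<dots> = \<epsilon> / 2 + exp (- \<delta>\<^sup>2 / (4 * \<sigma>\<^sup>2)) * C"
      using \<sigma> valk[of \<sigma>] valk[of "sqrt 2 * \<sigma>"] intk[of \<sigma>] intk[of "sqrt 2 * \<sigma>"] by simp
    also have "\<dots> \<le> \<epsilon>" using \<sigma> by simp
    finally show ?thesis using 1 2 by simp
  qed
  with \<sigma>(1) that show ?thesis by blast
qed

section \<open>From Gaussian mixtures to bounded continuous functions\<close>

lemma uniformly_continuous_compact_support:
  fixes f :: "'a::euclidean_space \<Rightarrow> real"
  assumes f: "continuous_on UNIV f" and R: "\<And>x. norm x > R \<Longrightarrow> f x = 0"
  shows "uniformly_continuous_on UNIV f"
  unfolding uniformly_continuous_on_def
proof (intro allI impI)
  fix e :: real assume e: "e > 0"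
  have "uniformly_continuous_on (cball 0 (R + 1)) f"
    using f by (intro compact_uniformly_continuous continuous_on_subset[OF f]) auto
  then obtain d where d: "d > 0"
    "\<And>x y. x \<in> cball 0 (R + 1) \<Longrightarrow> y \<in> cball 0 (R + 1) \<Longrightarrow> dist y x < d \<Longrightarrow> dist (f y) (f x) < e"
    using e unfolding uniformly_continuous_on_def by metis
  have "dist (f y) (f x) < e" if "dist y x < min d 1" for x y
  proof (cases "norm x \<le> R + 1 \<and> norm y \<le> R + 1")
    case True
    then show ?thesis using d that by auto
  next
    case False
    \<comment> \<open>The margin 1 around the support pays off here: if one point lies outside
      radius \<open>R + 1\<close>, a point at distance below 1 from it is still outside radius
      \<open>R\<close>, where \<open>f\<close> vanishes.\<close>
    have "\<bar>norm x - norm y\<bar> < 1"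
      using that norm_triangle_ineq3[of x y] by (simp add: dist_norm norm_minus_commute)
    with False have "norm x > R" "norm y > R" by auto
    then show ?thesis using e by (simp add: R)
  qed
  then show "\<exists>d>0. \<forall>x\<in>UNIV. \<forall>y\<in>UNIV. dist y x < d \<longrightarrow> dist (f y) (f x) < e"
    using d(1) by (intro exI[of _ "min d 1"]) auto
qed

lemma levy_continuity_compact_support:
  fixes \<mu> :: "nat \<Rightarrow> (real^'n) measure" and f :: "real^'n \<Rightarrow> real"
  assumes \<mu>: "\<And>n. prob_space (\<mu> n)" "\<And>n. sets (\<mu> n) = sets borel"
    and G: "prob_space G" "sets G = sets borel"
    and conv: "\<And>t. (\<lambda>n. \<integral>x. cis (t \<bullet> x) \<partial>\<mu> n) \<longlonglongrightarrow> (\<integral>x. cis (t \<bullet> x) \<partial>G)"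
    and f: "continuous_on UNIV f" and B: "\<And>x. \<bar>f x\<bar> \<le> B" and R: "\<And>x. norm x > R \<Longrightarrow> f x = 0"
  shows "(\<lambda>n. \<integral>x. f x \<partial>\<mu> n) \<longlonglongrightarrow> (\<integral>x. f x \<partial>G)"
proof (rule LIMSEQ_I)
  fix r :: real assume r: "r > 0"
  have f_meas[measurable]: "f \<in> borel_measurable borel" by (rule borel_measurable_continuous_onI[OF f])
  have uc: "uniformly_continuous_on UNIV f" by (rule uniformly_continuous_compact_support[OF f R])
  obtain \<sigma> where \<sigma>: "\<sigma> > 0" and ap: "\<And>x. \<bar>(\<integral>z. f z * gauss_kernel \<sigma> (x - z) \<partial>lborel) - f x\<bar> \<le> r / 4"
    using gauss_smoothing_uniform[OF f_meas B uc, of "r / 4"] r by auto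
  define g where "g = (\<lambda>x. \<integral>z. f z * gauss_kernel \<sigma> (x - z) \<partial>lborel)"
  have [measurable]: "g \<in> borel_measurable borel" unfolding g_def by measurable
  have near: "\<bar>(\<integral>x. f x \<partial>\<nu>) - (\<integral>x. g x \<partial>\<nu>)\<bar> \<le> r / 4"
    if "prob_space \<nu>" and s[measurable_cong]: "sets \<nu> = sets borel" for \<nu> :: "(real^'n) measure"
  proof -
    interpret \<nu>: prob_space \<nu> by fact
    have i1: "integrable \<nu> f" by (rule \<nu>.integrable_const_bound[where B=B]) (auto simp: B)
    have "norm (g x) \<le> B + r / 4" for x
      using ap[of x] B[of x] unfolding g_def real_norm_def by linarith
    then have i2: "integrable \<nu> g" by (intro \<nu>.integrable_const_bound[where B="B + r / 4"]) auto
    have "\<bar>\<integral>x. f x - g x \<partial>\<nu>\<bar> \<le> (\<integral>x. r / 4 \<partial>\<nu>)"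
      using ap by (intro integral_abs_bound_integral Bochner_Integration.integrable_diff i1 i2)
        (auto simp: g_def abs_minus_commute)
    then show ?thesis by (simp add: i1 i2 \<nu>.prob_space)
  qed
  from gauss_smoothing_tendsto[OF \<mu> G conv \<sigma> f_meas B R, folded g_def]
  obtain N where N: "\<And>n. n \<ge> N \<Longrightarrow> norm ((\<integral>x. g x \<partial>\<mu> n) - (\<integral>x. g x \<partial>G)) < r / 4"
    using r by (metis LIMSEQ_D zero_less_divide_iff zero_less_numeral)
  show "\<exists>no. \<forall>n\<ge>no. norm ((\<integral>x. f x \<partial>\<mu> n) - (\<integral>x. f x \<partial>G)) < r"
  proof (intro exI allI impI)
    fix n assume "n \<ge> N"
    from N[OF this] near[OF \<mu>, of n] near[OF G] r
    show "norm ((\<integral>x. f x \<partial>\<mu> n) - (\<integral>x. f x \<partial>G)) < r" unfolding real_norm_def by linarith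
  qed
qed

text \<open>No mass escapes to infinity: a compactly supported cut-off \<open>\<xi> k\<close> has
  \<open>G\<close>-expectation close to 1, the compactly supported case carries this over to
  \<open>\<mu> n\<close>, and then both integrals of \<open>f\<close> may be replaced by integrals
  of \<open>f\<close> times the cut-off.\<close>

theorem levy_continuity_vec:
  fixes \<mu> :: "nat \<Rightarrow> (real^'n) measure" and f :: "real^'n \<Rightarrow> real"
  assumes \<mu>: "\<And>n. prob_space (\<mu> n)" "\<And>n. sets (\<mu> n) = sets borel"
    and G: "prob_space G" "sets G = sets borel"
    and conv: "\<And>t. (\<lambda>n. \<integral>x. cis (t \<bullet> x) \<partial>\<mu> n) \<longlonglongrightarrow> (\<integral>x. cis (t \<bullet> x) \<partial>G)"
    and f: "continuous_on UNIV f" and B: "\<And>x. \<bar>f x\<bar> \<le> B"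
  shows "(\<lambda>n. \<integral>x. f x \<partial>\<mu> n) \<longlonglongrightarrow> (\<integral>x. f x \<partial>G)"
proof (rule LIMSEQ_I)
  fix r :: real assume r: "r > 0"
  interpret G: prob_space G by fact
  have sG[measurable_cong]: "sets G = sets borel" by fact
  have B0: "B \<ge> 0" using B[of 0] by linarith
  have f_meas[measurable]: "f \<in> borel_measurable borel" by (rule borel_measurable_continuous_onI[OF f])
  \<comment> \<open>Equal to 1 on the ball of radius k, zero from radius k + 1 on, linear in the
    norm between.\<close>
  define \<xi> where "\<xi> = (\<lambda>(k::nat) (x::real^'n). max 0 (min 1 (real k + 1 - norm x)))"
  have \<xi>cont: "continuous_on UNIV (\<xi> k)" for k unfolding \<xi>_def by (intro continuous_intros)
  have [measurable]: "\<xi> k \<in> borel_measurable borel" for k by (rule borel_measurable_continuous_onI[OF \<xi>cont])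
  have \<xi>01: "0 \<le> \<xi> k x" "\<xi> k x \<le> 1" for k x by (auto simp: \<xi>_def)
  have \<xi>0: "\<xi> k x = 0" if "norm x > real k + 1" for k x using that by (simp add: \<xi>_def)
  have "(\<lambda>k. \<integral>x. \<xi> k x \<partial>G) \<longlonglongrightarrow> (\<integral>x. 1 \<partial>G)"
  proof (rule integral_dominated_convergence[where w="\<lambda>_. 1"])
    show "AE x in G. (\<lambda>k. \<xi> k x) \<longlonglongrightarrow> 1"
    proof (rule AE_I2)
      fix x
      have "eventually (\<lambda>k. \<xi> k x = 1) sequentially"
        using eventually_ge_at_top[of "nat \<lceil>norm x\<rceil>"]
      proof eventually_elim
        case (elim k)
        then have "norm x \<le> real k" by linarith
        then show ?case by (simp add: \<xi>_def)
      qed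
      then show "(\<lambda>k. \<xi> k x) \<longlonglongrightarrow> 1" by (rule tendsto_eventually)
    qed
  qed (auto simp: \<xi>01)
  then have "(\<lambda>k. \<integral>x. \<xi> k x \<partial>G) \<longlonglongrightarrow> 1" by (simp add: G.prob_space)
  \<comment> \<open>The replacement costs \<open>B\<close> times the missing mass, so this level
    makes it at most r/8 for each law; \<open>B + 1\<close> allows for \<open>B = 0\<close>.\<close>
  then have "eventually (\<lambda>k. (\<integral>x. \<xi> k x \<partial>G) > 1 - r / (8 * (B + 1))) sequentially"
    using r B0 by (intro order_tendstoD) auto
  then obtain k where k: "(\<integral>x. \<xi> k x \<partial>G) > 1 - r / (8 * (B + 1))"
    by (auto simp: eventually_sequentially)
  have \<xi>conv: "(\<lambda>n. \<integral>x. \<xi> k x \<partial>\<mu> n) \<longlonglongrightarrow> (\<integral>x. \<xi> k x \<partial>G)"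
    by (rule levy_continuity_compact_support[OF \<mu> G conv \<xi>cont, where B=1 and R="real k + 1"]) (auto simp: \<xi>01 \<xi>0)
  have f\<xi>: "continuous_on UNIV (\<lambda>x. f x * \<xi> k x)" by (intro continuous_intros f \<xi>cont)
  have fconv: "(\<lambda>n. \<integral>x. f x * \<xi> k x \<partial>\<mu> n) \<longlonglongrightarrow> (\<integral>x. f x * \<xi> k x \<partial>G)"
  proof (rule levy_continuity_compact_support[OF \<mu> G conv f\<xi>, where B=B and R="real k + 1"])
    show "\<bar>f x * \<xi> k x\<bar> \<le> B" for x
      using mult_mono[OF B[of x] \<xi>01(2)[of k x]] B0 \<xi>01[of k x] by (simp add: abs_mult)
  qed (auto simp: \<xi>0)
  have near: "\<bar>(\<integral>x. f x \<partial>\<nu>) - (\<integral>x. f x * \<xi> k x \<partial>\<nu>)\<bar> \<le> B * (1 - (\<integral>x. \<xi> k x \<partial>\<nu>))"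
    if "prob_space \<nu>" and s[measurable_cong]: "sets \<nu> = sets borel" for \<nu> :: "(real^'n) measure"
  proof -
    interpret \<nu>: prob_space \<nu> by fact
    have i1: "integrable \<nu> f" by (rule \<nu>.integrable_const_bound[where B=B]) (auto simp: B)
    have i3: "integrable \<nu> (\<xi> k)" by (rule \<nu>.integrable_const_bound[where B=1]) (auto simp: \<xi>01)
    have "norm (f x * \<xi> k x) \<le> B" for x
      using mult_mono[OF B[of x] \<xi>01(2)[of k x]] B0 \<xi>01[of k x] by (simp add: abs_mult)
    then have i2: "integrable \<nu> (\<lambda>x. f x * \<xi> k x)" by (intro \<nu>.integrable_const_bound[where B=B]) auto
    have "\<bar>\<integral>x. f x - f x * \<xi> k x \<partial>\<nu>\<bar> \<le> (\<integral>x. B * (1 - \<xi> k x) \<partial>\<nu>)"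
    proof (rule integral_abs_bound_integral)
      show "\<bar>f x - f x * \<xi> k x\<bar> \<le> B * (1 - \<xi> k x)" for x
      proof -
        have "f x - f x * \<xi> k x = f x * (1 - \<xi> k x)" by (simp add: algebra_simps)
        then have "\<bar>f x - f x * \<xi> k x\<bar> = \<bar>f x\<bar> * (1 - \<xi> k x)"
          using \<xi>01[of k x] by (simp add: abs_mult)
        then show ?thesis using B[of x] \<xi>01[of k x] by (simp add: mult_right_mono)
      qed
    qed (use i1 i2 i3 in auto)
    also have "\<dots> = B * (1 - (\<integral>x. \<xi> k x \<partial>\<nu>))" using i3 by (simp add: \<nu>.prob_space)
    finally show ?thesis by (simp add: i1 i2)
  qed
  have "eventually (\<lambda>n. (\<integral>x. \<xi> k x \<partial>\<mu> n) > 1 - r / (8 * (B + 1))) sequentially"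
    using order_tendstoD(1)[OF \<xi>conv k] .
  moreover have "eventually (\<lambda>n. \<bar>(\<integral>x. f x * \<xi> k x \<partial>\<mu> n) - (\<integral>x. f x * \<xi> k x \<partial>G)\<bar> < r / 2) sequentially"
    using tendstoD[OF fconv, of "r / 2"] r by (simp add: dist_real_def)
  ultimately have "eventually (\<lambda>n. norm ((\<integral>x. f x \<partial>\<mu> n) - (\<integral>x. f x \<partial>G)) < r) sequentially"
  proof eventually_elim
    case (elim n)
    have *: "B * (1 - I) \<le> r / 8" if "I > 1 - r / (8 * (B + 1))" for I
    proof -
      have "B * (1 - I) \<le> B * (r / (8 * (B + 1)))" using that B0 by (intro mult_left_mono) auto
      also have "\<dots> \<le> r / 8" using B0 r by (simp add: field_simps)
      finally show ?thesis .
    qed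
    show ?case
      using near[OF \<mu>, of n] near[OF G] *[OF elim(1)] *[OF k] elim(2) r unfolding real_norm_def by linarith
  qed
  then show "\<exists>no. \<forall>n\<ge>no. norm ((\<integral>x. f x \<partial>\<mu> n) - (\<integral>x. f x \<partial>G)) < r"
    by (simp add: eventually_sequentially)
qed

section \<open>Convergence in probability and Slutsky\<close>

text \<open>The limit is a constant because the probability spaces \<open>P n\<close> may differ
  from one another.\<close>

definition tendsto_prob :: "(nat \<Rightarrow> 'b measure) \<Rightarrow> (nat \<Rightarrow> 'b \<Rightarrow> 'c::real_normed_vector) \<Rightarrow> 'c \<Rightarrow> bool" where
  "tendsto_prob P Z c \<longleftrightarrow>
    (\<forall>\<epsilon>>0. (\<lambda>n. measure (P n) {x \<in> space (P n). norm (Z n x - c) \<ge> \<epsilon>}) \<longlonglongrightarrow> 0)"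

lemma norm_cis_diff_le: "norm (cis a - cis b) \<le> \<bar>a - b\<bar>"
proof -
  have "cis a - cis b = cis b * (cis (a - b) - 1)"
    by (simp add: cis_mult algebra_simps)
  then have "norm (cis a - cis b) = norm (cis (a - b) - 1)" by (simp add: norm_mult)
  also have "\<dots> \<le> \<bar>a - b\<bar>"
    using iexp_approx1[of "a - b" 0] by (simp add: cis_conv_exp)
  finally show ?thesis .
qed

text \<open>Continuity is asked for at the limit point only, because \<open>inv0\<close> is
  discontinuous at singular matrices.\<close>

lemma tendsto_prob_isCont:
  fixes Z :: "nat \<Rightarrow> 'b \<Rightarrow> 'c::euclidean_space" and g :: "'c \<Rightarrow> 'd::euclidean_space"
  assumes P: "\<And>n. prob_space (P n)" and Z[measurable]: "\<And>n. Z n \<in> borel_measurable (P n)"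
    and Zc: "tendsto_prob P Z c" and g: "isCont g c"
  shows "tendsto_prob P (\<lambda>n x. g (Z n x)) (g c)"
  unfolding tendsto_prob_def
proof (intro allI impI)
  fix \<epsilon> :: real assume "\<epsilon> > 0"
  then obtain \<delta> where \<delta>: "\<delta> > 0" "\<And>x. norm (x - c) < \<delta> \<Longrightarrow> norm (g x - g c) < \<epsilon>"
    using g unfolding continuous_at_eps_delta dist_norm by blast
  show "(\<lambda>n. measure (P n) {x \<in> space (P n). norm (g (Z n x) - g c) \<ge> \<epsilon>}) \<longlonglongrightarrow> 0"
  proof (rule tendsto_sandwich[OF _ _ tendsto_const])
    show "(\<lambda>n. measure (P n) {x \<in> space (P n). norm (Z n x - c) \<ge> \<delta>}) \<longlonglongrightarrow> 0"
      using Zc \<delta>(1) by (simp add: tendsto_prob_def)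
    show "eventually (\<lambda>n. measure (P n) {x \<in> space (P n). norm (g (Z n x) - g c) \<ge> \<epsilon>}
       \<le> measure (P n) {x \<in> space (P n). norm (Z n x - c) \<ge> \<delta>}) sequentially"
    proof (rule always_eventually, rule allI)
      fix n
      interpret prob_space "P n" by (rule P)
      have "{x \<in> space (P n). norm (g (Z n x) - g c) \<ge> \<epsilon>} \<subseteq> {x \<in> space (P n). norm (Z n x - c) \<ge> \<delta>}"
        using \<delta>(2) by (auto simp: not_less[symmetric])
      then show "measure (P n) {x \<in> space (P n). norm (g (Z n x) - g c) \<ge> \<epsilon>}
         \<le> measure (P n) {x \<in> space (P n). norm (Z n x - c) \<ge> \<delta>}"
        by (rule finite_measure_mono) measurable
    qed
  qed simp
qed


lemma char_fun_diff_tendsto: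
  fixes Z :: "nat \<Rightarrow> 'b \<Rightarrow> 'c::euclidean_space"
  assumes P: "\<And>n. prob_space (P n)" and [measurable]: "\<And>n. Z n \<in> borel_measurable (P n)" "\<And>n. Y n \<in> borel_measurable (P n)"
    and ZY: "tendsto_prob P (\<lambda>n x. Z n x - Y n x) 0"
    and Y: "(\<lambda>n. \<integral>x. cis (t \<bullet> Y n x) \<partial>P n) \<longlonglongrightarrow> l"
  shows "(\<lambda>n. \<integral>x. cis (t \<bullet> Z n x) \<partial>P n) \<longlonglongrightarrow> l"
proof -
  have "(\<lambda>n. (\<integral>x. cis (t \<bullet> Z n x) \<partial>P n) - (\<integral>x. cis (t \<bullet> Y n x) \<partial>P n)) \<longlonglongrightarrow> 0"
  proof (rule LIMSEQ_I)
    fix r :: real assume r: "r > 0"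
    \<comment> \<open>Where \<open>Z n\<close> and \<open>Y n\<close> are closer than this,
      \<open>cis\<close> moves by at most r/2; elsewhere it moves by at most 2, on an event of
      probability below r/4. The \<open>+ 1\<close> covers \<open>t = 0\<close>.\<close>
    define \<epsilon> where "\<epsilon> = r / (2 * (norm t + 1))"
    have \<epsilon>: "\<epsilon> > 0" using r by (simp add: \<epsilon>_def add_nonneg_pos)
    have "norm t * \<epsilon> \<le> (norm t + 1) * \<epsilon>" using \<epsilon> by simp
    also have "\<dots> = r / 2" 
    proof -
      have "norm t + 1 \<noteq> 0" using norm_ge_zero[of t] by linarith
      then show ?thesis unfolding \<epsilon>_def by (metis (no_types) divide_divide_eq_left' nonzero_mult_div_cancel_left times_divide_eq_right mult.commute)
    qed
    finally have "norm t * \<epsilon> \<le> r / 2" .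
    have "eventually (\<lambda>n. measure (P n) {x \<in> space (P n). norm (Z n x - Y n x) \<ge> \<epsilon>} < r / 4) sequentially"
      using ZY \<epsilon> r by (intro order_tendstoD) (auto simp: tendsto_prob_def)
    then have "eventually (\<lambda>n. norm ((\<integral>x. cis (t \<bullet> Z n x) \<partial>P n) - (\<integral>x. cis (t \<bullet> Y n x) \<partial>P n)) < r) sequentially"
    proof eventually_elim
      case (elim n)
      interpret prob_space "P n" by (rule P)
      let ?A = "{x \<in> space (P n). norm (Z n x - Y n x) \<ge> \<epsilon>}"
      have i: "integrable (P n) (\<lambda>x. cis (t \<bullet> Z n x))" "integrable (P n) (\<lambda>x. cis (t \<bullet> Y n x))"
        by (rule integrable_const_bound[where B=1]; simp)+
      have "norm ((\<integral>x. cis (t \<bullet> Z n x) \<partial>P n) - (\<integral>x. cis (t \<bullet> Y n x) \<partial>P n)) = norm (\<integral>x. cis (t \<bullet> Z n x) - cis (t \<bullet> Y n x) \<partial>P n)"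
        using i by simp
      also have "\<dots> \<le> (\<integral>x. norm (cis (t \<bullet> Z n x) - cis (t \<bullet> Y n x)) \<partial>P n)"
        by (rule integral_norm_bound)
      also have "\<dots> \<le> (\<integral>x. norm t * \<epsilon> + 2 * indicator ?A x \<partial>P n)"
      proof (rule integral_mono)
        fix x assume x: "x \<in> space (P n)"
        show "norm (cis (t \<bullet> Z n x) - cis (t \<bullet> Y n x)) \<le> norm t * \<epsilon> + 2 * indicator ?A x"
        proof (cases "norm (Z n x - Y n x) \<ge> \<epsilon>")
          case True
          have "norm (cis (t \<bullet> Z n x) - cis (t \<bullet> Y n x)) \<le> 2"
            using norm_triangle_ineq4[of "cis (t \<bullet> Z n x)" "cis (t \<bullet> Y n x)"] by simp
          then show ?thesis using x True \<epsilon> by (simp add: add_increasing)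
        next
          case False
          have "norm (cis (t \<bullet> Z n x) - cis (t \<bullet> Y n x)) \<le> \<bar>t \<bullet> (Z n x - Y n x)\<bar>"
            using norm_cis_diff_le[of "t \<bullet> Z n x" "t \<bullet> Y n x"] by (simp add: inner_diff_right)
          also have "\<dots> \<le> norm t * norm (Z n x - Y n x)" by (rule Cauchy_Schwarz_ineq2)
          also have "\<dots> \<le> norm t * \<epsilon>" using False by (intro mult_left_mono) auto
          finally show ?thesis using False by simp
        qed
      qed (use i in \<open>auto intro!: integrable_norm Bochner_Integration.integrable_add Bochner_Integration.integrable_diff integrable_mult_right integrable_real_indicator simp: emeasure_eq_measure\<close>)
      also have "\<dots> = norm t * \<epsilon> + 2 * measure (P n) ?A"
        by (subst Bochner_Integration.integral_add) (auto simp: prob_space emeasure_eq_measure intro!: integrable_mult_right integrable_real_indicator)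
      also have "\<dots> < r" using \<open>norm t * \<epsilon> \<le> r / 2\<close> elim by simp
      finally show ?case .
    qed
    then show "\<exists>no. \<forall>n\<ge>no. norm ((\<integral>x. cis (t \<bullet> Z n x) \<partial>P n) - (\<integral>x. cis (t \<bullet> Y n x) \<partial>P n) - 0) < r"
      by (simp add: eventually_sequentially)
  qed
  from tendsto_add[OF this Y] show ?thesis by simp
qed

text \<open>Tightness is read off from the limit law: a tail probability of \<open>T n\<close> is at
  most the expectation of a continuous ramp, which converges to its
  \<open>G\<close>-expectation.\<close>

lemma normal_vec_tight:
  fixes T :: "nat \<Rightarrow> 'b \<Rightarrow> real^'n"
  assumes P: "\<And>n. prob_space (P n)" and [measurable]: "\<And>n. T n \<in> borel_measurable (P n)"
    and G: "prob_space G" "sets G = sets borel"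
    and conv: "\<And>t. (\<lambda>n. \<integral>x. cis (t \<bullet> T n x) \<partial>P n) \<longlonglongrightarrow> (\<integral>x. cis (t \<bullet> x) \<partial>G)"
    and \<epsilon>: "\<epsilon> > 0"
  obtains R where "R > 0" "eventually (\<lambda>n. measure (P n) {x \<in> space (P n). norm (T n x) \<ge> R} < \<epsilon>) sequentially"
proof -
  interpret G: prob_space G by fact
  have [measurable_cong]: "sets G = sets borel" by fact
  define f where "f = (\<lambda>(k::nat) (x::real^'n). min 1 (max 0 (norm x - real k)))"
  have fc: "continuous_on UNIV (f k)" for k unfolding f_def by (intro continuous_intros)
  have [measurable]: "f k \<in> borel_measurable borel" for k by (rule borel_measurable_continuous_onI[OF fc])
  have f01: "0 \<le> f k x" "f k x \<le> 1" for k x by (auto simp: f_def)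
  have "(\<lambda>k. \<integral>x. f k x \<partial>G) \<longlonglongrightarrow> (\<integral>x. 0 \<partial>G)"
  proof (rule integral_dominated_convergence[where w="\<lambda>_. 1"])
    show "AE x in G. (\<lambda>k. f k x) \<longlonglongrightarrow> 0"
    proof (rule AE_I2)
      fix x
      have "eventually (\<lambda>k. f k x = 0) sequentially"
        using eventually_ge_at_top[of "nat \<lceil>norm x\<rceil>"]
      proof eventually_elim
        case (elim k)
        then have "norm x \<le> real k" by linarith
        then show ?case by (simp add: f_def)
      qed
      then show "(\<lambda>k. f k x) \<longlonglongrightarrow> 0" by (rule tendsto_eventually)
    qed
  qed (auto simp: f01)
  then have "eventually (\<lambda>k. (\<integral>x. f k x \<partial>G) < \<epsilon>) sequentially"
    using \<epsilon> by (intro order_tendstoD) auto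
  then obtain k where k: "(\<integral>x. f k x \<partial>G) < \<epsilon>" by (auto simp: eventually_sequentially)
  have "(\<lambda>n. \<integral>x. f k x \<partial>distr (P n) borel (T n)) \<longlonglongrightarrow> (\<integral>x. f k x \<partial>G)"
    by (rule levy_continuity_vec[OF _ _ G _ fc, where B=1])
      (auto simp: f01 integral_distr conv intro!: prob_space.prob_space_distr P)
  then have "(\<lambda>n. \<integral>x. f k (T n x) \<partial>P n) \<longlonglongrightarrow> (\<integral>x. f k x \<partial>G)"
    by (simp add: integral_distr)
  from order_tendstoD(2)[OF this k]
  have "eventually (\<lambda>n. measure (P n) {x \<in> space (P n). norm (T n x) \<ge> real k + 1} < \<epsilon>) sequentially"
  proof eventually_elim
    case (elim n)
    interpret prob_space "P n" by (rule P)
    have "measure (P n) {x \<in> space (P n). norm (T n x) \<ge> real k + 1} = (\<integral>x. indicator {x \<in> space (P n). norm (T n x) \<ge> real k + 1} x \<partial>P n)"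
      by simp
    also have "\<dots> \<le> (\<integral>x. f k (T n x) \<partial>P n)"
    proof (rule integral_mono)
      show "integrable (P n) (\<lambda>x. f k (T n x))"
        by (rule integrable_const_bound[where B=1]) (auto simp: f01)
      show "integrable (P n) (indicat_real {x \<in> space (P n). norm (T n x) \<ge> real k + 1})"
        by (intro integrable_real_indicator) (auto simp: emeasure_eq_measure)
    qed (auto simp: f_def indicator_def)
    finally show ?case using elim by simp
  qed
  then show ?thesis using that[of "real k + 1"] by simp
qed

section \<open>Slutsky's lemma for a vanishing matrix times a tight vector\<close>

lemma matrix_vector_norm_le:
  fixes A :: "real^'n^'n"
  shows "norm (A *v x) \<le> real CARD('n) * norm A * norm x"
proof -
  have "norm (A *v x) \<le> (\<Sum>i\<in>UNIV. \<bar>(A *v x) $ i\<bar>)" by (rule norm_le_l1_cart)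
  also have "\<dots> \<le> (\<Sum>i\<in>(UNIV::'n set). norm A * norm x)"
  proof (rule sum_mono)
    fix i
    have "(A *v x) $ i = A $ i \<bullet> x" by (simp add: matrix_vector_mult_def inner_vec_def)
    then have "\<bar>(A *v x) $ i\<bar> \<le> norm (A $ i) * norm x" by (simp add: Cauchy_Schwarz_ineq2)
    also have "\<dots> \<le> norm A * norm x" by (intro mult_right_mono Finite_Cartesian_Product.norm_nth_le) auto
    finally show "\<bar>(A *v x) $ i\<bar> \<le> norm A * norm x" .
  qed
  finally show ?thesis by simp
qed

lemma slutsky_matrix:
  fixes A :: "nat \<Rightarrow> 'b \<Rightarrow> real^'n^'n" and T :: "nat \<Rightarrow> 'b \<Rightarrow> real^'n"
  assumes P: "\<And>n. prob_space (P n)"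
    and [measurable]: "\<And>n. A n \<in> borel_measurable (P n)" "\<And>n. T n \<in> borel_measurable (P n)"
    and A: "tendsto_prob P A 0"
    and tight: "\<And>\<epsilon>. \<epsilon> > 0 \<Longrightarrow> \<exists>R>0. eventually (\<lambda>n. measure (P n) {x \<in> space (P n). norm (T n x) \<ge> R} < \<epsilon>) sequentially"
  shows "tendsto_prob P (\<lambda>n x. A n x *v T n x) 0"
  unfolding tendsto_prob_def
proof (intro allI impI)
  fix \<epsilon> :: real assume \<epsilon>: "\<epsilon> > 0"
  show "(\<lambda>n. measure (P n) {x \<in> space (P n). norm (A n x *v T n x - 0) \<ge> \<epsilon>}) \<longlonglongrightarrow> 0"
  proof (rule LIMSEQ_I)
    fix r :: real assume r: "r > 0"
    obtain R where R: "R > 0" "eventually (\<lambda>n. measure (P n) {x \<in> space (P n). norm (T n x) \<ge> R} < r / 2) sequentially"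
      using tight[of "r / 2"] r by auto
    \<comment> \<open>Chosen so that \<open>norm (A n x) < \<delta>\<close> and
      \<open>norm (T n x) < R\<close> bring the bound of \<open>matrix_vector_norm_le\<close>,
      including its factor \<open>CARD('n)\<close>, just below \<open>\<epsilon>\<close>.\<close>
    define \<delta> where "\<delta> = \<epsilon> / (real CARD('n) * R)"
    have \<delta>: "\<delta> > 0" using \<epsilon> R by (simp add: \<delta>_def)
    have "eventually (\<lambda>n. measure (P n) {x \<in> space (P n). norm (A n x) \<ge> \<delta>} < r / 2) sequentially"
      using A \<delta> r by (intro order_tendstoD) (auto simp: tendsto_prob_def)
    with R(2) have "eventually (\<lambda>n. measure (P n) {x \<in> space (P n). norm (A n x *v T n x) \<ge> \<epsilon>} < r) sequentially"
    proof eventually_elim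
      case (elim n)
      interpret prob_space "P n" by (rule P)
      have "{x \<in> space (P n). norm (A n x *v T n x) \<ge> \<epsilon>}
        \<subseteq> {x \<in> space (P n). norm (A n x) \<ge> \<delta>} \<union> {x \<in> space (P n). norm (T n x) \<ge> R}" (is "?S \<subseteq> ?A \<union> ?B")
      proof (rule subsetI, rule ccontr)
        fix x assume x: "x \<in> ?S" and n: "x \<notin> ?A \<union> ?B"
        then have "norm (A n x) < \<delta>" "norm (T n x) < R" by auto
        then have "norm (A n x) * norm (T n x) < \<delta> * R" using \<delta>
          by (intro mult_strict_mono) auto
        have "norm (A n x *v T n x) \<le> real CARD('n) * (norm (A n x) * norm (T n x))"
          using matrix_vector_norm_le[of "A n x" "T n x"] by (simp add: mult.assoc)
        also have "\<dots> < real CARD('n) * (\<delta> * R)"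
          using \<open>norm (A n x) * norm (T n x) < \<delta> * R\<close> by (intro mult_strict_left_mono) auto
        also have "\<dots> = \<epsilon>" using R by (simp add: \<delta>_def)
        finally show False using x by simp
      qed
      then have "measure (P n) ?S \<le> measure (P n) (?A \<union> ?B)"
        by (intro finite_measure_mono) auto
      also have "\<dots> \<le> measure (P n) ?A + measure (P n) ?B"
        by (rule measure_Un_le) auto
      finally show ?case using elim by simp
    qed
    then show "\<exists>no. \<forall>n\<ge>no. norm (measure (P n) {x \<in> space (P n). norm (A n x *v T n x - 0) \<ge> \<epsilon>} - 0) < r"
      by (simp add: eventually_sequentially)
  qed
qed

lemma tendsto_prob_tight:
  assumes Z: "tendsto_prob P Z 0" and \<epsilon>: "\<epsilon> > 0"
  shows "\<exists>R>0. eventually (\<lambda>n. measure (P n) {x \<in> space (P n). norm (Z n x) \<ge> R} < \<epsilon>) sequentially"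
proof -
  have "eventually (\<lambda>n. measure (P n) {x \<in> space (P n). norm (Z n x) \<ge> 1} < \<epsilon>) sequentially"
    using Z \<epsilon> by (intro order_tendstoD) (auto simp: tendsto_prob_def dest: spec[of _ 1])
  then show ?thesis by (intro exI[of _ 1]) simp
qed

lemma tendsto_prob_union3:
  assumes P: "\<And>n. prob_space (P n)"
    and ev: "\<And>\<epsilon>. \<epsilon> > 0 \<Longrightarrow> eventually (\<lambda>n. {x \<in> space (P n). norm (Z n x - c) \<ge> \<epsilon>} \<subseteq> Ea \<epsilon> n \<union> Eb \<epsilon> n \<union> Ec \<epsilon> n) sequentially"
    and m: "\<And>\<epsilon> n. Ea \<epsilon> n \<in> sets (P n)" "\<And>\<epsilon> n. Eb \<epsilon> n \<in> sets (P n)" "\<And>\<epsilon> n. Ec \<epsilon> n \<in> sets (P n)"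
    and l: "\<And>\<epsilon>. \<epsilon> > 0 \<Longrightarrow> (\<lambda>n. measure (P n) (Ea \<epsilon> n)) \<longlonglongrightarrow> 0"
      "\<And>\<epsilon>. \<epsilon> > 0 \<Longrightarrow> (\<lambda>n. measure (P n) (Eb \<epsilon> n)) \<longlonglongrightarrow> 0"
      "\<And>\<epsilon>. \<epsilon> > 0 \<Longrightarrow> (\<lambda>n. measure (P n) (Ec \<epsilon> n)) \<longlonglongrightarrow> 0"
  shows "tendsto_prob P Z c"
  unfolding tendsto_prob_def
proof (intro allI impI)
  fix \<epsilon> :: real assume \<epsilon>: "\<epsilon> > 0"
  have "(\<lambda>n. measure (P n) (Ea \<epsilon> n) + measure (P n) (Eb \<epsilon> n) + measure (P n) (Ec \<epsilon> n)) \<longlonglongrightarrow> 0 + 0 + 0"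
    by (intro tendsto_add l \<epsilon>)
  then have lim: "(\<lambda>n. measure (P n) (Ea \<epsilon> n) + measure (P n) (Eb \<epsilon> n) + measure (P n) (Ec \<epsilon> n)) \<longlonglongrightarrow> 0"
    by simp
  show "(\<lambda>n. measure (P n) {x \<in> space (P n). norm (Z n x - c) \<ge> \<epsilon>}) \<longlonglongrightarrow> 0"
  proof (rule tendsto_sandwich[OF _ _ tendsto_const lim])
    show "eventually (\<lambda>n. measure (P n) {x \<in> space (P n). norm (Z n x - c) \<ge> \<epsilon>}
        \<le> measure (P n) (Ea \<epsilon> n) + measure (P n) (Eb \<epsilon> n) + measure (P n) (Ec \<epsilon> n)) sequentially"
      using ev[OF \<epsilon>]
    proof eventually_elim
      case (elim n)
      interpret prob_space "P n" by (rule P)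
      have "measure (P n) {x \<in> space (P n). norm (Z n x - c) \<ge> \<epsilon>} \<le> measure (P n) (Ea \<epsilon> n \<union> Eb \<epsilon> n \<union> Ec \<epsilon> n)"
        using elim m by (intro finite_measure_mono) auto
      also have "\<dots> \<le> measure (P n) (Ea \<epsilon> n \<union> Eb \<epsilon> n) + measure (P n) (Ec \<epsilon> n)"
        using m by (intro measure_Un_le) auto
      also have "measure (P n) (Ea \<epsilon> n \<union> Eb \<epsilon> n) \<le> measure (P n) (Ea \<epsilon> n) + measure (P n) (Eb \<epsilon> n)"
        using m by (intro measure_Un_le) auto
      finally show ?case by simp
    qed
  qed simp
qed

lemma invertible_near:
  fixes \<Sigma> :: "real^'n^'n"
  assumes "invertible \<Sigma>"
  obtains \<delta> where "\<delta> > 0" "\<And>A. norm (A - \<Sigma>) < \<delta> \<Longrightarrow> invertible A"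
proof -
  have "open {A::real^'n^'n. det A \<noteq> 0}"
    using open_Collect_neq[OF continuous_on_det continuous_on_const[of _ 0]] by simp
  moreover have "\<Sigma> \<in> {A. det A \<noteq> 0}" using assms by (simp add: invertible_det_nz)
  ultimately obtain \<delta> where "\<delta> > 0" "ball \<Sigma> \<delta> \<subseteq> {A. det A \<noteq> 0}"
    by (meson open_contains_ball)
  then show ?thesis
    using that[of \<delta>] by (auto simp: invertible_det_nz ball_def dist_norm norm_minus_commute subset_iff)
qed

text \<open>The hypothesis on \<open>Z\<close> is only required where both Gram matrices are invertible,
  so the junk value of \<open>inv0\<close> plays no role in the limit.\<close>

lemma conv_distr_inverse_gram:
  fixes A B :: "nat \<Rightarrow> 'b \<Rightarrow> real^'n^'n" and T r Z :: "nat \<Rightarrow> 'b \<Rightarrow> real^'n"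
    and \<Sigma> W :: "real^'n^'n"
  assumes P: "\<And>n. prob_space (P n)"
    and A[measurable]: "\<And>n. A n \<in> borel_measurable (P n)" and B[measurable]: "\<And>n. B n \<in> borel_measurable (P n)"
    and T[measurable]: "\<And>n. T n \<in> borel_measurable (P n)" and r[measurable]: "\<And>n. r n \<in> borel_measurable (P n)"
    and Z[measurable]: "\<And>n. Z n \<in> borel_measurable (P n)"
    and AS: "tendsto_prob P A \<Sigma>" and BS: "tendsto_prob P B \<Sigma>" and r0: "tendsto_prob P r 0"
    and TW: "\<And>t. (\<lambda>n. \<integral>x. cis (t \<bullet> T n x) \<partial>P n) \<longlonglongrightarrow> complex_of_real (exp (- (t \<bullet> (W *v t)) / 2))"
    and Zeq: "eventually (\<lambda>n. \<forall>x\<in>space (P n). invertible (A n x) \<longrightarrow> invertible (B n x) \<longrightarrow>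
        Z n x = inv0 (A n x) *v T n x - inv0 (B n x) *v r n x) sequentially"
    and inv: "invertible \<Sigma>" and sym\<Sigma>: "transpose \<Sigma> = \<Sigma>"
    and symW: "transpose W = W" and psdW: "\<And>t. 0 \<le> t \<bullet> (W *v t)"
  shows "\<exists>G. normal_vec (matrix_inv \<Sigma> ** W ** matrix_inv \<Sigma>) G \<and> conv_distr P Z G"
proof -
  let ?S = "matrix_inv \<Sigma>"
  let ?V = "?S ** W ** ?S"
  have symS: "transpose ?S = ?S"
  proof -
    have "transpose ?S ** \<Sigma> = mat 1"
      using arg_cong[OF matrix_inv_mult(1)[OF inv], of transpose] sym\<Sigma>
      by (simp add: matrix_transpose_mul transpose_mat)
    then have "transpose ?S ** \<Sigma> ** ?S = ?S" by simp
    then show ?thesis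
      by (simp add: matrix_mul_assoc[symmetric] matrix_inv_mult[OF inv])
  qed
  have S_inner: "s \<bullet> (?S *v t) = (?S *v s) \<bullet> t" for s t
    by (metis symS dot_lmul_matrix vector_transpose_matrix)
  have tV: "t \<bullet> (?V *v t) = (?S *v t) \<bullet> (W *v (?S *v t))" for t
    by (simp add: matrix_vector_mul_assoc[symmetric] S_inner)
  have "\<exists>G. normal_vec ?V G"
  proof (rule normal_vec_exists)
    show "transpose ?V = ?V" by (simp add: matrix_transpose_mul symS symW matrix_mul_assoc)
    show "0 \<le> t \<bullet> (?V *v t)" for t unfolding tV by (rule psdW)
  qed
  then obtain G where G: "normal_vec ?V G" ..
  \<comment> \<open>The law N(0, W) serves to make the vectors \<open>T n\<close> tight; the limit
    law proper is \<open>G\<close>.\<close>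
  obtain GW where GW: "normal_vec W GW" using normal_vec_exists[OF symW psdW] ..
  have tightT: "\<exists>R>0. eventually (\<lambda>n. measure (P n) {x \<in> space (P n). norm (T n x) \<ge> R} < \<epsilon>) sequentially" if "\<epsilon> > 0" for \<epsilon>
  proof -
    have "prob_space GW" "sets GW = sets borel" "\<And>t. (\<lambda>n. \<integral>x. cis (t \<bullet> T n x) \<partial>P n) \<longlonglongrightarrow> (\<integral>x. cis (t \<bullet> x) \<partial>GW)"
      using GW TW by (auto simp: normal_vec_def)
    from normal_vec_tight[OF P T this that] show ?thesis by blast
  qed
  have inv0: "inv0 \<Sigma> = ?S" using inv by (simp add: inv0_def)
  have iA: "tendsto_prob P (\<lambda>n x. inv0 (A n x) - ?S) 0"
    using tendsto_prob_isCont[OF P A AS isCont_inv0[OF inv]] by (simp add: tendsto_prob_def inv0)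
  have iB: "tendsto_prob P (\<lambda>n x. inv0 (B n x) - ?S) 0"
    using tendsto_prob_isCont[OF P B BS isCont_inv0[OF inv]] by (simp add: tendsto_prob_def inv0)
  have t1: "tendsto_prob P (\<lambda>n x. (inv0 (A n x) - ?S) *v T n x) 0"
    by (rule slutsky_matrix[OF P _ T iA tightT]) measurable
  have t2: "tendsto_prob P (\<lambda>n x. (inv0 (B n x) - ?S) *v r n x) 0"
    by (rule slutsky_matrix[OF P _ r iB tendsto_prob_tight[OF r0]]) measurable
  have t3: "tendsto_prob P (\<lambda>n x. ?S *v r n x) 0"
  proof -
    have "isCont ((*v) ?S) 0" by (intro linear_continuous_at) (simp add: linear_linear)
    from tendsto_prob_isCont[OF P r r0 this] show ?thesis by simp
  qed
  obtain \<delta> where \<delta>: "\<delta> > 0" "\<And>A. norm (A - \<Sigma>) < \<delta> \<Longrightarrow> invertible A" using invertible_near[OF inv] by blast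
  \<comment> \<open>When both Gram matrices are within \<open>\<delta>\<close> of
    \<open>\<Sigma>\<close>, and hence invertible, the difference is a combination of three terms:
    the error of each inverse applied to its vector, and \<open>?S\<close> applied to
    \<open>r\<close>. Each gets a third of \<open>\<epsilon>\<close>.\<close>
  have D: "tendsto_prob P (\<lambda>n x. Z n x - ?S *v T n x) 0"
  proof (rule tendsto_prob_union3[OF P, where
      Ea = "\<lambda>\<epsilon> n. {x \<in> space (P n). norm (A n x - \<Sigma>) \<ge> \<delta>} \<union> {x \<in> space (P n). norm (B n x - \<Sigma>) \<ge> \<delta>}" and
      Eb = "\<lambda>\<epsilon> n. {x \<in> space (P n). norm ((inv0 (A n x) - ?S) *v T n x) \<ge> \<epsilon> / 3}" and
      Ec = "\<lambda>\<epsilon> n. {x \<in> space (P n). norm ((inv0 (B n x) - ?S) *v r n x) \<ge> \<epsilon> / 3} \<union> {x \<in> space (P n). norm (?S *v r n x) \<ge> \<epsilon> / 3}"])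
    have un: "(\<lambda>n. measure (P n) (E n \<union> F n)) \<longlonglongrightarrow> 0"
      if "(\<lambda>n. measure (P n) (E n)) \<longlonglongrightarrow> 0" "(\<lambda>n. measure (P n) (F n)) \<longlonglongrightarrow> 0"
        "\<And>n. E n \<in> sets (P n)" "\<And>n. F n \<in> sets (P n)" for E F
    proof (rule tendsto_sandwich[OF _ _ tendsto_const])
      show "(\<lambda>n. measure (P n) (E n) + measure (P n) (F n)) \<longlonglongrightarrow> 0"
        using tendsto_add[OF that(1,2)] by simp
      show "eventually (\<lambda>n. measure (P n) (E n \<union> F n) \<le> measure (P n) (E n) + measure (P n) (F n)) sequentially"
      proof (rule always_eventually, rule allI)
        fix n
        interpret prob_space "P n" by (rule P)
        show "measure (P n) (E n \<union> F n) \<le> measure (P n) (E n) + measure (P n) (F n)"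
          by (intro measure_Un_le that)
      qed
    qed simp
    fix \<epsilon> :: real assume \<epsilon>: "\<epsilon> > 0"
    show "(\<lambda>n. measure (P n) ({x \<in> space (P n). norm (A n x - \<Sigma>) \<ge> \<delta>} \<union> {x \<in> space (P n). norm (B n x - \<Sigma>) \<ge> \<delta>})) \<longlonglongrightarrow> 0"
      using AS BS \<delta>(1) by (intro un) (auto simp: tendsto_prob_def)
    show "(\<lambda>n. measure (P n) {x \<in> space (P n). norm ((inv0 (A n x) - ?S) *v T n x) \<ge> \<epsilon> / 3}) \<longlonglongrightarrow> 0"
      using t1 \<epsilon> by (auto simp: tendsto_prob_def dest: spec[of _ "\<epsilon> / 3"])
    show "(\<lambda>n. measure (P n) ({x \<in> space (P n). norm ((inv0 (B n x) - ?S) *v r n x) \<ge> \<epsilon> / 3} \<union> {x \<in> space (P n). norm (?S *v r n x) \<ge> \<epsilon> / 3})) \<longlonglongrightarrow> 0"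
    proof (rule un)
      show "(\<lambda>n. measure (P n) {x \<in> space (P n). norm ((inv0 (B n x) - ?S) *v r n x) \<ge> \<epsilon> / 3}) \<longlonglongrightarrow> 0"
        using t2 \<epsilon> by (auto simp: tendsto_prob_def dest: spec[of _ "\<epsilon> / 3"])
      show "(\<lambda>n. measure (P n) {x \<in> space (P n). norm (?S *v r n x) \<ge> \<epsilon> / 3}) \<longlonglongrightarrow> 0"
        using t3 \<epsilon> by (auto simp: tendsto_prob_def dest: spec[of _ "\<epsilon> / 3"])
    qed measurable
    show "eventually (\<lambda>n. {x \<in> space (P n). norm (Z n x - ?S *v T n x - 0) \<ge> \<epsilon>} \<subseteq>
      ({x \<in> space (P n). norm (A n x - \<Sigma>) \<ge> \<delta>} \<union> {x \<in> space (P n). norm (B n x - \<Sigma>) \<ge> \<delta>})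
      \<union> {x \<in> space (P n). norm ((inv0 (A n x) - ?S) *v T n x) \<ge> \<epsilon> / 3}
      \<union> ({x \<in> space (P n). norm ((inv0 (B n x) - ?S) *v r n x) \<ge> \<epsilon> / 3} \<union> {x \<in> space (P n). norm (?S *v r n x) \<ge> \<epsilon> / 3})) sequentially"
      using Zeq
    proof eventually_elim
      case (elim n)
      show ?case
      proof (rule subsetI, rule ccontr)
        fix x
        assume x: "x \<in> {x \<in> space (P n). norm (Z n x - ?S *v T n x - 0) \<ge> \<epsilon>}"
          and "x \<notin> {x \<in> space (P n). norm (A n x - \<Sigma>) \<ge> \<delta>} \<union> {x \<in> space (P n). norm (B n x - \<Sigma>) \<ge> \<delta>}
          \<union> {x \<in> space (P n). norm ((inv0 (A n x) - ?S) *v T n x) \<ge> \<epsilon> / 3}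
          \<union> ({x \<in> space (P n). norm ((inv0 (B n x) - ?S) *v r n x) \<ge> \<epsilon> / 3} \<union> {x \<in> space (P n). norm (?S *v r n x) \<ge> \<epsilon> / 3})"
        then have *: "norm (A n x - \<Sigma>) < \<delta>" "norm (B n x - \<Sigma>) < \<delta>"
          "norm ((inv0 (A n x) - ?S) *v T n x) < \<epsilon> / 3" "norm ((inv0 (B n x) - ?S) *v r n x) < \<epsilon> / 3" "norm (?S *v r n x) < \<epsilon> / 3"
          by auto
        have "Z n x - ?S *v T n x = (inv0 (A n x) - ?S) *v T n x - (inv0 (B n x) - ?S) *v r n x - ?S *v r n x"
          using elim x \<delta>(2) *(1,2) by (simp add: matrix_vector_mult_diff_rdistrib)
        then have "norm (Z n x - ?S *v T n x) < \<epsilon>"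
          using *(3-5) norm_triangle_ineq4[of "(inv0 (A n x) - ?S) *v T n x - (inv0 (B n x) - ?S) *v r n x" "?S *v r n x"]
            norm_triangle_ineq4[of "(inv0 (A n x) - ?S) *v T n x" "(inv0 (B n x) - ?S) *v r n x"] by simp
        then show False using x by simp
      qed
    qed
  qed measurable
  have ch: "(\<lambda>n. \<integral>x. cis (t \<bullet> Z n x) \<partial>P n) \<longlonglongrightarrow> (\<integral>x. cis (t \<bullet> x) \<partial>G)" for t
  proof (rule char_fun_diff_tendsto[OF P Z _ D])
    \<comment> \<open>By symmetry \<open>?S\<close> moves to the argument: the characteristic
      function of the image at \<open>t\<close> is that of \<open>T n\<close> at
      \<open>?S *v t\<close>, which produces the sandwich \<open>?V\<close>.\<close>
    have "(\<lambda>n. \<integral>x. cis ((?S *v t) \<bullet> T n x) \<partial>P n) \<longlonglongrightarrow> complex_of_real (exp (- (t \<bullet> (?V *v t)) / 2))"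
      using TW[of "?S *v t"] by (simp add: tV)
    then show "(\<lambda>n. \<integral>x. cis (t \<bullet> (?S *v T n x)) \<partial>P n) \<longlonglongrightarrow> (\<integral>x. cis (t \<bullet> x) \<partial>G)"
      using G by (simp add: normal_vec_def S_inner)
  qed measurable
  have "conv_distr P Z G"
    unfolding conv_distr_def
  proof (intro conjI allI impI P Z)
    fix f :: "real^'n \<Rightarrow> real" assume f: "continuous_on UNIV f" and "bounded (range f)"
    then obtain Bd where Bd: "\<And>x. \<bar>f x\<bar> \<le> Bd" by (auto simp: bounded_iff)
    have [measurable]: "f \<in> borel_measurable borel" by (rule borel_measurable_continuous_onI[OF f])
    have "(\<lambda>n. \<integral>x. f x \<partial>distr (P n) borel (Z n)) \<longlonglongrightarrow> (\<integral>x. f x \<partial>G)"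
    proof (rule levy_continuity_vec[OF _ _ _ _ _ f Bd])
      show "prob_space G" "sets G = sets borel" using G by (auto simp: normal_vec_def)
    qed (auto simp: integral_distr ch intro!: prob_space.prob_space_distr P)
    then show "(\<lambda>n. \<integral>x. f (Z n x) \<partial>P n) \<longlonglongrightarrow> (\<integral>x. f x \<partial>G)"
      by (simp add: integral_distr)
  qed
  with G show ?thesis by blast
qed

section \<open>Characteristic functions and moments of independent sums\<close>

text \<open>The exponent 3/2 gives a variance the scaling of a third absolute moment, so that in
  \<open>char_blocks\<close> this error is summed by \<open>occ_pow 3\<close> together with the
  Lindeberg part. For \<open>u \<le> 1\<close> it follows from exp(-u) \<le> 1/(1 + u) \<le> 1 - u +
  u^2.\<close>

lemma exp_minus_approx:
  fixes u :: real assumes "u \<ge> 0"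
  shows "\<bar>exp (- u) - (1 - u)\<bar> \<le> u * sqrt u"
proof -
  have lo: "exp (- u) \<ge> 1 - u" using exp_ge_add_one_self[of "- u"] by simp
  show ?thesis
  proof (cases "u \<le> 1")
    case True
    have "exp (- u) \<le> 1 - u + u\<^sup>2"
    proof -
      have "1 + u \<le> exp u" using exp_ge_add_one_self[of u] by simp
      then have "exp (- u) \<le> 1 / (1 + u)"
        using assms by (simp add: exp_minus field_simps)
      also have "\<dots> \<le> 1 - u + u\<^sup>2"
      proof -
        have "1 \<le> (1 - u + u\<^sup>2) * (1 + u)" using assms by (simp add: algebra_simps power2_eq_square)
        then show ?thesis using assms by (simp add: divide_le_eq)
      qed
      finally show ?thesis .
    qed
    moreover have "u \<le> sqrt u" using assms True by (metis abs_of_nonneg mult_left_le real_sqrt_abs real_sqrt_le_iff power2_eq_square)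
    then have "u\<^sup>2 \<le> u * sqrt u" using assms by (simp add: power2_eq_square mult_left_mono)
    ultimately show ?thesis using lo by simp
  next
    case False
    then have "1 \<le> sqrt u" by simp
    then have "u * 1 \<le> u * sqrt u" using assms by (intro mult_left_mono) auto
    moreover have "exp (- u) \<le> 1" using assms by simp
    ultimately have "exp (- u) - (1 - u) \<le> u * sqrt u" by linarith
    then show ?thesis using lo by simp
  qed
qed

lemma exp_minus_lipschitz:
  fixes a b :: real
  assumes "a \<ge> 0" "b \<ge> 0"
  shows "\<bar>exp (- a) - exp (- b)\<bar> \<le> \<bar>a - b\<bar>"
proof -
  have *: "exp (- a) - exp (- b) \<le> b - a" if "0 \<le> a" "a \<le> b" for a b :: real
  proof -
    have "exp (- a) - exp (- b) = exp (- a) * (1 - exp (- (b - a)))"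
      by (simp add: right_diff_distrib exp_add[symmetric])
    also have "\<dots> \<le> 1 * (1 - exp (- (b - a)))" using that by (intro mult_right_mono) auto
    also have "\<dots> \<le> b - a" by (smt (verit) exp_ge_add_one_self)
    finally show ?thesis .
  qed
  show ?thesis
  proof (cases "a \<le> b")
    case True
    then have "exp (- b) \<le> exp (- a)" by simp
    then show ?thesis using *[OF assms(1) True] True by simp
  next
    case False
    then have "exp (- a) \<le> exp (- b)" by simp
    then show ?thesis using *[OF assms(2), of a] False by simp
  qed
qed

lemma (in prob_space) integrable_power_le:
  fixes X :: "'a \<Rightarrow> real"
  assumes [measurable]: "random_variable borel X" and n: "integrable M (\<lambda>x. X x ^ n)" and "k \<le> n"
  shows "integrable M (\<lambda>x. X x ^ k)"
proof (rule Bochner_Integration.integrable_bound)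
  show "integrable M (\<lambda>x. 1 + \<bar>X x ^ n\<bar>)" using n by simp
  have "\<bar>x\<bar> ^ k \<le> 1 + \<bar>x\<bar> ^ n" for x :: real
  proof (cases "\<bar>x\<bar> \<le> 1")
    case True
    then show ?thesis using power_le_one[of "\<bar>x\<bar>" k] by (simp add: add_increasing2)
  next
    case False
    then show ?thesis using power_increasing[OF \<open>k \<le> n\<close>, of "\<bar>x\<bar>"] by linarith
  qed
  then show "AE x in M. norm (X x ^ k) \<le> norm (1 + \<bar>X x ^ n\<bar>)"
    by (simp add: power_abs[symmetric])
qed simp

text \<open>Characteristic functions and Gaussian factors lie in the unit disc, so the difference of
  the two products is at most the sum of the differences of the factors. The minimum of square and
  cube keeps the bound finite under second moments and still of third order where \<open>Y k\<close>
  is small.\<close>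

lemma (in prob_space) char_sum_approx:
  fixes Y :: "'i \<Rightarrow> 'a \<Rightarrow> real"
  assumes I: "finite I" and ind: "indep_vars (\<lambda>_. borel) Y I"
    and int: "\<And>k. k \<in> I \<Longrightarrow> integrable M (\<lambda>x. (Y k x)\<^sup>2)"
    and mean: "\<And>k. k \<in> I \<Longrightarrow> expectation (Y k) = 0"
    and v: "\<And>k. k \<in> I \<Longrightarrow> expectation (\<lambda>x. (Y k x)\<^sup>2) = v k"
  shows "cmod (expectation (\<lambda>x. cis (\<Sum>k\<in>I. Y k x)) - complex_of_real (exp (- (\<Sum>k\<in>I. v k) / 2)))
    \<le> (\<Sum>k\<in>I. expectation (\<lambda>x. min ((Y k x)\<^sup>2) (\<bar>Y k x\<bar> ^ 3)) + v k * sqrt (v k))"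
proof -
  have rv[measurable]: "random_variable borel (Y k)" if "k \<in> I" for k
    using ind that by (auto simp: indep_vars_def)
  have v0: "v k \<ge> 0" if "k \<in> I" for k
    unfolding v[OF that, symmetric] by simp
  have i1: "integrable M (Y k)" if "k \<in> I" for k
    using integrable_power_le[OF rv[OF that] int[OF that], of 1] by simp
  have ic: "integrable M (\<lambda>x. cis (Y k x))" if "k \<in> I" for k
    using rv[OF that] by (intro integrable_const_bound[where B=1]) auto
  have "expectation (\<lambda>x. cis (\<Sum>k\<in>I. Y k x)) = expectation (\<lambda>x. \<Prod>k\<in>I. cis (Y k x))"
  proof (rule Bochner_Integration.integral_cong[OF refl])
    fix x
    show "cis (\<Sum>k\<in>I. Y k x) = (\<Prod>k\<in>I. cis (Y k x))"
      using I by (induction I rule: finite_induct) (auto simp: cis_mult[symmetric])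
  qed
  also have "\<dots> = (\<Prod>k\<in>I. expectation (\<lambda>x. cis (Y k x)))"
    by (rule indep_vars_lebesgue_integral[OF I])
      (auto intro!: indep_vars_compose2[OF ind] ic)
  finally have 1: "expectation (\<lambda>x. cis (\<Sum>k\<in>I. Y k x)) = (\<Prod>k\<in>I. expectation (\<lambda>x. cis (Y k x)))" .
  have 2: "complex_of_real (exp (- (\<Sum>k\<in>I. v k) / 2)) = (\<Prod>k\<in>I. complex_of_real (exp (- v k / 2)))"
    using I by (simp add: sum_divide_distrib sum_negf[symmetric] exp_sum)
  have "cmod ((\<Prod>k\<in>I. expectation (\<lambda>x. cis (Y k x))) - (\<Prod>k\<in>I. complex_of_real (exp (- v k / 2))))
    \<le> (\<Sum>k\<in>I. cmod (expectation (\<lambda>x. cis (Y k x)) - complex_of_real (exp (- v k / 2))))"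
  proof (rule norm_prod_diff)
    fix k assume k: "k \<in> I"
    have "cmod (expectation (\<lambda>x. cis (Y k x))) \<le> expectation (\<lambda>x. cmod (cis (Y k x)))"
      by (rule integral_norm_bound)
    then show "cmod (expectation (\<lambda>x. cis (Y k x))) \<le> 1" by (simp add: prob_space)
    show "cmod (complex_of_real (exp (- v k / 2))) \<le> 1" using v0[OF k] by (simp del: of_real_exp)
  qed
  also have "\<dots> \<le> (\<Sum>k\<in>I. expectation (\<lambda>x. min ((Y k x)\<^sup>2) (\<bar>Y k x\<bar> ^ 3)) + v k * sqrt (v k))"
  proof (rule sum_mono)
    fix k assume k: "k \<in> I"
    note [measurable] = rv[OF k]
    have "cmod (char (distr M borel (Y k)) 1 - (1 - 1^2 * v k / 2))
      \<le> (1^2 / 6) * expectation (\<lambda>x. min (6 * (Y k x)^2) (\<bar>1\<bar> * \<bar>Y k x\<bar>^3))"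
      using k int i1 mean v by (intro char_approx3'[OF rv]) auto
    moreover have "char (distr M borel (Y k)) 1 = expectation (\<lambda>x. cis (Y k x))"
      by (simp add: char_def integral_distr cis_conv_exp)
    ultimately have a: "cmod (expectation (\<lambda>x. cis (Y k x)) - (1 - v k / 2))
      \<le> expectation (\<lambda>x. min (6 * (Y k x)^2) (\<bar>Y k x\<bar>^3)) / 6" by simp
    also have "\<dots> = expectation (\<lambda>x. min (6 * (Y k x)^2) (\<bar>Y k x\<bar>^3) / 6)" by simp
    also have "\<dots> \<le> expectation (\<lambda>x. min ((Y k x)\<^sup>2) (\<bar>Y k x\<bar> ^ 3))"
    proof (rule integral_mono)
      show "integrable M (\<lambda>x. min (6 * (Y k x)\<^sup>2) (\<bar>Y k x\<bar> ^ 3) / 6)"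
        by (rule Bochner_Integration.integrable_bound[OF int[OF k]]) (auto simp: min_def)
      show "integrable M (\<lambda>x. min ((Y k x)\<^sup>2) (\<bar>Y k x\<bar> ^ 3))"
        by (rule Bochner_Integration.integrable_bound[OF int[OF k]]) (auto simp: min_def)
      show "min (6 * (Y k x)\<^sup>2) (\<bar>Y k x\<bar> ^ 3) / 6 \<le> min ((Y k x)\<^sup>2) (\<bar>Y k x\<bar> ^ 3)" for x
      proof -
        have "min (6 * a) b / 6 \<le> min a b" if "a \<ge> 0" "b \<ge> 0" for a b :: real using that by (auto simp: min_def)
        then show ?thesis by simp
      qed
    qed
    finally have a: "cmod (expectation (\<lambda>x. cis (Y k x)) - (1 - v k / 2)) \<le> expectation (\<lambda>x. min ((Y k x)\<^sup>2) (\<bar>Y k x\<bar> ^ 3))" .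
    have "cmod (complex_of_real (1 - v k / 2) - complex_of_real (exp (- v k / 2))) = \<bar>exp (- (v k / 2)) - (1 - v k / 2)\<bar>"
      by (simp only: of_real_diff[symmetric] norm_of_real) (simp add: abs_minus_commute)
    also have "\<dots> \<le> (v k / 2) * sqrt (v k / 2)" using v0[OF k] by (intro exp_minus_approx) simp
    also have "\<dots> \<le> v k * sqrt (v k)" using v0[OF k] by (intro mult_mono) auto
    finally have b: "cmod (complex_of_real (1 - v k / 2) - complex_of_real (exp (- v k / 2))) \<le> v k * sqrt (v k)" .
    have "cmod (expectation (\<lambda>x. cis (Y k x)) - complex_of_real (exp (- v k / 2)))
      \<le> cmod (expectation (\<lambda>x. cis (Y k x)) - (1 - v k / 2)) + cmod (complex_of_real (1 - v k / 2) - complex_of_real (exp (- v k / 2)))"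
      using norm_triangle_ineq[of "expectation (\<lambda>x. cis (Y k x)) - (1 - v k / 2)" "complex_of_real (1 - v k / 2) - complex_of_real (exp (- v k / 2))"] by simp
    with a b show "cmod (expectation (\<lambda>x. cis (Y k x)) - complex_of_real (exp (- v k / 2)))
      \<le> expectation (\<lambda>x. min ((Y k x)\<^sup>2) (\<bar>Y k x\<bar> ^ 3)) + v k * sqrt (v k)" by linarith
  qed
  finally show ?thesis unfolding 1 2 .
qed

section \<open>Moments of sums of independent variables\<close>

lemma (in prob_space) indep_var_power_mult:
  fixes X Y :: "'a \<Rightarrow> real"
  assumes "indep_var borel X borel Y" "integrable M (\<lambda>x. X x ^ j)" "integrable M (\<lambda>x. Y x ^ k)"
  shows "expectation (\<lambda>x. X x ^ j * Y x ^ k) = expectation (\<lambda>x. X x ^ j) * expectation (\<lambda>x. Y x ^ k)"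
    and "integrable M (\<lambda>x. X x ^ j * Y x ^ k)"
proof -
  have "indep_var borel ((\<lambda>x. x ^ j) \<circ> X) borel ((\<lambda>x. x ^ k) \<circ> Y)"
    by (rule indep_var_compose[OF assms(1)]) auto
  from indep_var_lebesgue_integral[OF this] indep_var_integrable[OF this]
  show "expectation (\<lambda>x. X x ^ j * Y x ^ k) = expectation (\<lambda>x. X x ^ j) * expectation (\<lambda>x. Y x ^ k)"
    and "integrable M (\<lambda>x. X x ^ j * Y x ^ k)"
    using assms by (auto simp: comp_def)
qed

text \<open>When one summand joins, the terms with a first power vanish by centring, and 6 v times
  the previous variance remains; these add up to 3 N (N - 1) v^2. An equality is stated because
  \<open>block_moments\<close> takes differences of such moments.\<close>

lemma (in prob_space) sum_fourth_moment:
  fixes X :: "'i \<Rightarrow> 'a \<Rightarrow> real"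
  assumes "finite I" "indep_vars (\<lambda>_. borel) X I"
    and "\<And>i. i \<in> I \<Longrightarrow> integrable M (\<lambda>x. X i x ^ 4)" "\<And>i. i \<in> I \<Longrightarrow> expectation (X i) = 0"
    and "\<And>i. i \<in> I \<Longrightarrow> expectation (\<lambda>x. X i x ^ 2) = v" "\<And>i. i \<in> I \<Longrightarrow> expectation (\<lambda>x. X i x ^ 4) = w"
  shows "integrable M (\<lambda>x. (\<Sum>i\<in>I. X i x) ^ 4) \<and> expectation (\<lambda>x. \<Sum>i\<in>I. X i x) = 0
    \<and> expectation (\<lambda>x. (\<Sum>i\<in>I. X i x) ^ 2) = real (card I) * v
    \<and> expectation (\<lambda>x. (\<Sum>i\<in>I. X i x) ^ 4) = real (card I) * w + 3 * real (card I) * (real (card I) - 1) * v\<^sup>2"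
  using assms
proof (induction I rule: finite_induct)
  case empty
  then show ?case by simp
next
  case (insert i I)
  let ?S = "\<lambda>x. \<Sum>i\<in>I. X i x"
  have IH: "integrable M (\<lambda>x. ?S x ^ 4)" "expectation ?S = 0" "expectation (\<lambda>x. ?S x ^ 2) = real (card I) * v"
    "expectation (\<lambda>x. ?S x ^ 4) = real (card I) * w + 3 * real (card I) * (real (card I) - 1) * v\<^sup>2"
    using insert.IH[OF indep_vars_subset[OF insert.prems(1)]] insert.prems by auto
  have ind: "indep_var borel (X i) borel ?S"
    using insert by (intro indep_vars_sum) auto
  have [measurable]: "random_variable borel (X i)" "random_variable borel ?S"
    using indep_var_rv1[OF ind] indep_var_rv2[OF ind] by auto
  have iX: "integrable M (\<lambda>x. X i x ^ k)" if "k \<le> 4" for k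
    using integrable_power_le[OF _ insert.prems(2)[of i] that] by simp
  have iS: "integrable M (\<lambda>x. ?S x ^ k)" if "k \<le> 4" for k
    using integrable_power_le[OF _ IH(1) that] by simp
  note pm = indep_var_power_mult[OF ind iX iS]
  have X1: "expectation (\<lambda>x. X i x ^ 1) = 0" "expectation (\<lambda>x. ?S x ^ 1) = 0" using insert.prems IH by auto
  have iXS: "integrable M (\<lambda>x. X i x)" "integrable M ?S" using iX[of 1] iS[of 1] by auto
  have e4: "(\<lambda>x. (X i x + ?S x) ^ 4) = (\<lambda>x. X i x ^ 4 + 4 * (X i x ^ 3 * ?S x ^ 1) + 6 * (X i x ^ 2 * ?S x ^ 2) + 4 * (X i x ^ 1 * ?S x ^ 3) + ?S x ^ 4)"
    by (rule ext) (simp add: eval_nat_numeral algebra_simps)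
  have e2: "(\<lambda>x. (X i x + ?S x) ^ 2) = (\<lambda>x. X i x ^ 2 + 2 * (X i x ^ 1 * ?S x ^ 1) + ?S x ^ 2)"
    by (rule ext) (simp add: eval_nat_numeral algebra_simps)
  have "integrable M (\<lambda>x. (X i x + ?S x) ^ 4)"
    unfolding e4 by (intro Bochner_Integration.integrable_add integrable_mult_right pm(2) iX iS) auto
  moreover have "expectation (\<lambda>x. (X i x + ?S x) ^ 4) = expectation (\<lambda>x. X i x ^ 4) + 4 * expectation (\<lambda>x. X i x ^ 3 * ?S x ^ 1)
     + 6 * expectation (\<lambda>x. X i x ^ 2 * ?S x ^ 2) + 4 * expectation (\<lambda>x. X i x ^ 1 * ?S x ^ 3) + expectation (\<lambda>x. ?S x ^ 4)"
    unfolding e4 using pm(2)[of 3 1] pm(2)[of 2 2] pm(2)[of 1 3] iX[of 4] iS[of 4]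
    by (simp only: Bochner_Integration.integral_add integral_mult_right_zero Bochner_Integration.integrable_add integrable_mult_right one_le_numeral numeral_le_iff semiring_norm order_refl simp_thms)
  moreover have "expectation (\<lambda>x. (X i x + ?S x) ^ 2) = expectation (\<lambda>x. X i x ^ 2) + 2 * expectation (\<lambda>x. X i x ^ 1 * ?S x ^ 1) + expectation (\<lambda>x. ?S x ^ 2)"
    unfolding e2 using pm(2)[of 1 1] iX[of 2] iS[of 2]
    by (simp only: Bochner_Integration.integral_add integral_mult_right_zero Bochner_Integration.integrable_add integrable_mult_right one_le_numeral numeral_le_iff semiring_norm order_refl simp_thms)
  moreover have "expectation (\<lambda>x. X i x + ?S x) = 0"
    using iXS insert.prems(3)[of i] IH(2) by (subst Bochner_Integration.integral_add) auto
  ultimately show ?case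
    using insert.hyps insert.prems(4,5)[of i] IH(3,4) pm(1)[of 3 1] pm(1)[of 2 2] pm(1)[of 1 3] pm(1)[of 1 1] X1
    by (simp add: algebra_simps power2_eq_square)
qed

text \<open>The constants 3 and 15 are the fourth and sixth moments of a standard normal variable,
  and the orders N^2 and N^3 are those of central limit scaling. Vanishing third moments remove the
  product of cubes from the expansion. The bounds are carried jointly because the step for the sixth
  moment uses the second and the fourth.\<close>

lemma (in prob_space) sum_bounded_sixth_moment:
  fixes X :: "'i \<Rightarrow> 'a \<Rightarrow> real"
  assumes "finite I" "indep_vars (\<lambda>_. borel) X I"
    and "\<And>i x. i \<in> I \<Longrightarrow> \<bar>X i x\<bar> \<le> K" "\<And>i. i \<in> I \<Longrightarrow> expectation (X i) = 0"
    and "\<And>i. i \<in> I \<Longrightarrow> expectation (\<lambda>x. X i x ^ 3) = 0"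
  shows "expectation (\<lambda>x. \<Sum>i\<in>I. X i x) = 0
    \<and> expectation (\<lambda>x. (\<Sum>i\<in>I. X i x) ^ 2) \<le> real (card I) * K ^ 2
    \<and> expectation (\<lambda>x. (\<Sum>i\<in>I. X i x) ^ 4) \<le> 3 * real (card I) ^ 2 * K ^ 4
    \<and> expectation (\<lambda>x. (\<Sum>i\<in>I. X i x) ^ 6) \<le> 15 * real (card I) ^ 3 * K ^ 6
    \<and> (\<forall>k. integrable M (\<lambda>x. (\<Sum>i\<in>I. X i x) ^ k))"
  using assms
proof (induction I rule: finite_induct)
  case empty
  then show ?case by (simp add: power_0_left)
next
  case (insert i I)
  let ?S = "\<lambda>x. \<Sum>i\<in>I. X i x" and ?N = "real (card I)"
  have IH: "expectation ?S = 0" "expectation (\<lambda>x. ?S x ^ 2) \<le> ?N * K ^ 2"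
    "expectation (\<lambda>x. ?S x ^ 4) \<le> 3 * ?N ^ 2 * K ^ 4"
    "expectation (\<lambda>x. ?S x ^ 6) \<le> 15 * ?N ^ 3 * K ^ 6" and iS: "\<And>k. integrable M (\<lambda>x. ?S x ^ k)"
    using insert.IH[OF indep_vars_subset[OF insert.prems(1)]] insert.prems by auto
  have ind: "indep_var borel (X i) borel ?S"
    using insert by (intro indep_vars_sum) auto
  have [measurable]: "random_variable borel (X i)" "random_variable borel ?S"
    using indep_var_rv1[OF ind] indep_var_rv2[OF ind] by auto
  have bX: "\<bar>X i x ^ k\<bar> \<le> K ^ k" for k x
    using insert.prems(2)[of i x] by (simp add: power_abs power_mono)
  have iX: "integrable M (\<lambda>x. X i x ^ k)" for k
    using bX by (intro integrable_const_bound[where B="K ^ k"]) auto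
  have EX: "expectation (\<lambda>x. X i x ^ k) \<le> K ^ k" for k
    using integral_mono[OF iX integrable_const[of "K ^ k"], of k] bX[of _ k] by (simp add: prob_space abs_le_iff)
  note pm = indep_var_power_mult[OF ind iX iS]
  have X1: "expectation (\<lambda>x. X i x ^ 1) = 0" "expectation (\<lambda>x. ?S x ^ 1) = 0" "expectation (\<lambda>x. X i x ^ 3) = 0"
    using insert.prems IH by auto
  have iXS: "integrable M (\<lambda>x. X i x)" "integrable M ?S" using iX[of 1] iS[of 1] by auto
  have e6: "(\<lambda>x. (X i x + ?S x) ^ 6) = (\<lambda>x. X i x ^ 6 + 6 * (X i x ^ 5 * ?S x ^ 1) + 15 * (X i x ^ 4 * ?S x ^ 2)
     + 20 * (X i x ^ 3 * ?S x ^ 3) + 15 * (X i x ^ 2 * ?S x ^ 4) + 6 * (X i x ^ 1 * ?S x ^ 5) + ?S x ^ 6)"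
    by (rule ext) (simp add: eval_nat_numeral algebra_simps)
  have e4: "(\<lambda>x. (X i x + ?S x) ^ 4) = (\<lambda>x. X i x ^ 4 + 4 * (X i x ^ 3 * ?S x ^ 1) + 6 * (X i x ^ 2 * ?S x ^ 2) + 4 * (X i x ^ 1 * ?S x ^ 3) + ?S x ^ 4)"
    by (rule ext) (simp add: eval_nat_numeral algebra_simps)
  have e2: "(\<lambda>x. (X i x + ?S x) ^ 2) = (\<lambda>x. X i x ^ 2 + 2 * (X i x ^ 1 * ?S x ^ 1) + ?S x ^ 2)"
    by (rule ext) (simp add: eval_nat_numeral algebra_simps)
  note int_simps = Bochner_Integration.integral_add integral_mult_right_zero Bochner_Integration.integrable_add integrable_mult_right pm iX iS X1 mult_zero_left mult_zero_right
  have E6: "expectation (\<lambda>x. (X i x + ?S x) ^ 6) = expectation (\<lambda>x. X i x ^ 6) + 15 * (expectation (\<lambda>x. X i x ^ 4) * expectation (\<lambda>x. ?S x ^ 2))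
     + 15 * (expectation (\<lambda>x. X i x ^ 2) * expectation (\<lambda>x. ?S x ^ 4)) + expectation (\<lambda>x. ?S x ^ 6)"
    unfolding e6 by (simp only: int_simps add_0_right add_0_left)
  have E4: "expectation (\<lambda>x. (X i x + ?S x) ^ 4) = expectation (\<lambda>x. X i x ^ 4)
     + 6 * (expectation (\<lambda>x. X i x ^ 2) * expectation (\<lambda>x. ?S x ^ 2)) + expectation (\<lambda>x. ?S x ^ 4)"
    unfolding e4 by (simp only: int_simps add_0_right add_0_left)
  have E2: "expectation (\<lambda>x. (X i x + ?S x) ^ 2) = expectation (\<lambda>x. X i x ^ 2) + expectation (\<lambda>x. ?S x ^ 2)"
    unfolding e2 by (simp only: int_simps add_0_right add_0_left)
  have E1: "expectation (\<lambda>x. X i x + ?S x) = 0"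
    using iXS insert.prems(3)[of i] IH(1) by (subst Bochner_Integration.integral_add) auto
  have intk: "integrable M (\<lambda>x. (X i x + ?S x) ^ k)" for k
    unfolding binomial_ring by (intro Bochner_Integration.integrable_sum) (simp add: mult.assoc pm)
  have pr: "expectation (\<lambda>x. X i x ^ a) * expectation (\<lambda>x. ?S x ^ b) \<le> K ^ a * c"
    if "expectation (\<lambda>x. ?S x ^ b) \<le> c" "even b" for a b c
    using that EX[of a] insert.prems(2)[of i undefined] by (intro mult_mono) (auto intro!: integral_nonneg_AE)
  have K0: "0 \<le> K" using insert.prems(2)[of i undefined] by simp
  have b2: "expectation (\<lambda>x. (X i x + ?S x) ^ 2) \<le> (?N + 1) * K ^ 2"
    unfolding E2 using EX[of 2] IH(2) by (simp add: algebra_simps)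
  have b4: "expectation (\<lambda>x. (X i x + ?S x) ^ 4) \<le> 3 * (?N + 1) ^ 2 * K ^ 4"
  proof -
    have "expectation (\<lambda>x. (X i x + ?S x) ^ 4) \<le> K ^ 4 + 6 * (K ^ 2 * (?N * K ^ 2)) + 3 * ?N ^ 2 * K ^ 4"
      unfolding E4 using EX[of 4] pr[OF IH(2), of 2] IH(3) by simp
    also have "\<dots> = (1 + 6 * ?N + 3 * ?N ^ 2) * K ^ 4"
      by (simp add: algebra_simps flip: power_add)
    also have "\<dots> \<le> (3 * (?N + 1) ^ 2) * K ^ 4"
      by (intro mult_right_mono) (simp_all add: algebra_simps power2_eq_square)
    finally show ?thesis .
  qed
  have b6: "expectation (\<lambda>x. (X i x + ?S x) ^ 6) \<le> 15 * (?N + 1) ^ 3 * K ^ 6"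
  proof -
    have "expectation (\<lambda>x. (X i x + ?S x) ^ 6) \<le> K ^ 6 + 15 * (K ^ 4 * (?N * K ^ 2)) + 15 * (K ^ 2 * (3 * ?N ^ 2 * K ^ 4)) + 15 * ?N ^ 3 * K ^ 6"
      unfolding E6 using EX[of 6] pr[OF IH(2), of 4] pr[OF IH(3), of 2] IH(4) by simp
    also have "\<dots> = (1 + 15 * ?N + 45 * ?N ^ 2 + 15 * ?N ^ 3) * K ^ 6"
      by (simp add: algebra_simps flip: power_add)
    also have "\<dots> \<le> (15 * (?N + 1) ^ 3) * K ^ 6"
      by (intro mult_right_mono) (simp_all add: algebra_simps power2_eq_square power3_eq_cube K0)
    finally show ?thesis .
  qed
  show ?case using insert.hyps E1 b2 b4 b6 intk by (simp add: add.commute)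
qed

text \<open>Independence adds the variances, and each variance is at most the raw second moment, the
  quantity that \<open>block_moments\<close> computes.\<close>

lemma (in prob_space) variance_sum_le:
  fixes Y :: "'i \<Rightarrow> 'a \<Rightarrow> real"
  assumes I: "finite I" and ind: "indep_vars (\<lambda>_. borel) Y I"
    and int: "\<And>k. k \<in> I \<Longrightarrow> integrable M (\<lambda>x. (Y k x)\<^sup>2)"
  shows "integrable M (\<lambda>x. ((\<Sum>k\<in>I. Y k x) - (\<Sum>k\<in>I. expectation (Y k)))\<^sup>2) \<and>
    expectation (\<lambda>x. ((\<Sum>k\<in>I. Y k x) - (\<Sum>k\<in>I. expectation (Y k)))\<^sup>2) \<le> (\<Sum>k\<in>I. expectation (\<lambda>x. (Y k x)\<^sup>2))"
  using assms
proof (induction I rule: finite_induct)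
  case empty
  then show ?case by simp
next
  case (insert i I)
  let ?S = "\<lambda>x. (\<Sum>k\<in>I. Y k x) - (\<Sum>k\<in>I. expectation (Y k))" and ?m = "expectation (Y i)"
  have IH: "integrable M (\<lambda>x. (?S x)\<^sup>2)" "expectation (\<lambda>x. (?S x)\<^sup>2) \<le> (\<Sum>k\<in>I. expectation (\<lambda>x. (Y k x)\<^sup>2))"
    using insert.IH[OF indep_vars_subset[OF insert.prems(1)]] insert.prems by auto
  have rv[measurable]: "random_variable borel (Y k)" if "k \<in> insert i I" for k
    using insert.prems(1) that by (auto simp: indep_vars_def)
  have [measurable]: "random_variable borel (\<lambda>x. \<Sum>k\<in>I. Y k x)" "random_variable borel (Y i)" using rv by auto
  have "indep_var borel (Y i) borel (\<lambda>x. \<Sum>k\<in>I. Y k x)"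
    using insert by (intro indep_vars_sum) auto
  then have "indep_var borel ((\<lambda>y. y - ?m) \<circ> Y i) borel ((\<lambda>s. s - (\<Sum>k\<in>I. expectation (Y k))) \<circ> (\<lambda>x. \<Sum>k\<in>I. Y k x))"
    by (rule indep_var_compose) auto
  then have ind: "indep_var borel (\<lambda>x. Y i x - ?m) borel ?S" by (simp add: comp_def)
  have iY: "integrable M (Y k)" if "k \<in> insert i I" for k
    using integrable_power_le[OF rv[OF that] insert.prems(2)[OF that], of 1] by simp
  have iS: "integrable M ?S" using integrable_power_le[OF _ IH(1), of 1] by simp
  have iYm: "integrable M (\<lambda>x. Y i x - ?m)" using iY by simp
  have ES: "expectation ?S = 0" using iY by (subst Bochner_Integration.integral_diff) (auto simp: prob_space)
  have iYm2: "integrable M (\<lambda>x. (Y i x - ?m)\<^sup>2)"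
    using iY[of i] insert.prems(2)[of i] by (simp add: power2_diff)
  have EYm2: "expectation (\<lambda>x. (Y i x - ?m)\<^sup>2) \<le> expectation (\<lambda>x. (Y i x)\<^sup>2)"
    using variance_eq[of "Y i"] iY[of i] insert.prems(2)[of i] by simp
  have e: "(\<lambda>x. (Y i x - ?m + ?S x)\<^sup>2) = (\<lambda>x. (Y i x - ?m)\<^sup>2 + 2 * ((Y i x - ?m) * ?S x) + (?S x)\<^sup>2)"
    by (rule ext) (simp add: power2_eq_square algebra_simps)
  have c: "integrable M (\<lambda>x. (Y i x - ?m) * ?S x)" "expectation (\<lambda>x. (Y i x - ?m) * ?S x) = 0"
    using indep_var_integrable[OF ind iYm iS] indep_var_lebesgue_integral[OF ind iYm iS] ES by auto
  have int': "integrable M (\<lambda>x. (Y i x - ?m + ?S x)\<^sup>2)"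
    unfolding e by (intro Bochner_Integration.integrable_add integrable_mult_right iYm2 c IH)
  have "expectation (\<lambda>x. (Y i x - ?m + ?S x)\<^sup>2) = expectation (\<lambda>x. (Y i x - ?m)\<^sup>2) + 2 * expectation (\<lambda>x. (Y i x - ?m) * ?S x) + expectation (\<lambda>x. (?S x)\<^sup>2)"
    unfolding e by (simp only: Bochner_Integration.integral_add integral_mult_right_zero Bochner_Integration.integrable_add integrable_mult_right iYm2 c(1) IH(1))
  then have "expectation (\<lambda>x. (Y i x - ?m + ?S x)\<^sup>2) \<le> expectation (\<lambda>x. (Y i x)\<^sup>2) + (\<Sum>k\<in>I. expectation (\<lambda>x. (Y k x)\<^sup>2))"
    using c(2) EYm2 IH(2) by simp
  moreover have "(\<Sum>k\<in>insert i I. Y k x) - (\<Sum>k\<in>insert i I. expectation (Y k)) = Y i x - ?m + ?S x" for x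
    using insert.hyps by simp
  ultimately show ?case
    using int' by (simp only: sum.insert[OF insert.hyps(1,2), of "\<lambda>k. expectation (\<lambda>x. (Y k x)\<^sup>2)"])
qed

section \<open>Occupancy numbers of the countsketch rows\<close>

definition occ :: "(nat \<Rightarrow> nat) \<Rightarrow> nat \<Rightarrow> nat \<Rightarrow> nat" where
  "occ h n k = card {i. i < n \<and> h i = k}"

text \<open>If all rows are below \<open>m\<close>, \<open>occ_pow 2\<close> counts the ordered
  pairs of columns sharing a row, a column paired with itself included, and \<open>occ_pow 3\<close>
  counts triples.\<close>

definition occ_pow :: "nat \<Rightarrow> nat \<Rightarrow> nat \<Rightarrow> (nat \<Rightarrow> nat) \<Rightarrow> real" where
  "occ_pow q n m h = (\<Sum>k<m. real (occ h n k) ^ q)"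

definition unif_rows :: "nat \<Rightarrow> nat \<Rightarrow> (nat \<Rightarrow> nat) pmf" where
  "unif_rows n m = Pi_pmf {..<n} 0 (\<lambda>_. pmf_of_set {..<m})"

lemma finite_set_Pi_pmf:
  assumes "finite A" "\<And>i. i \<in> A \<Longrightarrow> finite (set_pmf (p i))"
  shows "finite (set_pmf (Pi_pmf A d p))"
  by (rule finite_subset[OF set_Pi_pmf_subset'[OF assms(1)]]) (auto intro!: finite_PiE_dflt simp: assms)

lemma lessThan_nonempty: "0 < m \<Longrightarrow> {..<m} \<noteq> {}" for m :: nat
  by auto

lemma finite_set_unif_rows: "m > 0 \<Longrightarrow> finite (set_pmf (unif_rows n m))"
  unfolding unif_rows_def by (rule finite_set_Pi_pmf) (auto simp: set_pmf_of_set lessThan_nonempty)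

lemma set_unif_rows: "m > 0 \<Longrightarrow> h \<in> set_pmf (unif_rows n m) \<Longrightarrow> i < n \<Longrightarrow> h i < m"
  using set_Pi_pmf[of "{..<n}" 0 "\<lambda>_. pmf_of_set {..<m}"]
  by (auto simp: unif_rows_def PiE_dflt_def set_pmf_of_set lessThan_nonempty)

lemma integrable_unif_rows [simp]: "m > 0 \<Longrightarrow> integrable (measure_pmf (unif_rows n m)) (f :: _ \<Rightarrow> real)"
  by (rule integrable_measure_pmf_finite) (rule finite_set_unif_rows)

text \<open>Drawing the row of the last column after all others yields a one-step recursion, on
  which the occupancy moments are computed by induction on \<open>n\<close>.\<close>

lemma expectation_unif_rows_Suc:
  fixes F :: "(nat \<Rightarrow> nat) \<Rightarrow> real"
  assumes m: "m > 0"
  shows "measure_pmf.expectation (unif_rows (Suc n) m) F =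
    measure_pmf.expectation (unif_rows n m) (\<lambda>h. (\<Sum>x<m. F (h(n := x))) / real m)"
proof -
  let ?H = "unif_rows n m" and ?u = "pmf_of_set {..<m}"
  have "unif_rows (Suc n) m = do {y \<leftarrow> ?u; f \<leftarrow> ?H; return_pmf (f(n := y))}"
    unfolding unif_rows_def lessThan_Suc by (subst Pi_pmf_insert') auto
  also have "\<dots> = ?H \<bind> (\<lambda>f. map_pmf (\<lambda>y. f(n := y)) ?u)"
    unfolding map_pmf_def by (rule bind_commute_pmf)
  finally have eq: "unif_rows (Suc n) m = ?H \<bind> (\<lambda>f. map_pmf (\<lambda>y. f(n := y)) ?u)" .
  have "measure_pmf.expectation (unif_rows (Suc n) m) F
     = (\<Sum>h\<in>set_pmf ?H. pmf ?H h *\<^sub>R measure_pmf.expectation (map_pmf (\<lambda>y. h(n := y)) ?u) F)"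
    unfolding eq using m by (intro pmf_expectation_bind finite_set_unif_rows) (auto simp: set_pmf_of_set lessThan_nonempty)
  also have "\<dots> = (\<Sum>h\<in>set_pmf ?H. pmf ?H h *\<^sub>R ((\<Sum>x<m. F (h(n := x))) / real m))"
    using m by (simp add: integral_pmf_of_set lessThan_nonempty)
  also have "\<dots> = measure_pmf.expectation ?H (\<lambda>h. (\<Sum>x<m. F (h(n := x))) / real m)"
    using m by (intro integral_measure_pmf[symmetric] finite_set_unif_rows) auto
  finally show ?thesis .
qed

lemma expectation_unif_rows_cong:
  fixes F G :: "(nat \<Rightarrow> nat) \<Rightarrow> real"
  assumes "\<And>h. h \<in> set_pmf (unif_rows n m) \<Longrightarrow> F h = G h"
  shows "measure_pmf.expectation (unif_rows n m) F = measure_pmf.expectation (unif_rows n m) G"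
  by (rule integral_cong_AE) (auto simp: AE_measure_pmf_iff assms)

lemma expectation_unif_rows_mono:
  fixes F G :: "(nat \<Rightarrow> nat) \<Rightarrow> real"
  assumes "m > 0" "\<And>h. h \<in> set_pmf (unif_rows n m) \<Longrightarrow> F h \<le> G h"
  shows "measure_pmf.expectation (unif_rows n m) F \<le> measure_pmf.expectation (unif_rows n m) G"
  using assms by (intro integral_mono_AE) (auto simp: AE_measure_pmf_iff)

lemma occ_upd: "occ (h(n := x)) (Suc n) k = occ h n k + (if k = x then 1 else 0)"
proof -
  have "{i. i < Suc n \<and> (h(n := x)) i = k} = {i. i < n \<and> h i = k} \<union> (if k = x then {n} else {})"
    by (auto simp: less_Suc_eq)
  then show ?thesis by (auto simp: occ_def card_insert_if)
qed

lemma sum_occ: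
  assumes "\<And>i. i < n \<Longrightarrow> h i < m"
  shows "(\<Sum>k<m. occ h n k) = n"
proof -
  have "(\<Sum>k<m. occ h n k) = card (\<Union>k<m. {i. i < n \<and> h i = k})"
    unfolding occ_def by (subst card_UN_disjoint) auto
  also have "(\<Union>k<m. {i. i < n \<and> h i = k}) = {..<n}" using assms by auto
  finally show ?thesis by simp
qed

lemma occ_pow_upd:
  assumes "x < m"
  shows "occ_pow q (Suc n) m (h(n := x)) = occ_pow q n m h + ((real (occ h n x) + 1) ^ q - real (occ h n x) ^ q)"
proof -
  have "occ_pow q (Suc n) m (h(n := x)) = (\<Sum>k<m. real (occ h n k) ^ q + (if k = x then (real (occ h n x) + 1) ^ q - real (occ h n x) ^ q else 0))"
    unfolding occ_pow_def occ_upd by (intro sum.cong) (auto simp: add.commute)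
  then show ?thesis using assms by (simp add: sum.distrib occ_pow_def)
qed

lemma occ_pow_one:
  assumes "m > 0" "h \<in> set_pmf (unif_rows n m)"
  shows "(\<Sum>k<m. real (occ h n k)) = real n"
  using sum_occ[of n h m] set_unif_rows[OF assms] by (metis of_nat_sum)

text \<open>Each of the n columns pairs with itself, and each of the n (n - 1) other ordered pairs
  shares a row with probability 1/m.\<close>

lemma expectation_occ_square:
  assumes m: "m > 0"
  shows "measure_pmf.expectation (unif_rows n m) (occ_pow 2 n m) = real n + real n * (real n - 1) / real m"
proof (induction n)
  case 0
  then show ?case by (simp add: occ_pow_def occ_def)
next
  case (Suc n)
  have "measure_pmf.expectation (unif_rows (Suc n) m) (occ_pow 2 (Suc n) m)
    = measure_pmf.expectation (unif_rows n m) (\<lambda>h. (\<Sum>x<m. occ_pow 2 (Suc n) m (h(n := x))) / real m)"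
    by (rule expectation_unif_rows_Suc[OF m])
  also have "\<dots> = measure_pmf.expectation (unif_rows n m) (\<lambda>h. occ_pow 2 n m h + (2 * real n / real m + 1))"
  proof (rule expectation_unif_rows_cong)
    fix h assume h: "h \<in> set_pmf (unif_rows n m)"
    have "(\<Sum>x<m. occ_pow 2 (Suc n) m (h(n := x))) = (\<Sum>x<m. occ_pow 2 n m h + 1 + 2 * real (occ h n x))"
      by (rule sum.cong) (auto simp: occ_pow_upd power2_eq_square algebra_simps)
    also have "\<dots> = real m * (occ_pow 2 n m h + 1) + 2 * real n"
      by (simp add: sum.distrib sum_distrib_left[symmetric] occ_pow_one[OF m h])
    finally show "(\<Sum>x<m. occ_pow 2 (Suc n) m (h(n := x))) / real m = occ_pow 2 n m h + (2 * real n / real m + 1)"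
      using m by (simp add: field_simps)
  qed
  also have "\<dots> = real (Suc n) + real (Suc n) * (real (Suc n) - 1) / real m"
    using m Suc by (simp add: field_simps)
  finally show ?case .
qed

text \<open>The exact value has n (n - 1) and n (n - 1) (n - 2) in place of n^2 and n^3; the rounded
  form suffices for the rates and passes through the induction with 3/m + (6 n + 1)/m^2 to
  spare.\<close>

lemma expectation_occ_cube:
  assumes m: "m > 0"
  shows "measure_pmf.expectation (unif_rows n m) (occ_pow 3 n m) \<le> real n + 3 * real n ^ 2 / real m + real n ^ 3 / real m ^ 2"
proof (induction n)
  case 0
  then show ?case by (simp add: occ_pow_def occ_def)
next
  case (Suc n)
  have "measure_pmf.expectation (unif_rows (Suc n) m) (occ_pow 3 (Suc n) m)
    = measure_pmf.expectation (unif_rows n m) (\<lambda>h. (\<Sum>x<m. occ_pow 3 (Suc n) m (h(n := x))) / real m)"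
    by (rule expectation_unif_rows_Suc[OF m])
  also have "\<dots> = measure_pmf.expectation (unif_rows n m) (\<lambda>h. occ_pow 3 n m h + 3 / real m * occ_pow 2 n m h + (3 * real n / real m + 1))"
  proof (rule expectation_unif_rows_cong)
    fix h assume h: "h \<in> set_pmf (unif_rows n m)"
    have "(\<Sum>x<m. occ_pow 3 (Suc n) m (h(n := x))) = (\<Sum>x<m. occ_pow 3 n m h + 1 + 3 * real (occ h n x) + 3 * real (occ h n x) ^ 2)"
      by (rule sum.cong) (auto simp: occ_pow_upd power2_eq_square power3_eq_cube algebra_simps)
    also have "\<dots> = real m * (occ_pow 3 n m h + 1) + 3 * real n + 3 * occ_pow 2 n m h"
      by (simp add: sum.distrib sum_distrib_left[symmetric] occ_pow_one[OF m h] occ_pow_def)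
    finally show "(\<Sum>x<m. occ_pow 3 (Suc n) m (h(n := x))) / real m = occ_pow 3 n m h + 3 / real m * occ_pow 2 n m h + (3 * real n / real m + 1)"
      using m by (simp add: field_simps)
  qed
  also have "\<dots> = measure_pmf.expectation (unif_rows n m) (occ_pow 3 n m) + 3 / real m * (real n + real n * (real n - 1) / real m) + (3 * real n / real m + 1)"
    using m by (simp add: expectation_occ_square)
  also have "\<dots> \<le> (real n + 3 * real n ^ 2 / real m + real n ^ 3 / real m ^ 2) + 3 / real m * (real n + real n * (real n - 1) / real m) + (3 * real n / real m + 1)"
    using Suc by simp
  also have "\<dots> \<le> real (Suc n) + 3 * real (Suc n) ^ 2 / real m + real (Suc n) ^ 3 / real m ^ 2"
  proof -
    have "(real (Suc n) + 3 * real (Suc n) ^ 2 / real m + real (Suc n) ^ 3 / real m ^ 2) -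
      ((real n + 3 * real n ^ 2 / real m + real n ^ 3 / real m ^ 2) + 3 / real m * (real n + real n * (real n - 1) / real m) + (3 * real n / real m + 1))
      = 3 / real m + (6 * real n + 1) / real m ^ 2"
      using m by (simp add: field_simps power2_eq_square power3_eq_cube)
    moreover have "0 \<le> 3 / real m + (6 * real n + 1) / real m ^ 2" by simp
    ultimately show ?thesis by linarith
  qed
  finally show ?case .
qed

text \<open>A martingale argument: placing a column in row x changes the centred count by twice the
  difference of \<open>occ h n x\<close> and its average n/m over x, which has mean zero given the
  earlier rows. So the cross term drops, and each step adds at most 4/m times the mean of
  \<open>occ_pow 2\<close>.\<close>

lemma variance_occ_square:
  assumes m: "m > 0"
  shows "measure_pmf.expectation (unif_rows n m) (\<lambda>h. (occ_pow 2 n m h - (real n + real n * (real n - 1) / real m))\<^sup>2)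
    \<le> 4 * real n * (real n + real n ^ 2 / real m) / real m"
proof (induction n)
  case 0
  then show ?case by (simp add: occ_pow_def occ_def)
next
  case (Suc n)
  define c where "c = (\<lambda>n. real n + real n * (real n - 1) / real m)"
  have "measure_pmf.expectation (unif_rows (Suc n) m) (\<lambda>h. (occ_pow 2 (Suc n) m h - c (Suc n))\<^sup>2)
    = measure_pmf.expectation (unif_rows n m) (\<lambda>h. (\<Sum>x<m. (occ_pow 2 (Suc n) m (h(n := x)) - c (Suc n))\<^sup>2) / real m)"
    by (rule expectation_unif_rows_Suc[OF m])
  also have "\<dots> \<le> measure_pmf.expectation (unif_rows n m) (\<lambda>h. (occ_pow 2 n m h - c n)\<^sup>2 + 4 / real m * occ_pow 2 n m h)"
  proof (rule expectation_unif_rows_mono[OF m])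
    fix h assume h: "h \<in> set_pmf (unif_rows n m)"
    define Q where "Q = occ_pow 2 n m h - c n"
    have "(\<Sum>x<m. (occ_pow 2 (Suc n) m (h(n := x)) - c (Suc n))\<^sup>2) = (\<Sum>x<m. (Q + 2 * (real (occ h n x) - real n / real m))\<^sup>2)"
    proof (rule sum.cong[OF refl])
      fix x assume "x \<in> {..<m}"
      moreover have "c (Suc n) = c n + 1 + 2 * real n / real m" using m by (simp add: c_def field_simps)
      ultimately show "(occ_pow 2 (Suc n) m (h(n := x)) - c (Suc n))\<^sup>2 = (Q + 2 * (real (occ h n x) - real n / real m))\<^sup>2"
        by (simp add: occ_pow_upd Q_def power2_eq_square algebra_simps)
    qed
    also have "\<dots> = (\<Sum>x<m. Q\<^sup>2 - 4 * Q * (real n / real m) + 4 * (real n / real m)\<^sup>2 + (4 * Q - 8 * (real n / real m)) * real (occ h n x) + 4 * real (occ h n x) ^ 2)"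
      by (rule sum.cong) (auto simp: power2_eq_square algebra_simps)
    also have "\<dots> = real m * (Q\<^sup>2 - 4 * Q * (real n / real m) + 4 * (real n / real m)\<^sup>2) + (4 * Q - 8 * (real n / real m)) * real n + 4 * occ_pow 2 n m h"
    proof -
      have "(\<Sum>x<m. a + b * real (occ h n x) + 4 * real (occ h n x) ^ 2) = real m * a + b * real n + 4 * occ_pow 2 n m h" for a b
        by (simp only: sum.distrib sum_distrib_left[symmetric] occ_pow_one[OF m h] occ_pow_def sum_constant card_lessThan)
      then show ?thesis .
    qed
    \<comment> \<open>The terms linear in \<open>Q\<close> cancel because the occupancies sum to n;
      the negative term is dropped next.\<close>
    also have "\<dots> = real m * Q\<^sup>2 + 4 * occ_pow 2 n m h - 4 * (real n)\<^sup>2 / real m"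
      using m by (simp add: field_simps power2_eq_square)
    also have "\<dots> \<le> real m * (Q\<^sup>2 + 4 / real m * occ_pow 2 n m h)"
      using m by (simp add: field_simps)
    finally show "(\<Sum>x<m. (occ_pow 2 (Suc n) m (h(n := x)) - c (Suc n))\<^sup>2) / real m \<le> (occ_pow 2 n m h - c n)\<^sup>2 + 4 / real m * occ_pow 2 n m h"
      using m by (simp add: Q_def pos_divide_le_eq mult.commute)
  qed
  also have "\<dots> = measure_pmf.expectation (unif_rows n m) (\<lambda>h. (occ_pow 2 n m h - c n)\<^sup>2) + 4 / real m * c n"
    using m by (simp add: expectation_occ_square c_def)
  also have "\<dots> \<le> 4 * real n * (real n + real n ^ 2 / real m) / real m + 4 / real m * c n"
    using Suc by (simp add: c_def)
  also have "\<dots> \<le> 4 * real n * (real n + real n ^ 2 / real m) / real m + 4 / real m * (real n + real n ^ 2 / real m)"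
    using m by (intro add_mono mult_left_mono) (auto simp: c_def power2_eq_square divide_right_mono mult_left_mono)
  also have "\<dots> = 4 * real (Suc n) * (real n + real n ^ 2 / real m) / real m"
    using m by (simp add: field_simps)
  also have "\<dots> \<le> 4 * real (Suc n) * (real (Suc n) + real (Suc n) ^ 2 / real m) / real m"
    using m by (intro divide_right_mono mult_left_mono add_mono divide_right_mono power_mono) auto
  finally show ?case by (simp add: c_def)
qed

text \<open>A natural number is at most its square. In \<open>cs_char\<close> this makes the
  conditional variance nonnegative.\<close>

lemma occ_square_ge:
  assumes "k > 0" "h \<in> set_pmf (unif_rows n k)"
  shows "real n \<le> occ_pow 2 n k h"
proof -
  have "(\<Sum>j<k. real (occ h n j)) \<le> (\<Sum>j<k. real (occ h n j) ^ 2)"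
  proof (rule sum_mono)
    fix j
    have "occ h n j * 1 \<le> occ h n j * occ h n j" by (cases "occ h n j") auto
    then show "real (occ h n j) \<le> real (occ h n j) ^ 2"
      by (simp only: power2_eq_square of_nat_mult[symmetric] of_nat_le_iff mult_1_right)
  qed
  then show ?thesis using occ_pow_one[OF assms] by (simp add: occ_pow_def)
qed

text \<open>\<open>\<tau>\<close> is the weight of one row product in the scaled score. The first
  rate makes the truncated part of the Lindeberg error vanish; the second is merely bounded, so what
  it multiplies has to be made small by the truncation level; the third makes the conditional
  variance deterministic in the limit.\<close>

lemma occ_pow_rates:
  assumes k: "0 < k" "k \<le> n"
  defines "\<tau> \<equiv> sqrt (real k) / real n"
  shows "\<tau> ^ 3 * measure_pmf.expectation (unif_rows n k) (occ_pow 3 n k) \<le> 5 / sqrt (real k)"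
    "\<tau>\<^sup>2 * measure_pmf.expectation (unif_rows n k) (occ_pow 2 n k) \<le> 2"
    "measure_pmf.expectation (unif_rows n k) (\<lambda>h. \<bar>\<tau>\<^sup>2 * (occ_pow 2 n k h - real n) - 1\<bar>) \<le> sqrt (8 / real n) + 1 / real n"
proof -
  have n: "n > 0" using k by simp
  have \<tau>2: "\<tau>\<^sup>2 = real k / (real n)\<^sup>2" by (simp add: \<tau>_def power_divide)
  have \<tau>0: "\<tau> \<ge> 0" by (simp add: \<tau>_def)
  have \<tau>3: "\<tau> ^ 3 = sqrt (real k) * real k / real n ^ 3"
    by (simp add: \<tau>_def power_divide power3_eq_cube)
  have kn: "real k \<le> real n" using k by simp
  have "\<tau> ^ 3 * measure_pmf.expectation (unif_rows n k) (occ_pow 3 n k)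
    \<le> sqrt (real k) * real k / real n ^ 3 * (real n + 3 * real n ^ 2 / real k + real n ^ 3 / real k ^ 2)"
    unfolding \<tau>3 using expectation_occ_cube[OF k(1)] by (intro mult_left_mono) auto
  also have "\<dots> = sqrt (real k) * (real k / real n ^ 2 + 3 / real n + 1 / real k)"
    using n k by (simp add: field_simps power2_eq_square power3_eq_cube)
  \<comment> \<open>Each of the three terms is compared with 1/k by means of
    \<open>k \<le> n\<close>, whence 5 = 1 + 3 + 1.\<close>
  also have "\<dots> \<le> sqrt (real k) * (1 / real k + 3 / real k + 1 / real k)"
  proof (intro mult_left_mono add_mono)
    have "real k * real k \<le> real n ^ 2" unfolding power2_eq_square using kn by (intro mult_mono) auto
    then show "real k / real n ^ 2 \<le> 1 / real k" using n k by (simp add: field_simps)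
    show "3 / real n \<le> 3 / real k" using n k by (simp add: field_simps)
  qed auto
  also have "\<dots> = 5 * (sqrt (real k) / real k)" by (simp add: field_simps)
  also have "sqrt (real k) / real k = 1 / sqrt (real k)" using real_div_sqrt[of "real k"] k by (simp add: field_simps)
  finally show "\<tau> ^ 3 * measure_pmf.expectation (unif_rows n k) (occ_pow 3 n k) \<le> 5 / sqrt (real k)" by simp
  have "\<tau>\<^sup>2 * measure_pmf.expectation (unif_rows n k) (occ_pow 2 n k) = real k / real n + (real n - 1) / real n"
    unfolding \<tau>2 expectation_occ_square[OF k(1)] using n k by (simp add: field_simps power2_eq_square)
  also have "\<dots> \<le> 1 + 1" using n kn by (intro add_mono) (auto simp: divide_le_eq)
  finally show "\<tau>\<^sup>2 * measure_pmf.expectation (unif_rows n k) (occ_pow 2 n k) \<le> 2" by simp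
  define \<mu> where "\<mu> = real n + real n * (real n - 1) / real k"
  define x where "x = measure_pmf.expectation (unif_rows n k) (\<lambda>h. (occ_pow 2 n k h - \<mu>)\<^sup>2)"
  \<comment> \<open>Subtracting \<open>n\<close> removes the diagonal pairs; the scaled mean of what
    is left falls short of 1 by exactly 1/n.\<close>
  have \<tau>\<mu>: "\<tau>\<^sup>2 * (\<mu> - real n) = 1 - 1 / real n"
    unfolding \<tau>2 \<mu>_def using n k by (simp add: field_simps power2_eq_square)
  \<comment> \<open>Nonnegativity of a variance, in the form (E |Y|)^2 \<le> E Y^2.\<close>
  have cs: "(measure_pmf.expectation (unif_rows n k) (\<lambda>h. \<bar>occ_pow 2 n k h - \<mu>\<bar>))\<^sup>2 \<le> x"
  proof -
    have "measure_pmf.variance (unif_rows n k) (\<lambda>h. \<bar>occ_pow 2 n k h - \<mu>\<bar>) = x - (measure_pmf.expectation (unif_rows n k) (\<lambda>h. \<bar>occ_pow 2 n k h - \<mu>\<bar>))\<^sup>2"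
      using k by (subst measure_pmf.variance_eq) (auto simp: x_def)
    then show ?thesis using measure_pmf.variance_positive[of "unif_rows n k" "\<lambda>h. \<bar>occ_pow 2 n k h - \<mu>\<bar>"] by simp
  qed
  have "(\<tau>\<^sup>2 * measure_pmf.expectation (unif_rows n k) (\<lambda>h. \<bar>occ_pow 2 n k h - \<mu>\<bar>))\<^sup>2 \<le> (\<tau>\<^sup>2)\<^sup>2 * x"
    unfolding power_mult_distrib[of "\<tau>\<^sup>2"] using cs by (intro mult_left_mono) auto
  also have "\<dots> \<le> (\<tau>\<^sup>2)\<^sup>2 * (4 * real n * (real n + real n ^ 2 / real k) / real k)"
    unfolding x_def \<mu>_def by (intro mult_left_mono variance_occ_square k) auto
  also have "\<dots> = 4 * real k / real n ^ 2 + 4 / real n"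
    unfolding \<tau>2 using n k by (simp add: field_simps power2_eq_square)
  also have "\<dots> \<le> 4 / real n + 4 / real n"
  proof (intro add_right_mono)
    show "4 * real k / real n ^ 2 \<le> 4 / real n" using n kn by (simp add: field_simps power2_eq_square)
  qed
  finally have "(\<tau>\<^sup>2 * measure_pmf.expectation (unif_rows n k) (\<lambda>h. \<bar>occ_pow 2 n k h - \<mu>\<bar>))\<^sup>2 \<le> 8 / real n" by simp
  then have s: "\<tau>\<^sup>2 * measure_pmf.expectation (unif_rows n k) (\<lambda>h. \<bar>occ_pow 2 n k h - \<mu>\<bar>) \<le> sqrt (8 / real n)"
    by (rule real_le_rsqrt)
  have "measure_pmf.expectation (unif_rows n k) (\<lambda>h. \<bar>\<tau>\<^sup>2 * (occ_pow 2 n k h - real n) - 1\<bar>)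
    \<le> measure_pmf.expectation (unif_rows n k) (\<lambda>h. \<tau>\<^sup>2 * \<bar>occ_pow 2 n k h - \<mu>\<bar> + 1 / real n)"
  proof (rule expectation_unif_rows_mono[OF k(1)])
    fix h
    have "\<tau>\<^sup>2 * (occ_pow 2 n k h - real n) - 1 = \<tau>\<^sup>2 * (occ_pow 2 n k h - \<mu>) - 1 / real n"
      using \<tau>\<mu> by (simp add: algebra_simps)
    also have "\<bar>\<dots>\<bar> \<le> \<bar>\<tau>\<^sup>2 * (occ_pow 2 n k h - \<mu>)\<bar> + \<bar>1 / real n\<bar>" by (rule abs_triangle_ineq4)
    finally show "\<bar>\<tau>\<^sup>2 * (occ_pow 2 n k h - real n) - 1\<bar> \<le> \<tau>\<^sup>2 * \<bar>occ_pow 2 n k h - \<mu>\<bar> + 1 / real n"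
      by (simp add: abs_mult)
  qed
  also have "\<dots> = \<tau>\<^sup>2 * measure_pmf.expectation (unif_rows n k) (\<lambda>h. \<bar>occ_pow 2 n k h - \<mu>\<bar>) + 1 / real n"
    using k by simp
  finally show "measure_pmf.expectation (unif_rows n k) (\<lambda>h. \<bar>\<tau>\<^sup>2 * (occ_pow 2 n k h - real n) - 1\<bar>) \<le> sqrt (8 / real n) + 1 / real n"
    using s by simp
qed

section \<open>Independence of data and sketch; drawing the rows before the signs\<close>

lemma indep_vars_pair:
  assumes M: "prob_space M" and N: "prob_space N" and I: "finite I" "I \<noteq> {}"
    and X: "prob_space.indep_vars M A X I" and Y: "prob_space.indep_vars N B Y I"
  shows "prob_space.indep_vars (M \<Otimes>\<^sub>M N) (\<lambda>i. A i \<Otimes>\<^sub>M B i) (\<lambda>i p. (X i (fst p), Y i (snd p))) I"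
proof -
  interpret M: prob_space M by fact
  interpret N: prob_space N by fact
  interpret PP: pair_prob_space M N ..
  have rvX[measurable]: "X i \<in> measurable M (A i)" if "i \<in> I" for i using X that by (auto simp: M.indep_vars_def)
  have rvY[measurable]: "Y i \<in> measurable N (B i)" if "i \<in> I" for i using Y that by (auto simp: N.indep_vars_def)
  have meas: "measure (M \<Otimes>\<^sub>M N) (a \<times> b) = measure M a * measure N b" if "a \<in> sets M" "b \<in> sets N" for a b
    using that by (simp add: measure_def N.emeasure_pair_measure_Times enn2real_mult)
  show ?thesis
  \<comment> \<open>Rectangles are stable under intersection and generate the product sigma-algebra,
    and their preimages are again rectangles, on which the product measure splits.\<close>
  proof (subst PP.indep_vars_finite[OF I(2,1), where E="\<lambda>i. {a \<times> b | a b. a \<in> sets (A i) \<and> b \<in> sets (B i)}"])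
    show "sets (A i \<Otimes>\<^sub>M B i) = sigma_sets (space (A i \<Otimes>\<^sub>M B i)) {a \<times> b |a b. a \<in> sets (A i) \<and> b \<in> sets (B i)}" for i
      by (simp add: sets_pair_measure space_pair_measure)
    show "PP.random_variable (A i \<Otimes>\<^sub>M B i) (\<lambda>p. (X i (fst p), Y i (snd p)))" if "i \<in> I" for i
      using that by measurable
    show "Int_stable {a \<times> b |a b. a \<in> sets (A i) \<and> b \<in> sets (B i)}" for i
      by (rule Int_stable_pair_measure_generator)
    show "space (A i \<Otimes>\<^sub>M B i) \<in> {a \<times> b |a b. a \<in> sets (A i) \<and> b \<in> sets (B i)}" for i
      by (auto simp: space_pair_measure)
    show "{a \<times> b |a b. a \<in> sets (A i) \<and> b \<in> sets (B i)} \<subseteq> Pow (space (A i \<Otimes>\<^sub>M B i))" for i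
      by (auto simp: space_pair_measure dest: sets.sets_into_space)
    show "\<forall>C\<in>Pi I (\<lambda>i. {a \<times> b |a b. a \<in> sets (A i) \<and> b \<in> sets (B i)}).
       PP.prob (\<Inter>j\<in>I. (\<lambda>p. (X j (fst p), Y j (snd p))) -` C j \<inter> space (M \<Otimes>\<^sub>M N))
       = (\<Prod>j\<in>I. PP.prob ((\<lambda>p. (X j (fst p), Y j (snd p))) -` C j \<inter> space (M \<Otimes>\<^sub>M N)))"
    proof
      fix C assume "C \<in> Pi I (\<lambda>i. {a \<times> b |a b. a \<in> sets (A i) \<and> b \<in> sets (B i)})"
      then have "\<forall>i\<in>I. \<exists>a b. C i = a \<times> b \<and> a \<in> sets (A i) \<and> b \<in> sets (B i)" by (simp add: Pi_iff)
      then obtain a b where C: "\<And>i. i \<in> I \<Longrightarrow> C i = a i \<times> b i" "\<And>i. i \<in> I \<Longrightarrow> a i \<in> sets (A i)" "\<And>i. i \<in> I \<Longrightarrow> b i \<in> sets (B i)"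
        by metis
      have pre: "(\<lambda>p. (X j (fst p), Y j (snd p))) -` C j \<inter> space (M \<Otimes>\<^sub>M N) = (X j -` a j \<inter> space M) \<times> (Y j -` b j \<inter> space N)"
        if "j \<in> I" for j using C(1)[OF that] by (auto simp: space_pair_measure)
      have sx: "X j -` a j \<inter> space M \<in> sets M" "Y j -` b j \<inter> space N \<in> sets N" if "j \<in> I" for j
        using that C rvX rvY by (auto intro: measurable_sets)
      have "(\<Inter>j\<in>I. (\<lambda>p. (X j (fst p), Y j (snd p))) -` C j \<inter> space (M \<Otimes>\<^sub>M N))
         = (\<Inter>j\<in>I. X j -` a j \<inter> space M) \<times> (\<Inter>j\<in>I. Y j -` b j \<inter> space N)"
        using pre I(2) by auto
      then have "PP.prob (\<Inter>j\<in>I. (\<lambda>p. (X j (fst p), Y j (snd p))) -` C j \<inter> space (M \<Otimes>\<^sub>M N))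
         = M.prob (\<Inter>j\<in>I. X j -` a j \<inter> space M) * N.prob (\<Inter>j\<in>I. Y j -` b j \<inter> space N)"
        using I sx by (simp only:) (intro meas sets.finite_INT, auto)
      also have "\<dots> = (\<Prod>j\<in>I. M.prob (X j -` a j \<inter> space M)) * (\<Prod>j\<in>I. N.prob (Y j -` b j \<inter> space N))"
        using M.indep_varsD_finite[OF X I(2,1)] N.indep_varsD_finite[OF Y I(2,1)] C by simp
      also have "\<dots> = (\<Prod>j\<in>I. PP.prob ((\<lambda>p. (X j (fst p), Y j (snd p))) -` C j \<inter> space (M \<Otimes>\<^sub>M N)))"
        using pre sx by (simp add: prod.distrib[symmetric] meas)
      finally show "PP.prob (\<Inter>j\<in>I. (\<lambda>p. (X j (fst p), Y j (snd p))) -` C j \<inter> space (M \<Otimes>\<^sub>M N))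
       = (\<Prod>j\<in>I. PP.prob ((\<lambda>p. (X j (fst p), Y j (snd p))) -` C j \<inter> space (M \<Otimes>\<^sub>M N)))" .
    qed
  qed
qed

definition signs :: "nat \<Rightarrow> (nat \<Rightarrow> real) pmf" where
  "signs n = Pi_pmf {..<n} 1 (\<lambda>_. pmf_of_set {-1, 1})"

text \<open>Off \<open>{..<n}\<close> the value is the default pair of \<open>cs_sketch\<close>, so
  that \<open>cs_sketch_eq\<close> is an equality of distributions on whole functions.\<close>

definition glue :: "nat \<Rightarrow> (nat \<Rightarrow> nat) \<Rightarrow> (nat \<Rightarrow> real) \<Rightarrow> nat \<Rightarrow> nat \<times> real" where
  "glue n h s = (\<lambda>i. if i \<in> {..<n} then (h i, s i) else (0, 1))"

text \<open>Row and sign of a column are independent, hence all rows may be drawn before all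
  signs.\<close>

lemma cs_sketch_eq: "cs_sketch n m = unif_rows n m \<bind> (\<lambda>h. map_pmf (glue n h) (signs n))"
proof -
  have "cs_sketch n m = Pi_pmf {..<n} (0, 1) (\<lambda>_. pmf_of_set {..<m} \<bind> (\<lambda>x. pmf_of_set {-1, 1} \<bind> (\<lambda>y. return_pmf (x, y))))"
    by (simp add: cs_sketch_def pair_pmf_def)
  also have "\<dots> = unif_rows n m \<bind> (\<lambda>h. Pi_pmf {..<n} (0, 1) (\<lambda>i. pmf_of_set {-1, 1} \<bind> (\<lambda>y. return_pmf (h i, y))))"
    unfolding unif_rows_def by (rule Pi_pmf_bind) simp
  also have "\<dots> = unif_rows n m \<bind> (\<lambda>h. signs n \<bind> (\<lambda>s. Pi_pmf {..<n} (0, 1) (\<lambda>i. return_pmf (h i, s i))))"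
    unfolding signs_def by (subst Pi_pmf_bind[where d'=1]) simp_all
  also have "\<dots> = unif_rows n m \<bind> (\<lambda>h. map_pmf (glue n h) (signs n))"
    by (simp add: map_pmf_def glue_def)
  finally show ?thesis .
qed

lemma finite_set_signs: "finite (set_pmf (signs n))"
  unfolding signs_def by (rule finite_set_Pi_pmf) (auto simp: set_pmf_of_set)

text \<open>This is the conditioning on the rows: inside, \<open>h\<close> is frozen while data and
  signs are random. Finitely many row assignments have positive probability, so the outer
  expectation is a finite sum.\<close>

lemma integral_cs_sketch:
  fixes F :: "'a \<times> (nat \<Rightarrow> nat \<times> real) \<Rightarrow> 'b::{banach, second_countable_topology}"
  assumes M: "prob_space M" and m: "m > 0"
    and F[measurable]: "F \<in> borel_measurable (M \<Otimes>\<^sub>M measure_pmf (cs_sketch n m))" and B: "\<And>p. norm (F p) \<le> B"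
  shows "integral\<^sup>L (M \<Otimes>\<^sub>M measure_pmf (cs_sketch n m)) F
    = measure_pmf.expectation (unif_rows n m) (\<lambda>h. \<integral>p. F (fst p, glue n h (snd p)) \<partial>(M \<Otimes>\<^sub>M measure_pmf (signs n)))"
proof -
  interpret M: prob_space M by fact
  interpret P1: pair_prob_space M "measure_pmf (cs_sketch n m)" ..
  interpret P2: pair_prob_space M "measure_pmf (signs n)" ..
  have Fm: "F \<in> borel_measurable (M \<Otimes>\<^sub>M count_space UNIV)"
    using F by (simp cong: measurable_cong_sets)
  have i1: "integrable (M \<Otimes>\<^sub>M measure_pmf (cs_sketch n m)) F"
    by (rule P1.integrable_const_bound[where B=B]) (auto simp: B)
  have i2: "integrable (M \<Otimes>\<^sub>M measure_pmf (signs n)) (\<lambda>p. F (fst p, glue n h (snd p)))" for h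
  proof (rule P2.integrable_const_bound[where B=B])
    have "(\<lambda>p. (fst p, glue n h (snd p))) \<in> measurable (M \<Otimes>\<^sub>M measure_pmf (signs n)) (M \<Otimes>\<^sub>M count_space UNIV)"
      by (intro measurable_Pair measurable_fst measurable_compose[OF measurable_snd]) simp
    from measurable_compose[OF this Fm]
    show "(\<lambda>p. F (fst p, glue n h (snd p))) \<in> borel_measurable (M \<Otimes>\<^sub>M measure_pmf (signs n))" .
  qed (simp add: B)
  let ?H = "unif_rows n m"
  have "integral\<^sup>L (M \<Otimes>\<^sub>M measure_pmf (cs_sketch n m)) F = measure_pmf.expectation (cs_sketch n m) (\<lambda>c. \<integral>\<omega>. F (\<omega>, c) \<partial>M)"
    using P1.integral_snd[of "\<lambda>x y. F (x, y)"] i1 by simp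
  also have "\<dots> = (\<Sum>h\<in>set_pmf ?H. pmf ?H h *\<^sub>R measure_pmf.expectation (map_pmf (glue n h) (signs n)) (\<lambda>c. \<integral>\<omega>. F (\<omega>, c) \<partial>M))"
    unfolding cs_sketch_eq using m finite_set_signs by (intro pmf_expectation_bind finite_set_unif_rows) auto
  also have "\<dots> = (\<Sum>h\<in>set_pmf ?H. pmf ?H h *\<^sub>R (\<integral>p. F (fst p, glue n h (snd p)) \<partial>(M \<Otimes>\<^sub>M measure_pmf (signs n))))"
  proof (rule sum.cong[OF refl])
    fix h
    have "(\<integral>s. \<integral>\<omega>. F (\<omega>, glue n h s) \<partial>M \<partial>measure_pmf (signs n)) = (\<integral>p. F (fst p, glue n h (snd p)) \<partial>(M \<Otimes>\<^sub>M measure_pmf (signs n)))"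
      using P2.integral_snd[of "\<lambda>x y. F (x, glue n h y)"] i2[of h] by (simp add: case_prod_unfold)
    then show "pmf ?H h *\<^sub>R measure_pmf.expectation (map_pmf (glue n h) (signs n)) (\<lambda>c. \<integral>\<omega>. F (\<omega>, c) \<partial>M)
      = pmf ?H h *\<^sub>R (\<integral>p. F (fst p, glue n h (snd p)) \<partial>(M \<Otimes>\<^sub>M measure_pmf (signs n)))" by simp
  qed
  also have "\<dots> = measure_pmf.expectation ?H (\<lambda>h. \<integral>p. F (fst p, glue n h (snd p)) \<partial>(M \<Otimes>\<^sub>M measure_pmf (signs n)))"
    using m by (intro integral_measure_pmf[symmetric] finite_set_unif_rows) auto
  finally show ?thesis .
qed

section \<open>Quadratic forms of symmetric independent vectors\<close>

lemma tendsto_prob_chebyshev: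
  assumes ev: "\<And>\<epsilon>. \<epsilon> > 0 \<Longrightarrow> eventually (\<lambda>n. measure (P n) {x \<in> space (P n). norm (Z n x - c) \<ge> \<epsilon>} \<le> b n / \<epsilon>\<^sup>2) sequentially"
    and b: "b \<longlonglongrightarrow> 0"
  shows "tendsto_prob P Z c"
  unfolding tendsto_prob_def
proof (intro allI impI)
  fix \<epsilon> :: real assume "\<epsilon> > 0"
  show "(\<lambda>n. measure (P n) {x \<in> space (P n). norm (Z n x - c) \<ge> \<epsilon>}) \<longlonglongrightarrow> 0"
  proof (rule tendsto_sandwich[OF _ ev[OF \<open>\<epsilon> > 0\<close>] tendsto_const])
    show "(\<lambda>n. b n / \<epsilon>\<^sup>2) \<longlonglongrightarrow> 0" using tendsto_divide_zero[OF b] .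
  qed simp
qed

lemma tendsto_prob_componentwise:
  fixes Z :: "nat \<Rightarrow> 'b \<Rightarrow> 'c::euclidean_space"
  assumes P: "\<And>n. prob_space (P n)" and [measurable]: "\<And>n. Z n \<in> borel_measurable (P n)"
    and comp: "\<And>b. b \<in> Basis \<Longrightarrow> tendsto_prob P (\<lambda>n x. Z n x \<bullet> b) (c \<bullet> b)"
  shows "tendsto_prob P Z c"
  unfolding tendsto_prob_def
proof (intro allI impI)
  fix \<epsilon> :: real assume \<epsilon>: "\<epsilon> > 0"
  define E where "E = (\<lambda>b n. {x \<in> space (P n). norm (Z n x \<bullet> b - c \<bullet> b) \<ge> \<epsilon> / DIM('c)})"
  show "(\<lambda>n. measure (P n) {x \<in> space (P n). norm (Z n x - c) \<ge> \<epsilon>}) \<longlonglongrightarrow> 0"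
  proof (rule tendsto_sandwich[OF _ _ tendsto_const])
    have "(\<lambda>n. \<Sum>b\<in>Basis. measure (P n) (E b n)) \<longlonglongrightarrow> (\<Sum>b\<in>(Basis::'c set). 0)"
      using comp \<epsilon> by (intro tendsto_sum) (simp add: tendsto_prob_def E_def)
    then show "(\<lambda>n. \<Sum>b\<in>Basis. measure (P n) (E b n)) \<longlonglongrightarrow> 0" by simp
    show "eventually (\<lambda>n. measure (P n) {x \<in> space (P n). norm (Z n x - c) \<ge> \<epsilon>} \<le> (\<Sum>b\<in>Basis. measure (P n) (E b n))) sequentially"
    proof (rule always_eventually, rule allI)
      fix n
      interpret prob_space "P n" by (rule P)
      have E: "E b n \<in> sets (P n)" for b unfolding E_def by measurable
      have "{x \<in> space (P n). norm (Z n x - c) \<ge> \<epsilon>} \<subseteq> (\<Union>b\<in>Basis. E b n)"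
      proof (rule subsetI, rule ccontr)
        fix x assume x: "x \<in> {x \<in> space (P n). norm (Z n x - c) \<ge> \<epsilon>}" and "x \<notin> (\<Union>b\<in>Basis. E b n)"
        then have lt: "\<bar>(Z n x - c) \<bullet> b\<bar> < \<epsilon> / DIM('c)" if "b \<in> Basis" for b
          using that by (auto simp: E_def inner_diff_left not_le)
        have "norm (Z n x - c) \<le> (\<Sum>b\<in>Basis. \<bar>(Z n x - c) \<bullet> b\<bar>)" by (rule norm_le_l1)
        also have "\<dots> < (\<Sum>b\<in>(Basis::'c set). \<epsilon> / DIM('c))" by (rule sum_strict_mono) (auto simp: lt)
        also have "\<dots> = \<epsilon>" by simp
        finally show False using x by simp
      qed
      then have "measure (P n) {x \<in> space (P n). norm (Z n x - c) \<ge> \<epsilon>} \<le> measure (P n) (\<Union>b\<in>Basis. E b n)"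
        using E by (intro finite_measure_mono) auto
      also have "\<dots> \<le> (\<Sum>b\<in>Basis. measure (P n) (E b n))"
        using E by (intro measure_UNION_le) auto
      finally show "measure (P n) {x \<in> space (P n). norm (Z n x - c) \<ge> \<epsilon>} \<le> (\<Sum>b\<in>Basis. measure (P n) (E b n))" .
    qed
  qed simp
qed

section \<open>Truncation and cut fourth moments\<close>

definition trunc :: "real \<Rightarrow> real \<Rightarrow> real" where
  "trunc K x = (if \<bar>x\<bar> \<le> K then x else 0)"

lemma borel_measurable_trunc [measurable]: "trunc K \<in> borel_measurable borel"
  unfolding trunc_def[abs_def] by measurable

text \<open>Oddness keeps the truncated part and the remainder centred under a symmetric law, so
  truncation calls for no recentring.\<close>

lemma trunc_minus: "trunc K (- x) = - trunc K x"
  by (simp add: trunc_def)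

lemma abs_trunc_le: "K \<ge> 0 \<Longrightarrow> \<bar>trunc K x\<bar> \<le> K"
  by (simp add: trunc_def)

lemma abs_trunc_diff_le: "\<bar>x - trunc K x\<bar> \<le> \<bar>x\<bar>"
  by (simp add: trunc_def)

text \<open>Bounds the Lindeberg term of a product of two block sums by terms in each factor separately.\<close>

definition quartic_cut :: "real \<Rightarrow> real \<Rightarrow> real" where
  "quartic_cut \<tau> x = x ^ 4 * min 1 (\<tau> * x\<^sup>2)"

lemma borel_measurable_quartic_cut [measurable]: "quartic_cut \<tau> \<in> borel_measurable borel"
  unfolding quartic_cut_def[abs_def] by measurable

lemma quartic_cut_nonneg: "\<tau> \<ge> 0 \<Longrightarrow> 0 \<le> quartic_cut \<tau> x"
  by (simp add: quartic_cut_def)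

text \<open>The fourth-power bound serves the unbounded remainder of a truncation; the sixth-power
  bound serves the truncated part and gains a factor \<tau>.\<close>

lemma quartic_cut_le: "\<tau> \<ge> 0 \<Longrightarrow> quartic_cut \<tau> x \<le> x ^ 4" "\<tau> \<ge> 0 \<Longrightarrow> quartic_cut \<tau> x \<le> \<tau> * x ^ 6"
proof -
  show "quartic_cut \<tau> x \<le> x ^ 4" if "\<tau> \<ge> 0"
    using mult_left_mono[of "min 1 (\<tau> * x\<^sup>2)" 1 "x ^ 4"] by (simp add: quartic_cut_def)
  have "quartic_cut \<tau> x \<le> x ^ 4 * (\<tau> * x\<^sup>2)" if "\<tau> \<ge> 0"
    unfolding quartic_cut_def by (intro mult_left_mono) auto
  also have "x ^ 4 * (\<tau> * x\<^sup>2) = \<tau> * x ^ 6" by (simp add: eval_nat_numeral)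
  finally show "quartic_cut \<tau> x \<le> \<tau> * x ^ 6" if "\<tau> \<ge> 0" using that by blast
qed

lemma quartic_cut_mono:
  assumes "\<tau> \<ge> 0" "\<bar>x\<bar> \<le> \<bar>y\<bar>"
  shows "quartic_cut \<tau> x \<le> quartic_cut \<tau> y"
proof -
  have 2: "x\<^sup>2 \<le> y\<^sup>2" using assms(2) by (simp add: abs_le_square_iff)
  have "x ^ 4 \<le> y ^ 4" using power_mono[OF assms(2), of 4] by (simp add: power_abs)
  moreover have "min 1 (\<tau> * x\<^sup>2) \<le> min 1 (\<tau> * y\<^sup>2)" using 2 assms(1) by (intro min.mono mult_left_mono) auto
  ultimately show ?thesis unfolding quartic_cut_def using assms(1) by (intro mult_mono) auto
qed

text \<open>The constant is 2^4 from the fourth power times 2^2 from the square inside the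
  minimum.\<close>

lemma quartic_cut_double:
  assumes "\<tau> \<ge> 0"
  shows "quartic_cut \<tau> (2 * x) \<le> 64 * quartic_cut \<tau> x"
proof -
  have "min 1 (\<tau> * (2 * x)\<^sup>2) \<le> 4 * min 1 (\<tau> * x\<^sup>2)" using assms by (simp add: min_def power_mult_distrib)
  then have "(2 * x) ^ 4 * min 1 (\<tau> * (2 * x)\<^sup>2) \<le> (2 * x) ^ 4 * (4 * min 1 (\<tau> * x\<^sup>2))"
    by (intro mult_left_mono) auto
  then show ?thesis by (simp add: quartic_cut_def power_mult_distrib)
qed

lemma quartic_cut_add:
  assumes "\<tau> \<ge> 0"
  shows "quartic_cut \<tau> (x + y) \<le> 64 * (quartic_cut \<tau> x + quartic_cut \<tau> y)"
proof -
  have nn: "0 \<le> quartic_cut \<tau> x" "0 \<le> quartic_cut \<tau> y" using assms by (simp_all add: quartic_cut_nonneg)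
  show ?thesis
  proof (cases "\<bar>x\<bar> \<le> \<bar>y\<bar>")
    case True
    then have "quartic_cut \<tau> (x + y) \<le> quartic_cut \<tau> (2 * y)" using assms by (intro quartic_cut_mono) auto
    then show ?thesis using quartic_cut_double[OF assms, of y] nn by simp
  next
    case False
    then have "quartic_cut \<tau> (x + y) \<le> quartic_cut \<tau> (2 * x)" using assms by (intro quartic_cut_mono) auto
    then show ?thesis using quartic_cut_double[OF assms, of x] nn by simp
  qed
qed

text \<open>With y = \<tau> |a b| the minimum is y^2 min(1, y), which increases in y, and y is at
  most \<tau> times the square of the larger factor. The sum of the two cuts covers whichever factor
  is larger.\<close>

lemma min_product_le_quartic_cut:
  assumes "\<tau> \<ge> 0"
  shows "min ((\<tau> * (a * b))\<^sup>2) (\<bar>\<tau> * (a * b)\<bar> ^ 3) \<le> \<tau>\<^sup>2 * (quartic_cut \<tau> a + quartic_cut \<tau> b)"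
proof -
  define d where "d = max \<bar>a\<bar> \<bar>b\<bar>"
  have d: "d \<ge> 0" "\<bar>a\<bar> \<le> d" "\<bar>b\<bar> \<le> d" by (auto simp: d_def)
  define y where "y = \<tau> * \<bar>a * b\<bar>"
  have y0: "y \<ge> 0" using assms by (simp add: y_def)
  have "\<bar>a * b\<bar> \<le> d * d" unfolding abs_mult using d by (intro mult_mono) auto
  then have y: "y \<le> \<tau> * d\<^sup>2" unfolding y_def power2_eq_square using assms by (intro mult_left_mono) auto
  have "min ((\<tau> * (a * b))\<^sup>2) (\<bar>\<tau> * (a * b)\<bar> ^ 3) = min (y\<^sup>2) (y ^ 3)"
    using assms by (simp add: y_def abs_mult power_mult_distrib)
  also have "\<dots> = y\<^sup>2 * min 1 y"
    by (simp add: mult_min_right eval_nat_numeral)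
  also have "\<dots> \<le> (\<tau> * d\<^sup>2)\<^sup>2 * min 1 (\<tau> * d\<^sup>2)"
    using y y0 by (intro mult_mono power_mono min.mono) auto
  also have "\<dots> = \<tau>\<^sup>2 * quartic_cut \<tau> d"
    by (simp add: quartic_cut_def eval_nat_numeral)
  also have "quartic_cut \<tau> d \<le> quartic_cut \<tau> a + quartic_cut \<tau> b"
  proof (cases "\<bar>a\<bar> \<le> \<bar>b\<bar>")
    case True
    then have "quartic_cut \<tau> d = quartic_cut \<tau> b" by (simp add: d_def quartic_cut_def max_def)
    then show ?thesis using quartic_cut_nonneg[OF assms, of a] by simp
  next
    case False
    then have "quartic_cut \<tau> d = quartic_cut \<tau> a" by (simp add: d_def quartic_cut_def max_def)
    then show ?thesis using quartic_cut_nonneg[OF assms, of b] by simp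
  qed
  finally show ?thesis using assms by (simp add: mult_left_mono)
qed

definition quartic_tail :: "'b::euclidean_space measure \<Rightarrow> real \<Rightarrow> 'b \<Rightarrow> real" where
  "quartic_tail \<nu> K u = (\<integral>x. (u \<bullet> x - trunc K (u \<bullet> x)) ^ 4 \<partial>\<nu>)"

lemma quartic_tail_tendsto:
  assumes [measurable_cong]: "sets \<nu> = sets borel" and int: "integrable \<nu> (\<lambda>x. (u \<bullet> x) ^ 4)"
  shows "(\<lambda>K. quartic_tail \<nu> (real K) u) \<longlonglongrightarrow> 0"
proof -
  have "(\<lambda>K. quartic_tail \<nu> (real K) u) \<longlonglongrightarrow> (\<integral>x. 0 \<partial>\<nu>)"
    unfolding quartic_tail_def
  proof (rule integral_dominated_convergence[OF _ _ int])
    show "AE x in \<nu>. (\<lambda>K. (u \<bullet> x - trunc (real K) (u \<bullet> x)) ^ 4) \<longlonglongrightarrow> 0"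
    proof (rule AE_I2)
      fix x
      have "eventually (\<lambda>K. (u \<bullet> x - trunc (real K) (u \<bullet> x)) ^ 4 = 0) sequentially"
        using eventually_ge_at_top[of "nat \<lceil>\<bar>u \<bullet> x\<bar>\<rceil>"]
      proof eventually_elim
        case (elim K)
        then have "\<bar>u \<bullet> x\<bar> \<le> real K" by linarith
        then show ?case by (simp add: trunc_def)
      qed
      then show "(\<lambda>K. (u \<bullet> x - trunc (real K) (u \<bullet> x)) ^ 4) \<longlonglongrightarrow> 0" by (rule tendsto_eventually)
    qed
    show "AE x in \<nu>. norm ((u \<bullet> x - trunc (real K) (u \<bullet> x)) ^ 4) \<le> (u \<bullet> x) ^ 4" for K
    proof (rule AE_I2)
      fix x
      show "norm ((u \<bullet> x - trunc (real K) (u \<bullet> x)) ^ 4) \<le> (u \<bullet> x) ^ 4"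
        using power_mono[OF abs_trunc_diff_le[of "u \<bullet> x" "real K"], of 4] by (simp add: power_abs)
    qed
  qed measurable
  then show ?thesis by simp
qed

text \<open>Polarisation: mixed second moments of linear functionals reduce to pure fourth moments.\<close>

lemma square_eq_quartics: "(a * b)\<^sup>2 = ((a + b) ^ 4 + (a - b) ^ 4 - 2 * a ^ 4 - 2 * b ^ 4) / (12 :: real)"
  by (simp add: eval_nat_numeral algebra_simps)

lemma product_eq_squares: "a * b = ((a + b)\<^sup>2 - (a - b)\<^sup>2) / (4 :: real)"
  by (simp add: power2_eq_square algebra_simps)

text \<open>The intended \<open>W i\<close> is a random sign times the data point (e_i, X_i), with
  the row assignment held fixed. Symmetry of the law makes every integrable odd moment vanish, also
  after truncation.\<close>

locale sym_iid = prob_space +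
  fixes W :: "nat \<Rightarrow> 'a \<Rightarrow> 'b::euclidean_space" and n :: nat and \<nu> :: "'b measure"
  assumes indep: "indep_vars (\<lambda>_. borel) W {..<n}"
    and law: "\<And>i. i < n \<Longrightarrow> distr M borel (W i) = \<nu>"
    and prob_law: "prob_space \<nu>" and sets_law: "sets \<nu> = sets borel"
    and sym: "distr \<nu> borel uminus = \<nu>"
    and int4: "integrable \<nu> (\<lambda>x. (norm x) ^ 4)"
begin

definition m2 :: "'b \<Rightarrow> real" where "m2 u = (\<integral>x. (u \<bullet> x)\<^sup>2 \<partial>\<nu>)"
definition m4 :: "'b \<Rightarrow> real" where "m4 u = (\<integral>x. (u \<bullet> x) ^ 4 \<partial>\<nu>)"
definition cov :: "'b \<Rightarrow> 'b \<Rightarrow> real" where "cov u v = (\<integral>x. (u \<bullet> x) * (v \<bullet> x) \<partial>\<nu>)"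
definition m22 :: "'b \<Rightarrow> 'b \<Rightarrow> real" where "m22 u v = (\<integral>x. ((u \<bullet> x) * (v \<bullet> x))\<^sup>2 \<partial>\<nu>)"

lemma rv_W: "i < n \<Longrightarrow> random_variable borel (W i)"
  using indep by (auto simp: indep_vars_def)

lemma integral_W: "i < n \<Longrightarrow> g \<in> borel_measurable borel \<Longrightarrow> expectation (\<lambda>x. g (W i x)) = (\<integral>x. g x \<partial>\<nu> :: real)"
  using integral_distr[OF rv_W, of i g] law by simp

lemma integrable_W: "i < n \<Longrightarrow> g \<in> borel_measurable borel \<Longrightarrow> integrable \<nu> g \<Longrightarrow> integrable M (\<lambda>x. g (W i x) :: real)"
  using integrable_distr_eq[OF rv_W, of i g] law by simp

lemma integral_odd:
  assumes [measurable]: "g \<in> borel_measurable borel" and "\<And>x. g (- x) = - g x"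
  shows "(\<integral>x. g x \<partial>\<nu>) = (0 :: real)"
proof -
  have [measurable_cong]: "sets \<nu> = sets borel" by (rule sets_law)
  have "(\<integral>x. g x \<partial>\<nu>) = (\<integral>x. g x \<partial>distr \<nu> borel uminus)" by (simp add: sym)
  also have "\<dots> = (\<integral>x. g (- x) \<partial>\<nu>)" by (rule integral_distr) measurable
  also have "\<dots> = - (\<integral>x. g x \<partial>\<nu>)" by (simp add: assms)
  finally show ?thesis by simp
qed

lemma integrable_inner_power:
  assumes "k \<le> 4"
  shows "integrable \<nu> (\<lambda>x. (u \<bullet> x) ^ k)"
proof -
  interpret L: prob_space \<nu> by (rule prob_law)
  have [measurable_cong]: "sets \<nu> = sets borel" by (rule sets_law)
  have "integrable \<nu> (\<lambda>x. (u \<bullet> x) ^ 4)"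
  proof (rule Bochner_Integration.integrable_bound[OF integrable_mult_right[OF int4, of "norm u ^ 4"]])
    have "\<bar>u \<bullet> x\<bar> ^ 4 \<le> norm u ^ 4 * norm x ^ 4" for x
      using power_mono[OF Cauchy_Schwarz_ineq2[of u x], of 4] by (simp add: power_mult_distrib)
    then show "AE x in \<nu>. norm ((u \<bullet> x) ^ 4) \<le> norm (norm u ^ 4 * norm x ^ 4)"
      by (simp add: power_abs[symmetric])
  qed measurable
  then show ?thesis using assms by (rule L.integrable_power_le[rotated]) measurable
qed

lemma integrable_inner_square: "integrable \<nu> (\<lambda>x. (u \<bullet> x)\<^sup>2)"
  by (rule integrable_inner_power) simp

lemma integrable_inner_mult: "integrable \<nu> (\<lambda>x. (u \<bullet> x) * (v \<bullet> x))"
  unfolding product_eq_squares inner_add_left[symmetric] inner_diff_left[symmetric]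
  using integrable_inner_square by simp

lemma m22_eq: "m22 u v = (m4 (u + v) + m4 (u - v) - 2 * m4 u - 2 * m4 v) / 12"
  unfolding m22_def m4_def square_eq_quartics inner_add_left[symmetric] inner_diff_left[symmetric]
  using integrable_inner_power[of 4] by simp

lemma m2_add: "m2 (u + v) = m2 u + m2 v + 2 * cov u v"
proof -
  have "m2 (u + v) = (\<integral>x. (u \<bullet> x)\<^sup>2 + (v \<bullet> x)\<^sup>2 + 2 * ((u \<bullet> x) * (v \<bullet> x)) \<partial>\<nu>)"
    unfolding m2_def by (simp add: inner_add_left power2_sum mult.assoc)
  then show ?thesis
    using integrable_inner_square integrable_inner_mult by (simp add: m2_def cov_def)
qed

lemma m2_diff: "m2 (u - v) = m2 u + m2 v - 2 * cov u v"
  using m2_add[of u "- v"] by (simp add: m2_def cov_def)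

definition S :: "'b \<Rightarrow> nat set \<Rightarrow> 'a \<Rightarrow> real" where "S u B x = (\<Sum>i\<in>B. u \<bullet> W i x)"

lemma S_add: "S (u + v) B x = S u B x + S v B x"
  by (simp add: S_def inner_add_left sum.distrib)

lemma S_diff: "S (u - v) B x = S u B x - S v B x"
  by (simp add: S_def inner_diff_left sum_subtractf)

lemma indep_inner: "B \<subseteq> {..<n} \<Longrightarrow> g \<in> borel_measurable borel \<Longrightarrow> indep_vars (\<lambda>_. borel) (\<lambda>i x. g (u \<bullet> W i x) :: real) B"
  by (rule indep_vars_compose2[OF indep_vars_subset[OF indep]]) auto

lemma rv_S: "B \<subseteq> {..<n} \<Longrightarrow> random_variable borel (S u B)"
  unfolding S_def[abs_def] using rv_W by (intro borel_measurable_sum borel_measurable_inner) auto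

lemma S_moments:
  assumes B: "B \<subseteq> {..<n}"
  shows "integrable M (\<lambda>x. S u B x ^ 4)" "expectation (\<lambda>x. S u B x ^ 2) = real (card B) * m2 u"
    "expectation (\<lambda>x. S u B x ^ 4) = real (card B) * m4 u + 3 * real (card B) * (real (card B) - 1) * (m2 u)\<^sup>2"
proof -
  have fin: "finite B" using B finite_subset by blast
  have i: "i < n" if "i \<in> B" for i using that B by auto
  have "expectation (\<lambda>x. u \<bullet> W i x) = 0" if "i \<in> B" for i
    using integral_W[OF i[OF that], of "\<lambda>x. u \<bullet> x"] integral_odd[of "\<lambda>x. u \<bullet> x"] by simp
  moreover have "expectation (\<lambda>x. (u \<bullet> W i x) ^ 2) = m2 u" "expectation (\<lambda>x. (u \<bullet> W i x) ^ 4) = m4 u"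
    "integrable M (\<lambda>x. (u \<bullet> W i x) ^ 4)" if "i \<in> B" for i
    using integral_W[OF i[OF that], of "\<lambda>x. (u \<bullet> x) ^ 2"] integral_W[OF i[OF that], of "\<lambda>x. (u \<bullet> x) ^ 4"]
      integrable_W[OF i[OF that], of "\<lambda>x. (u \<bullet> x) ^ 4"] integrable_inner_power[of 4 u] by (simp_all add: m2_def m4_def)
  moreover have "indep_vars (\<lambda>_. borel) (\<lambda>i x. u \<bullet> W i x) B" using indep_inner[OF B, of "\<lambda>x. x"] by simp
  ultimately show "integrable M (\<lambda>x. S u B x ^ 4)" "expectation (\<lambda>x. S u B x ^ 2) = real (card B) * m2 u"
    "expectation (\<lambda>x. S u B x ^ 4) = real (card B) * m4 u + 3 * real (card B) * (real (card B) - 1) * (m2 u)\<^sup>2"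
    using sum_fourth_moment[OF fin, of "\<lambda>i x. u \<bullet> W i x" "m2 u" "m4 u"] unfolding S_def by auto
qed

lemma S_integrable_square: "B \<subseteq> {..<n} \<Longrightarrow> integrable M (\<lambda>x. S u B x ^ 2)"
  using integrable_power_le[OF rv_S S_moments(1)] by simp

text \<open>Polarisation of the formulas for a single functional. The second moment of the product
  has N diagonal terms and N (N - 1) terms with the three pairings of Isserlis' formula; in large
  blocks with \<open>cov u v = 0\<close> the product \<open>m2 u * m2 v\<close> prevails, the source
  of E(e^2) E(X X^T) in the limit.\<close>

lemma block_moments:
  assumes B: "B \<subseteq> {..<n}"
  shows "expectation (\<lambda>x. S u B x * S v B x) = real (card B) * cov u v"
    "integrable M (\<lambda>x. (S u B x * S v B x)\<^sup>2)"
    "expectation (\<lambda>x. (S u B x * S v B x)\<^sup>2) = real (card B) * m22 u v + real (card B) * (real (card B) - 1) * (m2 u * m2 v + 2 * (cov u v)\<^sup>2)"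
proof -
  note i2 = S_integrable_square[OF B] and i4 = S_moments(1)[OF B] and e2 = S_moments(2)[OF B] and e4 = S_moments(3)[OF B]
  have "expectation (\<lambda>x. S u B x * S v B x) = (expectation (\<lambda>x. S (u + v) B x ^ 2) - expectation (\<lambda>x. S (u - v) B x ^ 2)) / 4"
    unfolding product_eq_squares S_add[symmetric] S_diff[symmetric] using i2 by simp
  then show "expectation (\<lambda>x. S u B x * S v B x) = real (card B) * cov u v"
    by (simp add: e2 m2_add m2_diff algebra_simps)
  show "integrable M (\<lambda>x. (S u B x * S v B x)\<^sup>2)"
    unfolding square_eq_quartics S_add[symmetric] S_diff[symmetric] using i4 by simp
  have "expectation (\<lambda>x. (S u B x * S v B x)\<^sup>2) = (expectation (\<lambda>x. S (u + v) B x ^ 4) + expectation (\<lambda>x. S (u - v) B x ^ 4)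
      - 2 * expectation (\<lambda>x. S u B x ^ 4) - 2 * expectation (\<lambda>x. S v B x ^ 4)) / 12"
    unfolding square_eq_quartics S_add[symmetric] S_diff[symmetric] using i4 by simp
  also have "\<dots> = real (card B) * m22 u v + real (card B) * (real (card B) - 1) * (m2 u * m2 v + 2 * (cov u v)\<^sup>2)"
    unfolding e4 m22_eq m2_add m2_diff by (simp add: field_simps power2_eq_square)
  finally show "expectation (\<lambda>x. (S u B x * S v B x)\<^sup>2) = real (card B) * m22 u v + real (card B) * (real (card B) - 1) * (m2 u * m2 v + 2 * (cov u v)\<^sup>2)" .
qed

text \<open>Each summand is truncated at \<open>K\<close>. The truncated part pays with its sixth
  moment and a factor \<tau>, the remainder with its fourth moment; 64 comes from
  \<open>quartic_cut_add\<close>, 15 and 3 from the moment bounds for sums.\<close>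

lemma quartic_cut_S:
  assumes B: "B \<subseteq> {..<n}" and \<tau>: "\<tau> \<ge> 0" and K: "K \<ge> 0"
  shows "expectation (\<lambda>x. quartic_cut \<tau> (S u B x)) \<le> 64 * (15 * \<tau> * K ^ 6 * real (card B) ^ 3 + 3 * real (card B) ^ 2 * quartic_tail \<nu> K u)"
    and "integrable M (\<lambda>x. quartic_cut \<tau> (S u B x))"
proof -
  have fin: "finite B" using B finite_subset by blast
  have i: "i < n" if "i \<in> B" for i using that B by auto
  note [measurable] = rv_S[OF B, of u]
  have sL[measurable_cong]: "sets \<nu> = sets borel" by (rule sets_law)
  interpret L: prob_space \<nu> by (rule prob_law)
  define X1 where "X1 = (\<lambda>i x. trunc K (u \<bullet> W i x))"
  define X2 where "X2 = (\<lambda>i x. u \<bullet> W i x - trunc K (u \<bullet> W i x))"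
  define A1 where "A1 = (\<lambda>x. \<Sum>i\<in>B. X1 i x)"
  define A2 where "A2 = (\<lambda>x. \<Sum>i\<in>B. X2 i x)"
  have SA: "S u B x = A1 x + A2 x" for x
    by (simp add: S_def A1_def A2_def X1_def X2_def sum.distrib[symmetric])
  have ind1: "indep_vars (\<lambda>_. borel) X1 B" unfolding X1_def by (rule indep_inner[OF B]) measurable
  have ind2: "indep_vars (\<lambda>_. borel) X2 B" unfolding X2_def by (rule indep_inner[OF B]) measurable
  have z1: "expectation (X1 i) = 0" if "i \<in> B" for i
    unfolding X1_def using integral_W[OF i[OF that], of "\<lambda>x. trunc K (u \<bullet> x)"] integral_odd[of "\<lambda>x. trunc K (u \<bullet> x)"] by (simp add: trunc_minus)
  have z3: "expectation (\<lambda>x. X1 i x ^ 3) = 0" if "i \<in> B" for i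
    unfolding X1_def using integral_W[OF i[OF that], of "\<lambda>x. trunc K (u \<bullet> x) ^ 3"] integral_odd[of "\<lambda>x. trunc K (u \<bullet> x) ^ 3"] by (simp add: trunc_minus)
  have z2: "expectation (X2 i) = 0" if "i \<in> B" for i
    unfolding X2_def using integral_W[OF i[OF that], of "\<lambda>x. u \<bullet> x - trunc K (u \<bullet> x)"] integral_odd[of "\<lambda>x. u \<bullet> x - trunc K (u \<bullet> x)"] by (simp add: trunc_minus)
  have A1: "expectation (\<lambda>x. A1 x ^ 6) \<le> 15 * real (card B) ^ 3 * K ^ 6" "integrable M (\<lambda>x. A1 x ^ 6)"
    using sum_bounded_sixth_moment[OF fin ind1 _ z1 z3, of K] abs_trunc_le[OF K] unfolding A1_def by (auto simp: X1_def)
  let ?v = "\<integral>x. (u \<bullet> x - trunc K (u \<bullet> x)) ^ 2 \<partial>\<nu>" and ?w = "quartic_tail \<nu> K u"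
  have it4: "integrable \<nu> (\<lambda>x. (u \<bullet> x - trunc K (u \<bullet> x)) ^ 4)"
  proof (rule Bochner_Integration.integrable_bound[OF integrable_inner_power[of 4 u]])
    show "AE x in \<nu>. norm ((u \<bullet> x - trunc K (u \<bullet> x)) ^ 4) \<le> norm ((u \<bullet> x) ^ 4)"
    proof (rule AE_I2)
      fix x
      show "norm ((u \<bullet> x - trunc K (u \<bullet> x)) ^ 4) \<le> norm ((u \<bullet> x) ^ 4)"
        using power_mono[OF abs_trunc_diff_le[of "u \<bullet> x" K], of 4] by (simp add: power_abs)
    qed
  qed simp_all
  have w: "integrable M (\<lambda>x. X2 i x ^ 4)" "expectation (\<lambda>x. X2 i x ^ 4) = ?w" "expectation (\<lambda>x. X2 i x ^ 2) = ?v" if "i \<in> B" for i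
    using integral_W[OF i[OF that], of "\<lambda>x. (u \<bullet> x - trunc K (u \<bullet> x)) ^ 4"] integral_W[OF i[OF that], of "\<lambda>x. (u \<bullet> x - trunc K (u \<bullet> x)) ^ 2"]
      integrable_W[OF i[OF that] _ it4] by (auto simp: X2_def quartic_tail_def)
  \<comment> \<open>The squared remainder has nonnegative variance, so its mean squared is at most
    the fourth moment of the remainder.\<close>
  have vw: "?v\<^sup>2 \<le> ?w"
  proof -
    have "integrable \<nu> (\<lambda>x. (u \<bullet> x - trunc K (u \<bullet> x)) ^ 2)" by (rule L.integrable_power_le[OF _ it4]) auto
    moreover have "integrable \<nu> (\<lambda>x. ((u \<bullet> x - trunc K (u \<bullet> x)) ^ 2)\<^sup>2)" using it4 by simp
    ultimately have "L.variance (\<lambda>x. (u \<bullet> x - trunc K (u \<bullet> x)) ^ 2) = ?w - ?v\<^sup>2"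
      by (subst L.variance_eq) (auto simp: quartic_tail_def)
    then show ?thesis using L.variance_positive[of "\<lambda>x. (u \<bullet> x - trunc K (u \<bullet> x)) ^ 2"] by simp
  qed
  have A2: "integrable M (\<lambda>x. A2 x ^ 4)" "expectation (\<lambda>x. A2 x ^ 4) = real (card B) * ?w + 3 * real (card B) * (real (card B) - 1) * ?v\<^sup>2"
    using sum_fourth_moment[OF fin ind2 w(1) z2 w(3) w(2)] unfolding A2_def by auto
  have A2': "expectation (\<lambda>x. A2 x ^ 4) \<le> 3 * real (card B) ^ 2 * ?w"
  \<comment> \<open>An empty block is set apart because \<open>real (card B) - 1\<close> is negative
    there.\<close>
  proof (cases "card B = 0")
    case False
    then have "3 * real (card B) * (real (card B) - 1) * ?v\<^sup>2 \<le> 3 * real (card B) * (real (card B) - 1) * ?w"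
      using vw by (intro mult_left_mono) auto
    then have "expectation (\<lambda>x. A2 x ^ 4) \<le> real (card B) * ?w + 3 * real (card B) * (real (card B) - 1) * ?w"
      unfolding A2(2) by simp
    also have "\<dots> = 3 * real (card B) ^ 2 * ?w - 2 * real (card B) * ?w" by (simp add: algebra_simps power2_eq_square)
    also have "\<dots> \<le> 3 * real (card B) ^ 2 * ?w" using order.trans[OF zero_le_power2 vw] by simp
    finally show ?thesis .
  qed (simp add: A2)
  show int: "integrable M (\<lambda>x. quartic_cut \<tau> (S u B x))"
  proof (rule Bochner_Integration.integrable_bound[OF S_moments(1)[OF B, of u]])
    show "AE x in M. norm (quartic_cut \<tau> (S u B x)) \<le> norm (S u B x ^ 4)"
      using quartic_cut_le(1)[OF \<tau>] quartic_cut_nonneg[OF \<tau>] by simp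
  qed measurable
  have "expectation (\<lambda>x. quartic_cut \<tau> (S u B x)) \<le> expectation (\<lambda>x. 64 * (\<tau> * A1 x ^ 6 + A2 x ^ 4))"
  proof (rule integral_mono[OF int])
    show "integrable M (\<lambda>x. 64 * (\<tau> * A1 x ^ 6 + A2 x ^ 4))" using A1 A2 by simp
    show "quartic_cut \<tau> (S u B x) \<le> 64 * (\<tau> * A1 x ^ 6 + A2 x ^ 4)" for x
      unfolding SA by (rule order.trans[OF quartic_cut_add[OF \<tau>]])
        (intro mult_left_mono add_mono quartic_cut_le \<tau>, simp)
  qed
  also have "\<dots> = 64 * (\<tau> * expectation (\<lambda>x. A1 x ^ 6) + expectation (\<lambda>x. A2 x ^ 4))" using A1 A2(1) by simp
  also have "\<dots> \<le> 64 * (\<tau> * (15 * real (card B) ^ 3 * K ^ 6) + 3 * real (card B) ^ 2 * ?w)"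
    using A1(1) A2' \<tau> by (intro mult_left_mono add_mono) auto
  finally show "expectation (\<lambda>x. quartic_cut \<tau> (S u B x)) \<le> 64 * (15 * \<tau> * K ^ 6 * real (card B) ^ 3 + 3 * real (card B) ^ 2 * ?w)"
    by (simp add: mult_ac)
qed

definition block :: "(nat \<Rightarrow> nat) \<Rightarrow> nat \<Rightarrow> nat set" where "block h k = {i. i < n \<and> h i = k}"

lemma block_subset: "block h k \<subseteq> {..<n}" by (auto simp: block_def)

lemma card_block: "card (block h k) = occ h n k" by (simp add: block_def occ_def)

text \<open>With \<open>h\<close> fixed the blocks are disjoint index sets, and each product depends
  on the coordinates of one block.\<close>

lemma indep_blocks:
  "indep_vars (\<lambda>_. borel) (\<lambda>k x. S u (block h k) x * S v (block h k) x) {..<m}"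
proof -
  have "indep_vars (\<lambda>k. PiM (block h k) (\<lambda>_. borel)) (\<lambda>k x. restrict (\<lambda>i. W i x) (block h k)) {..<m}"
    by (rule indep_vars_restrict[OF indep]) (auto simp: block_subset disjoint_family_on_def block_def)
  then have "indep_vars (\<lambda>_. borel) (\<lambda>k x. (\<lambda>f. (\<Sum>i\<in>block h k. u \<bullet> f i) * (\<Sum>i\<in>block h k. v \<bullet> f i)) (restrict (\<lambda>i. W i x) (block h k))) {..<m}"
    by (rule indep_vars_compose2) measurable
  then show ?thesis by (simp add: S_def cong: sum.cong)
qed

lemma variance_blocks:
  assumes h: "\<And>i. i < n \<Longrightarrow> h i < m"
  shows "integrable M (\<lambda>x. ((\<Sum>k<m. S u (block h k) x * S v (block h k) x) - real n * cov u v)\<^sup>2)"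
    "expectation (\<lambda>x. ((\<Sum>k<m. S u (block h k) x * S v (block h k) x) - real n * cov u v)\<^sup>2)
      \<le> (m22 u v + m2 u * m2 v + 2 * (cov u v)\<^sup>2) * occ_pow 2 n m h"
proof -
  let ?Y = "\<lambda>k x. S u (block h k) x * S v (block h k) x" and ?c = "m2 u * m2 v + 2 * (cov u v)\<^sup>2"
  have sum: "(\<Sum>k<m. expectation (?Y k)) = real n * cov u v"
    unfolding block_moments(1)[OF block_subset] card_block sum_distrib_right[symmetric]
    using sum_occ[of n h m, OF h] by (simp flip: of_nat_sum)
  note var = variance_sum_le[OF _ indep_blocks[of u h v m] block_moments(2)[OF block_subset], unfolded sum]
  then show "integrable M (\<lambda>x. ((\<Sum>k<m. ?Y k x) - real n * cov u v)\<^sup>2)" by simp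
  have m22: "m22 u v \<ge> 0" "?c \<ge> 0" by (auto simp: m22_def m2_def)
  have "expectation (\<lambda>x. ((\<Sum>k<m. ?Y k x) - real n * cov u v)\<^sup>2) \<le> (\<Sum>k<m. expectation (\<lambda>x. (?Y k x)\<^sup>2))" using var by simp
  also have "\<dots> \<le> (\<Sum>k<m. (m22 u v + ?c) * real (occ h n k) ^ 2)"
  proof (rule sum_mono)
    fix k
    let ?N = "real (occ h n k)"
    \<comment> \<open>For natural N both counts are at most N^2, so a single multiple of
      \<open>occ_pow 2\<close> bounds the sum.\<close>
    have "?N \<le> ?N ^ 2" "?N * (?N - 1) \<le> ?N ^ 2"
      by (cases "occ h n k"; simp add: power2_eq_square algebra_simps)+
    then have "?N * m22 u v + ?N * (?N - 1) * ?c \<le> ?N ^ 2 * m22 u v + ?N ^ 2 * ?c"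
      using m22 by (intro add_mono mult_right_mono) auto
    then show "expectation (\<lambda>x. (?Y k x)\<^sup>2) \<le> (m22 u v + ?c) * ?N ^ 2"
      unfolding block_moments(3)[OF block_subset] card_block by (simp add: algebra_simps)
  qed
  also have "\<dots> = (m22 u v + m2 u * m2 v + 2 * (cov u v)\<^sup>2) * occ_pow 2 n m h"
    by (simp add: occ_pow_def sum_distrib_left add.assoc)
  finally show "expectation (\<lambda>x. ((\<Sum>k<m. ?Y k x) - real n * cov u v)\<^sup>2) \<le> (m22 u v + m2 u * m2 v + 2 * (cov u v)\<^sup>2) * occ_pow 2 n m h" .
qed

text \<open>A Lindeberg estimate over the rows for a fixed assignment. The exponent separates the n
  diagonal pairs, weighted by \<open>m22\<close>, from the pairs of distinct columns sharing a row.
  The constants are 1920 = 2 * 64 * 15 and 192 = 64 * 3.\<close>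

lemma char_blocks:
  assumes h: "\<And>i. i < n \<Longrightarrow> h i < m" and \<tau>: "\<tau> \<ge> 0" and K: "K \<ge> 0" and c0: "cov u v = 0"
  defines "C \<equiv> m22 u v + m2 u * m2 v"
  shows "cmod (expectation (\<lambda>x. cis (\<tau> * (\<Sum>k<m. S u (block h k) x * S v (block h k) x)))
      - complex_of_real (exp (- (\<tau>\<^sup>2 * (real n * m22 u v + (occ_pow 2 n m h - real n) * (m2 u * m2 v))) / 2)))
    \<le> \<tau> ^ 3 * (1920 * K ^ 6 + C * sqrt C) * occ_pow 3 n m h
      + \<tau>\<^sup>2 * 192 * (quartic_tail \<nu> K u + quartic_tail \<nu> K v) * occ_pow 2 n m h"
proof -
  let ?Y = "\<lambda>k x. \<tau> * (S u (block h k) x * S v (block h k) x)"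
  let ?N = "\<lambda>k. real (occ h n k)"
  define q where "q = (\<lambda>k. \<tau>\<^sup>2 * (?N k * m22 u v + ?N k * (?N k - 1) * (m2 u * m2 v)))"
  have C0: "m22 u v \<ge> 0" "m2 u * m2 v \<ge> 0" by (auto simp: m22_def m2_def)
  have ind: "indep_vars (\<lambda>_. borel) ?Y {..<m}"
    using indep_vars_compose2[OF indep_blocks[of u h v m], of "\<lambda>_ x. \<tau> * x" "\<lambda>_. borel"] by simp
  have int: "integrable M (\<lambda>x. (?Y k x)\<^sup>2)" for k
    using block_moments(2)[OF block_subset] by (simp add: power_mult_distrib[of \<tau>])
  have var: "expectation (\<lambda>x. (?Y k x)\<^sup>2) = q k" for k
    using block_moments(3)[OF block_subset, of u h k v] by (simp add: power_mult_distrib[of \<tau>] q_def card_block c0)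
  have mean: "expectation (?Y k) = 0" for k
    using block_moments(1)[OF block_subset, of u h k v] by (simp add: c0)
  have sumN: "(\<Sum>k<m. ?N k) = real n" using sum_occ[of n h m, OF h] by (metis of_nat_sum)
  have sq: "(\<Sum>k<m. q k) = \<tau>\<^sup>2 * (real n * m22 u v + (occ_pow 2 n m h - real n) * (m2 u * m2 v))"
  proof -
    have "(\<Sum>k<m. ?N k * m22 u v + ?N k * (?N k - 1) * (m2 u * m2 v)) = (\<Sum>k<m. ?N k) * m22 u v + ((\<Sum>k<m. ?N k ^ 2) - (\<Sum>k<m. ?N k)) * (m2 u * m2 v)"
      by (simp only: sum.distrib sum_distrib_right sum_subtractf[symmetric]) (simp add: power2_eq_square algebra_simps)
    then show ?thesis by (simp add: q_def sum_distrib_left[symmetric] sumN occ_pow_def)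
  qed
  have bound: "expectation (\<lambda>x. min ((?Y k x)\<^sup>2) (\<bar>?Y k x\<bar> ^ 3)) + q k * sqrt (q k)
    \<le> \<tau> ^ 3 * (1920 * K ^ 6 + C * sqrt C) * ?N k ^ 3 + \<tau>\<^sup>2 * 192 * (quartic_tail \<nu> K u + quartic_tail \<nu> K v) * ?N k ^ 2" for k
  proof -
    note cut = quartic_cut_S[OF block_subset \<tau> K, of _ h k, unfolded card_block]
    note [measurable] = rv_S[OF block_subset, of _ h k]
    have "expectation (\<lambda>x. min ((?Y k x)\<^sup>2) (\<bar>?Y k x\<bar> ^ 3)) \<le> expectation (\<lambda>x. \<tau>\<^sup>2 * (quartic_cut \<tau> (S u (block h k) x) + quartic_cut \<tau> (S v (block h k) x)))"
    proof (rule integral_mono)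
      show "integrable M (\<lambda>x. min ((?Y k x)\<^sup>2) (\<bar>?Y k x\<bar> ^ 3))"
        by (rule Bochner_Integration.integrable_bound[OF int[of k]]) (auto simp: min_def)
      show "integrable M (\<lambda>x. \<tau>\<^sup>2 * (quartic_cut \<tau> (S u (block h k) x) + quartic_cut \<tau> (S v (block h k) x)))"
        using cut(2) by simp
    qed (rule min_product_le_quartic_cut[OF \<tau>])
    also have "\<dots> = \<tau>\<^sup>2 * (expectation (\<lambda>x. quartic_cut \<tau> (S u (block h k) x)) + expectation (\<lambda>x. quartic_cut \<tau> (S v (block h k) x)))"
      using cut(2) by simp
    also have "\<dots> \<le> \<tau>\<^sup>2 * (64 * (15 * \<tau> * K ^ 6 * ?N k ^ 3 + 3 * ?N k ^ 2 * quartic_tail \<nu> K u) + 64 * (15 * \<tau> * K ^ 6 * ?N k ^ 3 + 3 * ?N k ^ 2 * quartic_tail \<nu> K v))"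
      using cut(1) by (intro mult_left_mono add_mono) auto
    finally have 1: "expectation (\<lambda>x. min ((?Y k x)\<^sup>2) (\<bar>?Y k x\<bar> ^ 3)) \<le>
       \<tau> ^ 3 * 1920 * K ^ 6 * ?N k ^ 3 + \<tau>\<^sup>2 * 192 * (quartic_tail \<nu> K u + quartic_tail \<nu> K v) * ?N k ^ 2"
      by (simp add: algebra_simps power2_eq_square power3_eq_cube)
    have NN: "?N k \<le> ?N k ^ 2" "?N k * (?N k - 1) \<le> ?N k ^ 2" "0 \<le> ?N k * (?N k - 1)"
      by (cases "occ h n k"; simp add: power2_eq_square algebra_simps)+
    have q0: "q k \<ge> 0" unfolding var[symmetric] by simp
    have "q k \<le> \<tau>\<^sup>2 * (?N k ^ 2 * m22 u v + ?N k ^ 2 * (m2 u * m2 v))"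
      unfolding q_def using NN C0 by (intro mult_left_mono add_mono mult_right_mono) auto
    also have "\<dots> = C * (\<tau> * ?N k)\<^sup>2" by (simp add: C_def algebra_simps power_mult_distrib)
    finally have qC: "q k \<le> C * (\<tau> * ?N k)\<^sup>2" .
    then have "sqrt (q k) \<le> sqrt C * (\<tau> * ?N k)"
      using \<tau> by (metis abs_of_nonneg mult_nonneg_nonneg of_nat_0_le_iff real_sqrt_abs real_sqrt_le_iff real_sqrt_mult)
    then have "q k * sqrt (q k) \<le> C * (\<tau> * ?N k)\<^sup>2 * (sqrt C * (\<tau> * ?N k))"
      using qC q0 by (intro mult_mono) auto
    also have "\<dots> = \<tau> ^ 3 * (C * sqrt C) * ?N k ^ 3" by (simp add: power2_eq_square power3_eq_cube)
    finally show ?thesis using 1 by (simp add: algebra_simps)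
  qed
  have "cmod (expectation (\<lambda>x. cis (\<Sum>k<m. ?Y k x)) - complex_of_real (exp (- (\<Sum>k<m. q k) / 2)))
    \<le> (\<Sum>k<m. expectation (\<lambda>x. min ((?Y k x)\<^sup>2) (\<bar>?Y k x\<bar> ^ 3)) + q k * sqrt (q k))"
    by (rule char_sum_approx[OF _ ind int mean var]) simp
  also have "\<dots> \<le> (\<Sum>k<m. \<tau> ^ 3 * (1920 * K ^ 6 + C * sqrt C) * ?N k ^ 3 + \<tau>\<^sup>2 * 192 * (quartic_tail \<nu> K u + quartic_tail \<nu> K v) * ?N k ^ 2)"
    by (rule sum_mono[OF bound])
  also have "\<dots> = \<tau> ^ 3 * (1920 * K ^ 6 + C * sqrt C) * occ_pow 3 n m h
      + \<tau>\<^sup>2 * 192 * (quartic_tail \<nu> K u + quartic_tail \<nu> K v) * occ_pow 2 n m h"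
    by (simp only: sum.distrib sum_distrib_left[symmetric] occ_pow_def)
  finally show ?thesis unfolding sq by (simp only: sum_distrib_left)
qed

end

section \<open>Sketched regression\<close>

lemma pair_integral_mult:
  fixes f :: "'a \<Rightarrow> real" and g :: "'b \<Rightarrow> real"
  assumes M: "prob_space M" and N: "prob_space N" and f: "integrable M f" and g: "integrable N g"
  shows "integrable (M \<Otimes>\<^sub>M N) (\<lambda>p. f (fst p) * g (snd p))"
    "(\<integral>p. f (fst p) * g (snd p) \<partial>(M \<Otimes>\<^sub>M N)) = (\<integral>x. f x \<partial>M) * (\<integral>y. g y \<partial>N)"
proof -
  interpret M: prob_space M by fact
  interpret N: prob_space N by fact
  interpret PP: pair_prob_space M N ..
  have [measurable]: "f \<in> borel_measurable M" "g \<in> borel_measurable N" using f g by auto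
  show int: "integrable (M \<Otimes>\<^sub>M N) (\<lambda>p. f (fst p) * g (snd p))"
  proof (rule PP.Fubini_integrable)
    show "integrable M (\<lambda>x. \<integral>y. norm (f (fst (x, y)) * g (snd (x, y))) \<partial>N)"
      using f by (simp add: abs_mult)
    show "AE x in M. integrable N (\<lambda>y. f (fst (x, y)) * g (snd (x, y)))" using g by simp
  qed measurable
  show "(\<integral>p. f (fst p) * g (snd p) \<partial>(M \<Otimes>\<^sub>M N)) = (\<integral>x. f x \<partial>M) * (\<integral>y. g y \<partial>N)"
    using PP.integral_fst'[OF int] by simp
qed

lemma (in prob_space) chebyshev_sum:
  fixes Y :: "'i \<Rightarrow> 'a \<Rightarrow> real"
  assumes I: "finite I" and ind: "indep_vars (\<lambda>_. borel) Y I"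
    and int: "\<And>k. k \<in> I \<Longrightarrow> integrable M (\<lambda>x. (Y k x)\<^sup>2)" and \<epsilon>: "\<epsilon> > 0"
  shows "prob {x \<in> space M. \<epsilon> \<le> \<bar>c * (\<Sum>k\<in>I. Y k x) - c * (\<Sum>k\<in>I. expectation (Y k))\<bar>}
    \<le> c\<^sup>2 * (\<Sum>k\<in>I. expectation (\<lambda>x. (Y k x)\<^sup>2)) / \<epsilon>\<^sup>2"
proof -
  let ?f = "\<lambda>x. c * (\<Sum>k\<in>I. Y k x) - c * (\<Sum>k\<in>I. expectation (Y k))"
  have rv: "random_variable borel (Y k)" if "k \<in> I" for k using ind that by (auto simp: indep_vars_def)
  then have [measurable]: "random_variable borel (\<lambda>x. \<Sum>k\<in>I. Y k x)" by simp
  have eq: "(\<lambda>x. (?f x)\<^sup>2) = (\<lambda>x. c\<^sup>2 * ((\<Sum>k\<in>I. Y k x) - (\<Sum>k\<in>I. expectation (Y k)))\<^sup>2)"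
    by (simp only: right_diff_distrib[symmetric] power_mult_distrib)
  note var = variance_sum_le[OF I ind int]
  have "integrable M (\<lambda>x. (?f x)\<^sup>2)" unfolding eq using var by simp
  then have "prob {x \<in> space M. \<epsilon> \<le> \<bar>?f x\<bar>} \<le> expectation (\<lambda>x. (?f x)\<^sup>2) / \<epsilon>\<^sup>2"
    by (intro second_moment_method \<epsilon>) measurable
  also have "expectation (\<lambda>x. (?f x)\<^sup>2) \<le> c\<^sup>2 * (\<Sum>k\<in>I. expectation (\<lambda>x. (Y k x)\<^sup>2))"
    unfolding eq using var by (simp add: mult_left_mono)
  finally show ?thesis using \<epsilon> by (simp add: divide_right_mono)
qed

definition gram :: "nat \<Rightarrow> nat \<Rightarrow> (nat \<Rightarrow> nat \<Rightarrow> real) \<Rightarrow> (nat \<Rightarrow> real^'p) \<Rightarrow> real^'p^'p" where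
  "gram r n S X = (1 / real n) *\<^sub>R (\<Sum>k<r. outer (\<Sum>i<n. S k i *\<^sub>R X i) (\<Sum>i<n. S k i *\<^sub>R X i))"

definition score :: "nat \<Rightarrow> nat \<Rightarrow> (nat \<Rightarrow> nat \<Rightarrow> real) \<Rightarrow> (nat \<Rightarrow> real^'p) \<Rightarrow> (nat \<Rightarrow> real) \<Rightarrow> real^'p" where
  "score r n S X e = (1 / real n) *\<^sub>R (\<Sum>k<r. (\<Sum>i<n. S k i * e i) *\<^sub>R (\<Sum>i<n. S k i *\<^sub>R X i))"

abbreviation id_sketch :: "nat \<Rightarrow> nat \<Rightarrow> real" where
  "id_sketch \<equiv> (\<lambda>k i. if k = i then 1 else 0)"

lemma gram_nth: "gram r n S X $ a $ b = (1 / real n) * (\<Sum>k<r. (\<Sum>i<n. S k i * X i $ a) * (\<Sum>i<n. S k i * X i $ b))"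
  by (simp add: gram_def outer_def)

lemma inner_score: "t \<bullet> score r n S X e = (1 / real n) * (\<Sum>k<r. (\<Sum>i<n. S k i * (t \<bullet> X i)) * (\<Sum>i<n. S k i * e i))"
  by (simp add: score_def inner_sum_right sum_distrib_left sum_distrib_right mult_ac)

lemma sum_diag:
  fixes f :: "nat \<Rightarrow> real"
  shows "k < n \<Longrightarrow> (\<Sum>i<n. (if k = i then c i else 0) * f i) = c k * f k"
  by (simp add: if_distrib[of "\<lambda>z. z * _"] sum.delta' cong: if_cong)

text \<open>A diagonal sketch, whether Bernoulli or the identity, leaves one summand per row, so the
  Gram entry is a weighted average over observations.\<close>

lemma gram_diag_nth:
  "gram n n (\<lambda>k i. if k = i then c i else 0) X $ a $ b = (1 / real n) * (\<Sum>k<n. (c k)\<^sup>2 * (X k $ a * X k $ b))"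
  unfolding gram_nth
  by (intro arg_cong[where f="(*) _"] sum.cong refl, simp only: lessThan_iff sum_diag) (simp add: power2_eq_square)

lemma inner_score_diag:
  "t \<bullet> score n n (\<lambda>k i. if k = i then c i else 0) X e = (1 / real n) * (\<Sum>k<n. (c k)\<^sup>2 * ((t \<bullet> X k) * e k))"
  unfolding inner_score
  by (intro arg_cong[where f="(*) _"] sum.cong refl, simp only: lessThan_iff sum_diag) (simp add: power2_eq_square)

lemma borel_measurable_gram:
  assumes [measurable]: "\<And>i. X i \<in> borel_measurable M" "\<And>k i. S k i \<in> borel_measurable M"
  shows "(\<lambda>w. gram r n (\<lambda>k i. S k i w) (\<lambda>i. X i w)) \<in> borel_measurable M"
  unfolding gram_def by measurable

lemma borel_measurable_score:
  assumes [measurable]: "\<And>i. X i \<in> borel_measurable M" "\<And>i. e i \<in> borel_measurable M" "\<And>k i. S k i \<in> borel_measurable M"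
  shows "(\<lambda>w. score r n (\<lambda>k i. S k i w) (\<lambda>i. X i w) (\<lambda>i. e i w)) \<in> borel_measurable M"
  unfolding score_def by measurable

lemma norm_outer_le: "norm (outer x z) \<le> real CARD('p) * (norm x * norm (z::real^'p))"
proof -
  have "norm (outer x z) \<le> (\<Sum>j\<in>UNIV. norm (outer x z $ j))"
    unfolding norm_vec_def by (rule L2_set_le_sum) simp
  also have "\<dots> \<le> (\<Sum>j\<in>(UNIV::'p set). norm x * norm z)"
  proof (rule sum_mono)
    fix j
    have "outer x z $ j = x $ j *\<^sub>R z" by (simp add: outer_def vec_eq_iff)
    then show "norm (outer x z $ j) \<le> norm x * norm z"
      using component_le_norm_cart[of x j] by (simp add: mult_right_mono)
  qed
  finally show ?thesis by simp
qed

lemma bounded_linear_mat_form: "bounded_linear (\<lambda>A::real^'p^'p. t \<bullet> (A *v s))"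
  unfolding linear_conv_bounded_linear[symmetric]
  by (rule linearI) (simp_all add: matrix_vector_mult_add_rdistrib inner_add_right scaleR_matrix_vector_assoc[symmetric])

lemma mat_nth_form: "A $ a $ b = axis a 1 \<bullet> ((A::real^'p^'p) *v axis b 1)"
  by (simp add: matrix_vector_mult_basis inner_axis' column_def)

text \<open>The hypotheses are put on (e, X), whose law alone determines the limit; the joint fourth
  moment dominates the products of four coordinates that occur later.\<close>

locale regression_data = prob_space +
  fixes X :: "nat \<Rightarrow> 'a \<Rightarrow> real^'p" and e :: "nat \<Rightarrow> 'a \<Rightarrow> real"
  assumes indep_eX: "indep_vars (\<lambda>_. borel) (\<lambda>i \<omega>. (e i \<omega>, X i \<omega>)) UNIV"
    and law_eX: "\<And>i. distr M borel (\<lambda>\<omega>. (e i \<omega>, X i \<omega>)) = distr M borel (\<lambda>\<omega>. (e 0 \<omega>, X 0 \<omega>))"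
    and int4: "integrable M (\<lambda>\<omega>. norm (e 0 \<omega>, X 0 \<omega>) ^ 4)"
    and orth: "expectation (\<lambda>\<omega>. e 0 \<omega> *\<^sub>R X 0 \<omega>) = 0"
begin

text \<open>As one vector the pair lets (0, t) select \<open>t \<bullet> X\<close> and (1, 0) select
  \<open>e\<close>, so that Gram entries and scores are both sums of products of two linear
  functionals.\<close>

definition D :: "nat \<Rightarrow> 'a \<Rightarrow> real \<times> (real^'p)" where "D i \<omega> = (e i \<omega>, X i \<omega>)"

definition Sig :: "real^'p^'p" where "Sig = expectation (\<lambda>\<omega>. outer (X 0 \<omega>) (X 0 \<omega>))"

definition Omg :: "real^'p^'p" where "Omg = expectation (\<lambda>\<omega>. (e 0 \<omega>)\<^sup>2 *\<^sub>R outer (X 0 \<omega>) (X 0 \<omega>))"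

lemma indep_D: "indep_vars (\<lambda>_. borel) D UNIV"
  using indep_eX unfolding D_def[abs_def] .

lemma rv_D [measurable]: "random_variable borel (D i)"
  using indep_D by (auto simp: indep_vars_def)

lemma rv_X [measurable]: "random_variable borel (X i)"
proof -
  have "random_variable borel (\<lambda>\<omega>. snd (D i \<omega>))"
    by (intro measurable_compose[OF rv_D] borel_measurable_continuous_onI continuous_intros)
  then show ?thesis by (simp add: D_def)
qed

lemma rv_e [measurable]: "random_variable borel (e i)"
proof -
  have "random_variable borel (\<lambda>\<omega>. fst (D i \<omega>))"
    by (intro measurable_compose[OF rv_D] borel_measurable_continuous_onI continuous_intros)
  then show ?thesis by (simp add: D_def)
qed

lemma law_D: "distr M borel (D i) = distr M borel (D 0)"
  using law_eX unfolding D_def[abs_def] .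

lemma integral_D:
  fixes g :: "_ \<Rightarrow> real"
  assumes "g \<in> borel_measurable borel"
  shows "expectation (\<lambda>\<omega>. g (D i \<omega>)) = expectation (\<lambda>\<omega>. g (D 0 \<omega>))"
  using integral_distr[OF rv_D assms, of i] integral_distr[OF rv_D assms, of 0] law_D[of i] by simp

lemma integrable_D:
  fixes g :: "_ \<Rightarrow> real"
  assumes "g \<in> borel_measurable borel" "integrable M (\<lambda>\<omega>. g (D 0 \<omega>))"
  shows "integrable M (\<lambda>\<omega>. g (D i \<omega>))"
  using integrable_distr_eq[OF rv_D assms(1), of i] integrable_distr_eq[OF rv_D assms(1), of 0] law_D[of i] assms(2) by simp

lemma integrable_quartic:
  fixes g :: "_ \<Rightarrow> real"
  assumes [measurable]: "g \<in> borel_measurable borel" and b: "\<And>d. \<bar>g d\<bar> \<le> C * (1 + norm d ^ 4)"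
  shows "integrable M (\<lambda>\<omega>. g (D i \<omega>))"
proof (rule integrable_D)
  show "integrable M (\<lambda>\<omega>. g (D 0 \<omega>))"
  proof (rule Bochner_Integration.integrable_bound)
    show "integrable M (\<lambda>\<omega>. C * (1 + norm (D 0 \<omega>) ^ 4))" using int4 by (simp add: D_def)
    show "AE \<omega> in M. norm (g (D 0 \<omega>)) \<le> norm (C * (1 + norm (D 0 \<omega>) ^ 4))"
      using order.trans[OF b abs_ge_self] by simp
  qed measurable
qed simp

lemma integrable_square_mult: "integrable M (\<lambda>\<omega>. ((u \<bullet> D i \<omega>) * (v \<bullet> D i \<omega>))\<^sup>2)"
proof (rule integrable_quartic[where C="(norm u * norm v)\<^sup>2"])
  show "\<bar>((u \<bullet> d) * (v \<bullet> d))\<^sup>2\<bar> \<le> (norm u * norm v)\<^sup>2 * (1 + norm d ^ 4)" for d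
  proof -
    have "\<bar>(u \<bullet> d) * (v \<bullet> d)\<bar> \<le> (norm u * norm d) * (norm v * norm d)"
      unfolding abs_mult by (intro mult_mono Cauchy_Schwarz_ineq2) auto
    then have "\<bar>(u \<bullet> d) * (v \<bullet> d)\<bar>\<^sup>2 \<le> ((norm u * norm d) * (norm v * norm d))\<^sup>2"
      by (rule power_mono) simp
    also have "\<dots> = (norm u * norm v)\<^sup>2 * norm d ^ 4" by (simp add: eval_nat_numeral)
    also have "\<dots> \<le> (norm u * norm v)\<^sup>2 * (1 + norm d ^ 4)" by (intro mult_left_mono) auto
    finally show ?thesis by simp
  qed
qed measurable

lemma integrable_mult: "integrable M (\<lambda>\<omega>. (u \<bullet> D i \<omega>) * (v \<bullet> D i \<omega>))"
  by (rule square_integrable_imp_integrable[OF _ integrable_square_mult]) measurable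

lemma integrable_outer: "integrable M (\<lambda>\<omega>. outer (X 0 \<omega>) (X 0 \<omega>))"
proof (rule Bochner_Integration.integrable_bound)
  have "integrable M (\<lambda>\<omega>. norm (snd (D 0 \<omega>)) ^ 4)"
  proof (rule integrable_quartic[where C=1])
    show "\<bar>norm (snd d) ^ 4\<bar> \<le> 1 * (1 + norm d ^ 4)" for d :: "real \<times> (real^'p)"
      using power_mono[OF norm_snd_le[of "snd d" "fst d"] norm_ge_zero, of 4] by (simp add: add_increasing)
  qed (intro borel_measurable_continuous_onI continuous_intros)
  then have "integrable M (\<lambda>\<omega>. norm (X 0 \<omega>) ^ 4)" by (simp add: D_def)
  then have "integrable M (\<lambda>\<omega>. norm (X 0 \<omega>) ^ 2)"
    by (rule integrable_power_le[rotated]) auto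
  then show "integrable M (\<lambda>\<omega>. real CARD('p) * norm (X 0 \<omega>) ^ 2)" by simp
  show "AE \<omega> in M. norm (outer (X 0 \<omega>) (X 0 \<omega>)) \<le> norm (real CARD('p) * norm (X 0 \<omega>) ^ 2)"
    using norm_outer_le[of "X 0 _" "X 0 _"] by (simp add: power2_eq_square)
qed measurable

lemma integrable_e2_outer: "integrable M (\<lambda>\<omega>. (e 0 \<omega>)\<^sup>2 *\<^sub>R outer (X 0 \<omega>) (X 0 \<omega>))"
proof (rule Bochner_Integration.integrable_bound)
  show "integrable M (\<lambda>\<omega>. real CARD('p) * norm (e 0 \<omega>, X 0 \<omega>) ^ 4)" using int4 by simp
  have "norm (a\<^sup>2 *\<^sub>R outer x x) \<le> real CARD('p) * norm (a, x) ^ 4" for a :: real and x :: "real^'p"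
  proof -
    have "norm (a\<^sup>2 *\<^sub>R outer x x) \<le> a\<^sup>2 * (real CARD('p) * (norm x * norm x))"
      using norm_outer_le[of x x] by (simp add: mult_left_mono)
    also have "\<dots> = real CARD('p) * (\<bar>a\<bar>\<^sup>2 * norm x ^ 2)" by (simp add: power2_eq_square)
    also have "\<dots> \<le> real CARD('p) * (norm (a, x) ^ 2 * norm (a, x) ^ 2)"
      using norm_fst_le[of a x] norm_snd_le[of x a] by (intro mult_left_mono mult_mono power_mono) auto
    finally show ?thesis by (simp flip: power_add)
  qed
  then show "AE \<omega> in M. norm ((e 0 \<omega>)\<^sup>2 *\<^sub>R outer (X 0 \<omega>) (X 0 \<omega>)) \<le> norm (real CARD('p) * norm (e 0 \<omega>, X 0 \<omega>) ^ 4)"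
    by simp
qed measurable

lemma Sig_form: "t \<bullet> (Sig *v s) = expectation (\<lambda>\<omega>. (t \<bullet> X 0 \<omega>) * (s \<bullet> X 0 \<omega>))"
  using integral_bounded_linear[OF bounded_linear_mat_form integrable_outer, of t s]
  by (simp add: Sig_def outer_mult_vec inner_commute mult.commute)

lemma Omg_form: "t \<bullet> (Omg *v s) = expectation (\<lambda>\<omega>. (e 0 \<omega>)\<^sup>2 * ((t \<bullet> X 0 \<omega>) * (s \<bullet> X 0 \<omega>)))"
  using integral_bounded_linear[OF bounded_linear_mat_form integrable_e2_outer, of t s]
  by (simp add: Omg_def scaleR_matrix_vector_assoc[symmetric] outer_mult_vec inner_commute mult_ac)

lemma Sig_nth: "Sig $ a $ b = expectation (\<lambda>\<omega>. X 0 \<omega> $ a * X 0 \<omega> $ b)"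
  unfolding mat_nth_form Sig_form by (simp add: inner_axis')

lemma Sig_sym: "transpose Sig = Sig"
  by (simp add: transpose_def vec_eq_iff Sig_nth mult.commute)

lemma Omg_sym: "transpose Omg = Omg"
proof -
  have "Omg $ a $ b = Omg $ b $ a" for a b
    unfolding mat_nth_form Omg_form by (simp add: mult.commute)
  then show ?thesis by (simp add: transpose_def vec_eq_iff)
qed

lemma Sig_psd: "0 \<le> t \<bullet> (Sig *v t)"
  unfolding Sig_form by simp

lemma Omg_psd: "0 \<le> t \<bullet> (Omg *v t)"
  unfolding Omg_form by simp

lemma inner_D: "(0, t) \<bullet> D i \<omega> = t \<bullet> X i \<omega>" "(1, 0) \<bullet> D i \<omega> = e i \<omega>"
  by (simp_all add: D_def)

lemma orth_inner: "expectation (\<lambda>\<omega>. (t \<bullet> X 0 \<omega>) * e 0 \<omega>) = 0"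
proof -
  have "integrable M (\<lambda>\<omega>. e 0 \<omega> *\<^sub>R X 0 \<omega>)"
  proof (rule Bochner_Integration.integrable_bound)
    show "integrable M (\<lambda>\<omega>. norm (D 0 \<omega>) ^ 2)"
      using integrable_power_le[OF _ int4, of 2] by (simp add: D_def)
    have "norm (a *\<^sub>R x) \<le> norm (a, x) ^ 2" for a :: real and x :: "real^'p"
      using mult_mono[OF norm_fst_le[of a x] norm_snd_le[of x a]] by (simp add: power2_eq_square)
    then show "AE \<omega> in M. norm (e 0 \<omega> *\<^sub>R X 0 \<omega>) \<le> norm (norm (D 0 \<omega>) ^ 2)" by (simp add: D_def)
  qed measurable
  from integral_inner_right[OF this, of t] show ?thesis by (simp add: orth mult.commute)
qed

text \<open>A Chebyshev bound on the data marginal, stated on the product space that also carries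
  the sketch. The free scale \<open>c\<close> is 1/n for the full Gram matrix and sqrt m / n for the
  unsketched score.\<close>

lemma iid_average:
  assumes \<epsilon>: "\<epsilon> > 0" and N: "prob_space N"
  shows "measure (M \<Otimes>\<^sub>M N) {p \<in> space (M \<Otimes>\<^sub>M N). \<epsilon> \<le> \<bar>c * (\<Sum>i<n. (u \<bullet> D i (fst p)) * (v \<bullet> D i (fst p))) - c * (real n * expectation (\<lambda>\<omega>. (u \<bullet> D 0 \<omega>) * (v \<bullet> D 0 \<omega>)))\<bar>}
    \<le> c\<^sup>2 * (real n * expectation (\<lambda>\<omega>. ((u \<bullet> D 0 \<omega>) * (v \<bullet> D 0 \<omega>))\<^sup>2)) / \<epsilon>\<^sup>2"
proof -
  interpret N: prob_space N by fact
  let ?Y = "\<lambda>i \<omega>. (u \<bullet> D i \<omega>) * (v \<bullet> D i \<omega>)"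
  let ?A = "{\<omega> \<in> space M. \<epsilon> \<le> \<bar>c * (\<Sum>i<n. ?Y i \<omega>) - c * (real n * expectation (?Y 0))\<bar>}"
  have ind: "indep_vars (\<lambda>_. borel) ?Y {..<n}"
    by (rule indep_vars_compose2[OF indep_vars_subset[OF indep_D]]) auto
  have "(\<Sum>i<n. expectation (?Y i)) = (\<Sum>i<n. expectation (?Y 0))"
    using integral_D[of "\<lambda>d. (u \<bullet> d) * (v \<bullet> d)"] by (intro sum.cong refl) simp
  then have 1: "(\<Sum>i<n. expectation (?Y i)) = real n * expectation (?Y 0)" by simp
  have "(\<Sum>i<n. expectation (\<lambda>\<omega>. (?Y i \<omega>)\<^sup>2)) = (\<Sum>i<n. expectation (\<lambda>\<omega>. (?Y 0 \<omega>)\<^sup>2))"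
    using integral_D[of "\<lambda>d. ((u \<bullet> d) * (v \<bullet> d))\<^sup>2"] by (intro sum.cong refl) simp
  then have 2: "(\<Sum>i<n. expectation (\<lambda>\<omega>. (?Y i \<omega>)\<^sup>2)) = real n * expectation (\<lambda>\<omega>. (?Y 0 \<omega>)\<^sup>2)" by simp
  have "measure (M \<Otimes>\<^sub>M N) {p \<in> space (M \<Otimes>\<^sub>M N). \<epsilon> \<le> \<bar>c * (\<Sum>i<n. ?Y i (fst p)) - c * (real n * expectation (?Y 0))\<bar>}
     = measure (M \<Otimes>\<^sub>M N) (fst -` ?A \<inter> space (M \<Otimes>\<^sub>M N))"
    by (rule arg_cong[where f="measure _"]) (auto simp: space_pair_measure)
  also have "\<dots> = measure (distr (M \<Otimes>\<^sub>M N) M fst) ?A" by (rule measure_distr[symmetric]) measurable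
  also have "\<dots> = measure M ?A" by (simp add: N.distr_pair_fst)
  also have "\<dots> \<le> c\<^sup>2 * (\<Sum>i<n. expectation (\<lambda>\<omega>. (?Y i \<omega>)\<^sup>2)) / \<epsilon>\<^sup>2"
    using chebyshev_sum[OF _ ind integrable_square_mult \<epsilon>, of c] unfolding 1 by simp
  finally show ?thesis unfolding 2 .
qed

lemma tendsto_prob_gram:
  fixes A :: "nat \<Rightarrow> 'c \<Rightarrow> real^'p^'p"
  assumes P: "\<And>n. prob_space (P n)" and A: "\<And>n. A n \<in> borel_measurable (P n)"
    and nth: "\<And>a b. tendsto_prob P (\<lambda>n x. A n x $ a $ b) (Sig $ a $ b)"
  shows "tendsto_prob P A Sig"
proof (rule tendsto_prob_componentwise[OF P A])
  fix B :: "real^'p^'p" assume "B \<in> Basis"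
  then obtain a b where "B = axis a (axis b 1)" by (auto simp: Basis_vec_def)
  then show "tendsto_prob P (\<lambda>n x. A n x \<bullet> B) (Sig \<bullet> B)" using nth[of a b] by (simp add: inner_axis)
qed

text \<open>Isolates what depends on the sketch: the convergence of its Gram matrix and the limiting
  characteristic function of its scaled score. All else is shared by the two sketches.\<close>

lemma sketch_conv_distr:
  fixes Q :: "nat \<Rightarrow> 'c pmf" and S :: "nat \<Rightarrow> 'c \<Rightarrow> nat \<Rightarrow> nat \<Rightarrow> real"
  assumes model: "\<And>i \<omega>. y i \<omega> = X i \<omega> \<bullet> \<beta> + e i \<omega>" and inv: "invertible Sig"
    and m_n: "(\<lambda>n. real (m n) / real n) \<longlonglongrightarrow> 0"
    and gram: "\<And>a b. tendsto_prob (\<lambda>n. M \<Otimes>\<^sub>M measure_pmf (Q n))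
       (\<lambda>n p. gram (r n) n (S n (snd p)) (\<lambda>i. X i (fst p)) $ a $ b) (Sig $ a $ b)"
    and ch: "\<And>t. (\<lambda>n. \<integral>p. cis (sqrt (real (m n)) * (t \<bullet> score (r n) n (S n (snd p)) (\<lambda>i. X i (fst p)) (\<lambda>i. e i (fst p)))) \<partial>(M \<Otimes>\<^sub>M measure_pmf (Q n)))
       \<longlonglongrightarrow> complex_of_real (exp (- (t \<bullet> (W *v t)) / 2))"
    and symW: "transpose W = W" and psdW: "\<And>t. 0 \<le> t \<bullet> (W *v t)"
  shows "\<exists>G. normal_vec (matrix_inv Sig ** W ** matrix_inv Sig) G \<and>
    conv_distr (\<lambda>n. M \<Otimes>\<^sub>M measure_pmf (Q n))
      (\<lambda>n (\<omega>, c). sqrt (real (m n)) *\<^sub>R (sketched_ols (r n) n (S n c) (\<lambda>i. X i \<omega>) (\<lambda>i. y i \<omega>) - ols n (\<lambda>i. X i \<omega>) (\<lambda>i. y i \<omega>))) G"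
proof -
  let ?P = "\<lambda>n. M \<Otimes>\<^sub>M measure_pmf (Q n)"
  have P: "prob_space (?P n)" for n
    by (intro prob_space_pair measure_pmf.prob_space_axioms prob_space_axioms)
  have Sm[measurable]: "(\<lambda>p. S n (snd p) k i) \<in> borel_measurable (?P n)" for n k i
    by (rule measurable_compose[OF measurable_snd]) simp
  have Xm[measurable]: "(\<lambda>p. X i (fst p)) \<in> borel_measurable (?P n)" for n i by measurable
  have em[measurable]: "(\<lambda>p. e i (fst p)) \<in> borel_measurable (?P n)" for n i by measurable
  have ym[measurable]: "(\<lambda>p. y i (fst p)) \<in> borel_measurable (?P n)" for n i unfolding model by measurable
  let ?A = "\<lambda>n p. gram (r n) n (S n (snd p)) (\<lambda>i. X i (fst p))"
  let ?B = "\<lambda>n p. gram n n id_sketch (\<lambda>i. X i (fst p))"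
  let ?T = "\<lambda>n p. sqrt (real (m n)) *\<^sub>R score (r n) n (S n (snd p)) (\<lambda>i. X i (fst p)) (\<lambda>i. e i (fst p))"
  let ?r = "\<lambda>n p. sqrt (real (m n)) *\<^sub>R score n n id_sketch (\<lambda>i. X i (fst p)) (\<lambda>i. e i (fst p))"
  let ?Z = "\<lambda>n p. sqrt (real (m n)) *\<^sub>R (sketched_ols (r n) n (S n (snd p)) (\<lambda>i. X i (fst p)) (\<lambda>i. y i (fst p)) - ols n (\<lambda>i. X i (fst p)) (\<lambda>i. y i (fst p)))"
  have Am: "?A n \<in> borel_measurable (?P n)" for n by (rule borel_measurable_gram) measurable
  have Bm: "?B n \<in> borel_measurable (?P n)" for n by (rule borel_measurable_gram) measurable
  have Tm: "?T n \<in> borel_measurable (?P n)" for n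
    by (intro borel_measurable_scaleR borel_measurable_const borel_measurable_score) measurable
  have rm: "?r n \<in> borel_measurable (?P n)" for n
    by (intro borel_measurable_scaleR borel_measurable_const borel_measurable_score) measurable
  have Zm: "?Z n \<in> borel_measurable (?P n)" for n
    by (intro borel_measurable_scaleR borel_measurable_const borel_measurable_diff borel_measurable_sketched_ols borel_measurable_ols) measurable
  have gr: "tendsto_prob ?P ?A Sig" by (rule tendsto_prob_gram[OF P Am gram])
  have B: "tendsto_prob ?P ?B Sig"
  proof (rule tendsto_prob_gram[OF P Bm])
    fix a b
    let ?u = "(0, axis a 1) :: real \<times> (real^'p)" and ?v = "(0, axis b 1) :: real \<times> (real^'p)"
    let ?C = "expectation (\<lambda>\<omega>. ((?u \<bullet> D 0 \<omega>) * (?v \<bullet> D 0 \<omega>))\<^sup>2)"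
    show "tendsto_prob ?P (\<lambda>n p. ?B n p $ a $ b) (Sig $ a $ b)"
    proof (rule tendsto_prob_chebyshev[where b="\<lambda>n. ?C / real n"])
      show "(\<lambda>n. ?C / real n) \<longlonglongrightarrow> 0" by (rule lim_const_over_n)
      fix \<epsilon> :: real assume \<epsilon>: "\<epsilon> > 0"
      show "eventually (\<lambda>n. measure (?P n) {x \<in> space (?P n). norm (?B n x $ a $ b - Sig $ a $ b) \<ge> \<epsilon>} \<le> ?C / real n / \<epsilon>\<^sup>2) sequentially"
        using eventually_gt_at_top[of 0]
      proof eventually_elim
        case (elim n)
        have "?B n x $ a $ b = (1 / real n) * (\<Sum>i<n. (?u \<bullet> D i (fst x)) * (?v \<bullet> D i (fst x)))" for x :: "'a \<times> 'c"
          by (simp only: gram_diag_nth inner_D) (simp add: inner_axis')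
        moreover have "Sig $ a $ b = (1 / real n) * (real n * expectation (\<lambda>\<omega>. (?u \<bullet> D 0 \<omega>) * (?v \<bullet> D 0 \<omega>)))"
          using elim by (simp only: Sig_nth inner_D) (simp add: inner_axis')
        ultimately have "measure (?P n) {x \<in> space (?P n). norm (?B n x $ a $ b - Sig $ a $ b) \<ge> \<epsilon>} \<le> (1 / real n)\<^sup>2 * (real n * ?C) / \<epsilon>\<^sup>2"
          using iid_average[OF \<epsilon> measure_pmf.prob_space_axioms[of "Q n"], where c="1 / real n" and n=n and u="?u" and v="?v"]
          by (simp only: real_norm_def)
        then show ?case using elim by (simp add: power2_eq_square)
      qed
    qed
  qed
  \<comment> \<open>Squaring the scale sqrt m / n and summing n equal second moments leaves the
    variance bound \<open>?C\<close> times m/n.\<close>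
  have r: "tendsto_prob ?P ?r 0"
  proof (rule tendsto_prob_componentwise[OF P rm])
    fix b :: "real^'p" assume "b \<in> Basis"
    let ?u = "(0, b) :: real \<times> (real^'p)" and ?v = "(1, 0) :: real \<times> (real^'p)"
    let ?C = "expectation (\<lambda>\<omega>. ((?u \<bullet> D 0 \<omega>) * (?v \<bullet> D 0 \<omega>))\<^sup>2)"
    show "tendsto_prob ?P (\<lambda>n p. ?r n p \<bullet> b) (0 \<bullet> b)"
    proof (rule tendsto_prob_chebyshev[where b="\<lambda>n. ?C * (real (m n) / real n)"])
      show "(\<lambda>n. ?C * (real (m n) / real n)) \<longlonglongrightarrow> 0" using tendsto_mult_right_zero[OF m_n] .
      fix \<epsilon> :: real assume \<epsilon>: "\<epsilon> > 0"
      show "eventually (\<lambda>n. measure (?P n) {x \<in> space (?P n). norm (?r n x \<bullet> b - 0 \<bullet> b) \<ge> \<epsilon>} \<le> ?C * (real (m n) / real n) / \<epsilon>\<^sup>2) sequentially"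
        using eventually_gt_at_top[of 0]
      proof eventually_elim
        case (elim n)
        have "?r n x \<bullet> b = (sqrt (real (m n)) / real n) * (\<Sum>i<n. (?u \<bullet> D i (fst x)) * (?v \<bullet> D i (fst x)))" for x :: "'a \<times> 'c"
          using inner_score_diag[of b n "\<lambda>_. 1" "\<lambda>i. X i (fst x)" "\<lambda>i. e i (fst x)"]
          by (simp add: inner_D inner_commute[of "score _ _ _ _ _"])
        moreover have "0 \<bullet> b = (sqrt (real (m n)) / real n) * (real n * expectation (\<lambda>\<omega>. (?u \<bullet> D 0 \<omega>) * (?v \<bullet> D 0 \<omega>)))"
          using orth_inner[of b] by (simp only: inner_D) simp
        ultimately have "measure (?P n) {x \<in> space (?P n). norm (?r n x \<bullet> b - 0 \<bullet> b) \<ge> \<epsilon>} \<le> (sqrt (real (m n)) / real n)\<^sup>2 * (real n * ?C) / \<epsilon>\<^sup>2"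
          using iid_average[OF \<epsilon> measure_pmf.prob_space_axioms[of "Q n"], where c="sqrt (real (m n)) / real n" and n=n and u="?u" and v="?v"]
          by (simp only: real_norm_def)
        then show ?case using elim by (simp add: power2_eq_square field_simps)
      qed
    qed
  qed
  have "\<exists>G. normal_vec (matrix_inv Sig ** W ** matrix_inv Sig) G \<and> conv_distr ?P ?Z G"
  proof (rule conv_distr_inverse_gram[OF P Am Bm Tm rm Zm gr B r _ _ inv Sig_sym symW psdW])
    show "(\<lambda>n. \<integral>p. cis (t \<bullet> ?T n p) \<partial>?P n) \<longlonglongrightarrow> complex_of_real (exp (- (t \<bullet> (W *v t)) / 2))" for t
      using ch[of t] by simp
    show "eventually (\<lambda>n. \<forall>x\<in>space (?P n). invertible (?A n x) \<longrightarrow> invertible (?B n x) \<longrightarrow>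
        ?Z n x = inv0 (?A n x) *v ?T n x - inv0 (?B n x) *v ?r n x) sequentially"
      using eventually_gt_at_top[of 0]
    proof (eventually_elim, intro ballI impI)
      fix n x assume n: "0 < (n::nat)" and A: "invertible (?A n x)" and B: "invertible (?B n x)"
      have a: "sketched_ols (r n) n (S n (snd x)) (\<lambda>i. X i (fst x)) (\<lambda>i. y i (fst x)) - \<beta>
         = inv0 (?A n x) *v score (r n) n (S n (snd x)) (\<lambda>i. X i (fst x)) (\<lambda>i. e i (fst x))"
        unfolding gram_def score_def
        by (rule sketched_ols_error) (use model n A in \<open>auto simp: gram_def\<close>)
      have b: "ols n (\<lambda>i. X i (fst x)) (\<lambda>i. y i (fst x)) - \<beta>
         = inv0 (?B n x) *v score n n id_sketch (\<lambda>i. X i (fst x)) (\<lambda>i. e i (fst x))"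
        unfolding gram_def score_def ols_eq_sketched_ols
        by (rule sketched_ols_error) (use model n B in \<open>auto simp: gram_def\<close>)
      have "?Z n x = sqrt (real (m n)) *\<^sub>R ((sketched_ols (r n) n (S n (snd x)) (\<lambda>i. X i (fst x)) (\<lambda>i. y i (fst x)) - \<beta>) - (ols n (\<lambda>i. X i (fst x)) (\<lambda>i. y i (fst x)) - \<beta>))"
        by simp
      then show "?Z n x = inv0 (?A n x) *v ?T n x - inv0 (?B n x) *v ?r n x"
        unfolding a b by (simp add: matrix_vector_mult_scaleR scaleR_diff_right)
    qed
  qed
  then show ?thesis by (simp add: case_prod_unfold)
qed

end

section \<open>Bernoulli sampling\<close>

lemma bern_Pi_diag: "bern_Pi n k b = (\<lambda>j i. if j = i then sqrt (real n / real k) * (if b i then 1 else 0) else 0)"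
  by (intro ext) (simp add: bern_Pi_def)

text \<open>\<open>m n \<le> n\<close> makes m/n a genuine success probability, and
  \<open>0 < m n\<close> gives meaning to the scalings by 1/m.\<close>

lemma eventually_sketch_size:
  assumes "filterlim m at_top sequentially" "(\<lambda>n. real (m n) / real n) \<longlonglongrightarrow> 0"
  shows "eventually (\<lambda>n. 0 < m n \<and> m n \<le> n) sequentially"
proof -
  have "eventually (\<lambda>n. 0 < m n) sequentially" 
    using filterlim_at_top[THEN iffD1, OF assms(1), rule_format, of 1] by eventually_elim simp
  moreover have "eventually (\<lambda>n. real (m n) / real n < 1) sequentially"
    using assms(2) by (rule order_tendstoD) simp
  moreover note eventually_gt_at_top[of 0]
  ultimately show ?thesis
    by eventually_elim (simp add: field_simps)
qed

context regression_data
begin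

lemma bern_indep:
  assumes n: "n > 0" and g[measurable]: "g \<in> borel_measurable borel"
  shows "prob_space.indep_vars (M \<Otimes>\<^sub>M measure_pmf (bern_sketch n k)) (\<lambda>_. borel)
    (\<lambda>i p. (if snd p i then 1 else 0) * (g (D i (fst p)) :: real)) {..<n}"
proof -
  interpret PP: prob_space "M \<Otimes>\<^sub>M measure_pmf (bern_sketch n k)"
    by (intro prob_space_pair measure_pmf.prob_space_axioms prob_space_axioms)
  have "PP.indep_vars (\<lambda>i. borel \<Otimes>\<^sub>M count_space UNIV) (\<lambda>i p. (D i (fst p), snd p i)) {..<n}"
  proof (rule indep_vars_pair[OF prob_space_axioms measure_pmf.prob_space_axioms])
    show "indep_vars (\<lambda>_. borel) D {..<n}" by (rule indep_vars_subset[OF indep_D]) simp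
    show "prob_space.indep_vars (measure_pmf (bern_sketch n k)) (\<lambda>i. count_space UNIV) (\<lambda>i b. b i) {..<n}"
      unfolding bern_sketch_def by (rule indep_vars_Pi_pmf) simp
  qed (use n in auto)
  then have "PP.indep_vars (\<lambda>_. borel) (\<lambda>i p. (\<lambda>q. (if snd q then 1 else 0) * g (fst q)) (D i (fst p), snd p i)) {..<n}"
    by (rule PP.indep_vars_compose2) measurable
  then show ?thesis by simp
qed

lemma bern_integral:
  fixes g :: "real \<times> (real^'p) \<Rightarrow> real"
  assumes k: "k \<le> n" and i: "i < n" and g: "g \<in> borel_measurable borel" "integrable M (\<lambda>\<omega>. g (D 0 \<omega>))"
  shows "integrable (M \<Otimes>\<^sub>M measure_pmf (bern_sketch n k)) (\<lambda>p. (if snd p i then 1 else 0) * g (D i (fst p)))"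
    "(\<integral>p. (if snd p i then 1 else 0) * g (D i (fst p)) \<partial>(M \<Otimes>\<^sub>M measure_pmf (bern_sketch n k))) = real k / real n * expectation (\<lambda>\<omega>. g (D 0 \<omega>))"
proof -
  let ?B = "bern_sketch n k"
  have "map_pmf (\<lambda>b. b i) ?B = bernoulli_pmf (real k / real n)"
    unfolding bern_sketch_def using i by (subst Pi_pmf_component) auto
  then have "measure_pmf.expectation ?B (\<lambda>b. if b i then 1 else 0 :: real) = measure_pmf.expectation (bernoulli_pmf (real k / real n)) (\<lambda>c. if c then 1 else 0)"
    using integral_map_pmf[of "\<lambda>b. b i" ?B "\<lambda>c. if c then 1 else 0 :: real"] by simp
  also have "\<dots> = real k / real n" using k i by (subst integral_bernoulli_pmf) auto
  finally have e: "measure_pmf.expectation ?B (\<lambda>b. if b i then 1 else 0 :: real) = real k / real n" .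
  have ib: "integrable (measure_pmf ?B) (\<lambda>b. if b i then 1 else 0 :: real)"
    by (rule measure_pmf.integrable_const_bound[where B=1]) auto
  note pim = pair_integral_mult[OF prob_space_axioms measure_pmf.prob_space_axioms integrable_D[OF g, of i] ib]
  show "integrable (M \<Otimes>\<^sub>M measure_pmf ?B) (\<lambda>p. (if snd p i then 1 else 0) * g (D i (fst p)))"
    using pim(1) by (simp add: mult.commute)
  have "(\<integral>p. (if snd p i then 1 else 0) * g (D i (fst p)) \<partial>(M \<Otimes>\<^sub>M measure_pmf ?B)) = (\<integral>p. g (D i (fst p)) * (if snd p i then 1 else 0) \<partial>(M \<Otimes>\<^sub>M measure_pmf ?B))"
    by (simp only: mult.commute)
  also have "\<dots> = real k / real n * expectation (\<lambda>\<omega>. g (D 0 \<omega>))"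
    unfolding pim(2) e integral_D[OF g(1), of i] by simp
  finally show "(\<integral>p. (if snd p i then 1 else 0) * g (D i (fst p)) \<partial>(M \<Otimes>\<^sub>M measure_pmf ?B)) = real k / real n * expectation (\<lambda>\<omega>. g (D 0 \<omega>))" .
qed

text \<open>The squared diagonal entry n/k and the normalisation 1/n combine to 1/k. With n summands
  kept with probability k/n each, Chebyshev's bound carries the factor (1/k)^2 n (k/n) =
  1/k.\<close>

lemma bern_gram:
  assumes k: "0 < k" "k \<le> n" and \<epsilon>: "\<epsilon> > 0"
  shows "measure (M \<Otimes>\<^sub>M measure_pmf (bern_sketch n k)) {p \<in> space (M \<Otimes>\<^sub>M measure_pmf (bern_sketch n k)).
       norm (gram n n (bern_Pi n k (snd p)) (\<lambda>i. X i (fst p)) $ a $ b - Sig $ a $ b) \<ge> \<epsilon>}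
    \<le> expectation (\<lambda>\<omega>. (((0, axis a 1) \<bullet> D 0 \<omega>) * ((0, axis b 1) \<bullet> D 0 \<omega>))\<^sup>2) / real k / \<epsilon>\<^sup>2"
proof -
  let ?P = "M \<Otimes>\<^sub>M measure_pmf (bern_sketch n k)"
  interpret PP: prob_space ?P
    by (intro prob_space_pair measure_pmf.prob_space_axioms prob_space_axioms)
  let ?u = "(0, axis a 1) :: real \<times> (real^'p)" and ?v = "(0, axis b 1) :: real \<times> (real^'p)"
  define g where "g = (\<lambda>d. (?u \<bullet> d) * (?v \<bullet> d))"
  have gm[measurable]: "g \<in> borel_measurable borel" unfolding g_def by measurable
  have gi: "integrable M (\<lambda>\<omega>. g (D 0 \<omega>))" unfolding g_def by (rule integrable_mult)
  have gi2: "integrable M (\<lambda>\<omega>. (g (D 0 \<omega>))\<^sup>2)" unfolding g_def by (rule integrable_square_mult)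
  let ?Y = "\<lambda>i p. (if snd p i then 1 else 0) * g (D i (fst p))"
  have n: "n > 0" using k by simp
  have sq: "(\<lambda>p. (?Y i p)\<^sup>2) = (\<lambda>p. (if snd p i then 1 else 0) * (g (D i (fst p)))\<^sup>2)" for i
    by (auto simp: fun_eq_iff)
  have g2m: "(\<lambda>d. (g d)\<^sup>2) \<in> borel_measurable borel" by measurable
  have e1: "(\<Sum>i<n. PP.expectation (?Y i)) = (\<Sum>i<n. real k / real n * expectation (\<lambda>\<omega>. g (D 0 \<omega>)))"
    using bern_integral(2)[OF k(2) _ gm gi] by (intro sum.cong) auto
  have e2: "(\<Sum>i<n. PP.expectation (\<lambda>p. (?Y i p)\<^sup>2)) = (\<Sum>i<n. real k / real n * expectation (\<lambda>\<omega>. (g (D 0 \<omega>))\<^sup>2))"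
    unfolding sq using bern_integral(2)[OF k(2) _ g2m gi2] by (intro sum.cong) auto
  have gr: "gram n n (bern_Pi n k (snd p)) (\<lambda>i. X i (fst p)) $ a $ b = (1 / real k) * (\<Sum>i<n. ?Y i p)" for p
  proof -
    have "gram n n (bern_Pi n k (snd p)) (\<lambda>i. X i (fst p)) $ a $ b
       = (1 / real n) * (\<Sum>i<n. (real n / real k) * ?Y i p)"
      unfolding bern_Pi_diag gram_diag_nth
      by (intro arg_cong[where f="(*) _"] sum.cong refl) (simp add: g_def inner_D inner_axis')
    then show ?thesis using n unfolding sum_distrib_left[symmetric] by simp
  qed
  have sg: "Sig $ a $ b = (1 / real k) * (\<Sum>i<n. PP.expectation (?Y i))"
    unfolding e1 using k n by (simp add: Sig_nth g_def inner_D inner_axis')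
  have "PP.prob {p \<in> space ?P. \<epsilon> \<le> \<bar>(1 / real k) * (\<Sum>i<n. ?Y i p) - (1 / real k) * (\<Sum>i<n. PP.expectation (?Y i))\<bar>}
     \<le> (1 / real k)\<^sup>2 * (\<Sum>i<n. PP.expectation (\<lambda>p. (?Y i p)\<^sup>2)) / \<epsilon>\<^sup>2"
  proof (rule PP.chebyshev_sum[OF _ bern_indep[OF n gm] _ \<epsilon>])
    show "integrable ?P (\<lambda>p. (?Y i p)\<^sup>2)" if "i \<in> {..<n}" for i
      unfolding sq using bern_integral(1)[OF k(2) _ g2m gi2] that by simp
  qed simp
  then show ?thesis unfolding gr sg e2 using k n by (simp add: power2_eq_square g_def)
qed

text \<open>A kept observation contributes \<xi> / sqrt k and is kept with probability k/n, so each
  of the n summands has variance V/n, where V = E \<xi>^2 is the form of \<open>Omg\<close> at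
  \<open>t\<close>.\<close>

lemma bern_char:
  assumes k: "0 < k" "k \<le> n"
  defines "\<xi> \<equiv> (\<lambda>t \<omega>. (t \<bullet> X 0 \<omega>) * e 0 \<omega>)"
  shows "cmod ((\<integral>p. cis (sqrt (real k) * (t \<bullet> score n n (bern_Pi n k (snd p)) (\<lambda>i. X i (fst p)) (\<lambda>i. e i (fst p)))) \<partial>(M \<Otimes>\<^sub>M measure_pmf (bern_sketch n k)))
      - complex_of_real (exp (- (t \<bullet> (Omg *v t)) / 2)))
    \<le> expectation (\<lambda>\<omega>. real k * min ((\<xi> t \<omega> / sqrt (real k))\<^sup>2) (\<bar>\<xi> t \<omega> / sqrt (real k)\<bar> ^ 3))
      + (t \<bullet> (Omg *v t)) * sqrt ((t \<bullet> (Omg *v t)) / real n)"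
proof -
  let ?P = "M \<Otimes>\<^sub>M measure_pmf (bern_sketch n k)"
  interpret PP: prob_space ?P
    by (intro prob_space_pair measure_pmf.prob_space_axioms prob_space_axioms)
  let ?u = "(0, t) :: real \<times> (real^'p)" and ?v = "(1, 0) :: real \<times> (real^'p)"
  define q where "q = (\<lambda>d. (?u \<bullet> d) * (?v \<bullet> d))"
  define g where "g = (\<lambda>d. q d / sqrt (real k))"
  define f where "f = (\<lambda>d. min ((g d)\<^sup>2) (\<bar>g d\<bar> ^ 3))"
  have [measurable]: "q \<in> borel_measurable borel" unfolding q_def by measurable
  have gm[measurable]: "g \<in> borel_measurable borel" unfolding g_def by measurable
  have g2m: "(\<lambda>d. (g d)\<^sup>2) \<in> borel_measurable borel" by measurable
  have fm[measurable]: "f \<in> borel_measurable borel" unfolding f_def by measurable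
  have q\<xi>: "q (D 0 \<omega>) = \<xi> t \<omega>" for \<omega> by (simp add: q_def \<xi>_def inner_D)
  define V where "V = t \<bullet> (Omg *v t)"
  have V: "V = expectation (\<lambda>\<omega>. (\<xi> t \<omega>)\<^sup>2)"
    unfolding V_def Omg_form \<xi>_def by (simp add: power2_eq_square mult_ac)
  have gi: "integrable M (\<lambda>\<omega>. g (D 0 \<omega>))" unfolding g_def q_def using integrable_mult by simp
  have gi2: "integrable M (\<lambda>\<omega>. (g (D 0 \<omega>))\<^sup>2)"
    unfolding g_def q_def using integrable_square_mult by (simp add: power_divide)
  have fi: "integrable M (\<lambda>\<omega>. f (D 0 \<omega>))"
    by (rule Bochner_Integration.integrable_bound[OF gi2]) (auto simp: f_def)
  let ?Y = "\<lambda>i p. (if snd p i then 1 else 0) * g (D i (fst p))"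
  have n: "n > 0" using k by simp
  have sq: "(\<lambda>p. (?Y i p)\<^sup>2) = (\<lambda>p. (if snd p i then 1 else 0) * (g (D i (fst p)))\<^sup>2)" for i
    by (auto simp: fun_eq_iff)
  \<comment> \<open>The selector is 0 or 1, so it can be pulled out of any function that vanishes at
    0.\<close>
  have cu: "(\<lambda>p. min ((?Y i p)\<^sup>2) (\<bar>?Y i p\<bar> ^ 3)) = (\<lambda>p. (if snd p i then 1 else 0) * f (D i (fst p)))" for i
    by (auto simp: fun_eq_iff f_def)
  have sc: "sqrt (real k) * (t \<bullet> score n n (bern_Pi n k (snd p)) (\<lambda>i. X i (fst p)) (\<lambda>i. e i (fst p))) = (\<Sum>i<n. ?Y i p)" for p
  proof -
    have "t \<bullet> score n n (bern_Pi n k (snd p)) (\<lambda>i. X i (fst p)) (\<lambda>i. e i (fst p))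
       = (1 / real n) * (\<Sum>i<n. (real n / real k * sqrt (real k)) * ?Y i p)"
      unfolding bern_Pi_diag inner_score_diag
      using k by (intro arg_cong[where f="(*) _"] sum.cong refl) (simp add: g_def q_def inner_D)
    then show ?thesis using n k unfolding sum_distrib_left[symmetric] by (simp flip: mult.assoc)
  qed
  have v: "PP.expectation (\<lambda>p. (?Y i p)\<^sup>2) = V / real n" if "i \<in> {..<n}" for i
  proof -
    have "expectation (\<lambda>\<omega>. (g (D 0 \<omega>))\<^sup>2) = V / real k"
      by (simp add: g_def q\<xi> V power_divide)
    then show ?thesis
      unfolding sq using bern_integral(2)[OF k(2) _ g2m gi2, of i] that k by simp
  qed
  have "cmod (PP.expectation (\<lambda>p. cis (\<Sum>i<n. ?Y i p)) - complex_of_real (exp (- (\<Sum>i<n. V / real n) / 2)))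
    \<le> (\<Sum>i<n. PP.expectation (\<lambda>p. min ((?Y i p)\<^sup>2) (\<bar>?Y i p\<bar> ^ 3)) + (V / real n) * sqrt (V / real n))"
  proof (rule PP.char_sum_approx[OF _ bern_indep[OF n gm] _ _ v])
    show "integrable ?P (\<lambda>p. (?Y i p)\<^sup>2)" if "i \<in> {..<n}" for i
      unfolding sq using bern_integral(1)[OF k(2) _ g2m gi2] that by simp
    show "PP.expectation (?Y i) = 0" if "i \<in> {..<n}" for i
    proof -
      have "expectation (\<lambda>\<omega>. g (D 0 \<omega>)) = 0"
        using orth_inner[of t] by (simp add: g_def q\<xi> \<xi>_def)
      then show ?thesis using bern_integral(2)[OF k(2) _ gm gi, of i] that by simp
    qed
  qed simp_all
  also have "\<dots> = (\<Sum>i<n. real k / real n * expectation (\<lambda>\<omega>. f (D 0 \<omega>)) + (V / real n) * sqrt (V / real n))"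
    unfolding cu using bern_integral(2)[OF k(2) _ fm fi] by (intro sum.cong) auto
  also have "\<dots> = real k * expectation (\<lambda>\<omega>. f (D 0 \<omega>)) + V * sqrt (V / real n)"
    using n by (simp add: distrib_left)
  also have "real k * expectation (\<lambda>\<omega>. f (D 0 \<omega>)) = expectation (\<lambda>\<omega>. real k * min ((\<xi> t \<omega> / sqrt (real k))\<^sup>2) (\<bar>\<xi> t \<omega> / sqrt (real k)\<bar> ^ 3))"
    by (simp add: f_def g_def q\<xi>)
  finally show ?thesis unfolding sc using n by (simp add: V_def)
qed

lemma bern_conv_distr:
  assumes model: "\<And>i \<omega>. y i \<omega> = X i \<omega> \<bullet> \<beta> + e i \<omega>" and inv: "invertible Sig"
    and m_inf: "filterlim m at_top sequentially" and m_n: "(\<lambda>n. real (m n) / real n) \<longlonglongrightarrow> 0"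
  shows "\<exists>G. normal_vec (matrix_inv Sig ** Omg ** matrix_inv Sig) G \<and>
    conv_distr (\<lambda>n. M \<Otimes>\<^sub>M measure_pmf (bern_sketch n (m n)))
      (\<lambda>n (\<omega>, b). sqrt (real (m n)) *\<^sub>R (sketched_ols n n (bern_Pi n (m n) b) (\<lambda>i. X i \<omega>) (\<lambda>i. y i \<omega>) - ols n (\<lambda>i. X i \<omega>) (\<lambda>i. y i \<omega>))) G"
proof (rule sketch_conv_distr[OF model inv m_n _ _ Omg_sym Omg_psd, where S="\<lambda>n. bern_Pi n (m n)"])
  have m_real: "filterlim (\<lambda>n. real (m n)) at_top sequentially"
    by (rule filterlim_compose[OF filterlim_real_sequentially m_inf])
  note ev = eventually_sketch_size[OF m_inf m_n]
  show "tendsto_prob (\<lambda>n. M \<Otimes>\<^sub>M measure_pmf (bern_sketch n (m n)))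
    (\<lambda>n p. gram n n (bern_Pi n (m n) (snd p)) (\<lambda>i. X i (fst p)) $ a $ b) (Sig $ a $ b)" for a b
  proof (rule tendsto_prob_chebyshev[where b="\<lambda>n. expectation (\<lambda>\<omega>. (((0, axis a 1) \<bullet> D 0 \<omega>) * ((0, axis b 1) \<bullet> D 0 \<omega>))\<^sup>2) / real (m n)"])
    show "(\<lambda>n. expectation (\<lambda>\<omega>. (((0, axis a 1) \<bullet> D 0 \<omega>) * ((0, axis b 1) \<bullet> D 0 \<omega>))\<^sup>2) / real (m n)) \<longlonglongrightarrow> 0"
      by (rule tendsto_divide_0[OF tendsto_const filterlim_at_top_imp_at_infinity[OF m_real]])
  qed (rule eventually_mono[OF ev], use bern_gram in auto)
  fix t
  let ?V = "t \<bullet> (Omg *v t)"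
  define \<xi> where "\<xi> = (\<lambda>\<omega>. (t \<bullet> X 0 \<omega>) * e 0 \<omega>)"
  have \<xi>2: "integrable M (\<lambda>\<omega>. (\<xi> \<omega>)\<^sup>2)"
    using integrable_square_mult[of "(0, t)" 0 "(1, 0)"] by (simp add: \<xi>_def inner_D)
  have [measurable]: "random_variable borel \<xi>" unfolding \<xi>_def by measurable
  \<comment> \<open>The Lindeberg term is dominated by the square of \<open>\<xi>\<close> and tends
    to 0 pointwise like 1/sqrt m. Dominated convergence thus asks for the second moment of
    \<open>\<xi>\<close>, which the fourth moments of the data supply.\<close>
  define E where "E = (\<lambda>n \<omega>. real (m n) * min ((\<xi> \<omega> / sqrt (real (m n)))\<^sup>2) (\<bar>\<xi> \<omega> / sqrt (real (m n))\<bar> ^ 3))"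
  have E0: "0 \<le> E n \<omega>" for n \<omega> by (simp add: E_def)
  have E1: "E n \<omega> \<le> (\<xi> \<omega>)\<^sup>2" for n \<omega>
  proof -
    have "E n \<omega> \<le> real (m n) * (\<xi> \<omega> / sqrt (real (m n)))\<^sup>2" unfolding E_def by (intro mult_left_mono) auto
    also have "\<dots> \<le> (\<xi> \<omega>)\<^sup>2" by (simp add: power_divide)
    finally show ?thesis .
  qed
  have E2: "E n \<omega> \<le> \<bar>\<xi> \<omega>\<bar> ^ 3 / sqrt (real (m n))" if "0 < m n" for n \<omega>
  proof -
    have "E n \<omega> \<le> real (m n) * \<bar>\<xi> \<omega> / sqrt (real (m n))\<bar> ^ 3" unfolding E_def by (intro mult_left_mono) auto
    also have "\<dots> = \<bar>\<xi> \<omega>\<bar> ^ 3 / sqrt (real (m n))"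
      using that by (simp add: power_divide abs_divide power3_eq_cube field_simps)
    finally show ?thesis .
  qed
  have sqrt_inf: "filterlim (\<lambda>n. sqrt (real (m n))) at_top sequentially"
    by (rule filterlim_compose[OF sqrt_at_top m_real])
  have "(\<lambda>n. expectation (E n)) \<longlonglongrightarrow> expectation (\<lambda>\<omega>. 0)"
  proof (rule integral_dominated_convergence[OF _ _ \<xi>2])
    show "AE \<omega> in M. (\<lambda>n. E n \<omega>) \<longlonglongrightarrow> 0"
    proof (rule AE_I2)
      fix \<omega>
      show "(\<lambda>n. E n \<omega>) \<longlonglongrightarrow> 0"
      proof (rule tendsto_sandwich[OF _ _ tendsto_const])
        show "(\<lambda>n. \<bar>\<xi> \<omega>\<bar> ^ 3 / sqrt (real (m n))) \<longlonglongrightarrow> 0"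
          by (rule tendsto_divide_0[OF tendsto_const filterlim_at_top_imp_at_infinity[OF sqrt_inf]])
        show "eventually (\<lambda>n. E n \<omega> \<le> \<bar>\<xi> \<omega>\<bar> ^ 3 / sqrt (real (m n))) sequentially"
          using ev by eventually_elim (simp add: E2)
      qed (simp add: E0)
    qed
    show "random_variable borel (E n)" for n unfolding E_def by measurable
    show "AE \<omega> in M. norm (E n \<omega>) \<le> (\<xi> \<omega>)\<^sup>2" for n using E0 E1 by simp
  qed simp
  then have l1: "(\<lambda>n. expectation (E n)) \<longlonglongrightarrow> 0" by simp
  have "(\<lambda>n. ?V * sqrt (?V / real n)) \<longlonglongrightarrow> ?V * sqrt 0"
    by (intro tendsto_mult tendsto_const tendsto_real_sqrt lim_const_over_n)
  then have l2: "(\<lambda>n. expectation (E n) + ?V * sqrt (?V / real n)) \<longlonglongrightarrow> 0"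
    using tendsto_add[OF l1] by simp
  show "(\<lambda>n. \<integral>p. cis (sqrt (real (m n)) * (t \<bullet> score n n (bern_Pi n (m n) (snd p)) (\<lambda>i. X i (fst p)) (\<lambda>i. e i (fst p)))) \<partial>(M \<Otimes>\<^sub>M measure_pmf (bern_sketch n (m n))))
    \<longlonglongrightarrow> complex_of_real (exp (- ?V / 2))"
  proof (rule LIM_zero_cancel, rule Lim_null_comparison[OF _ l2])
    show "eventually (\<lambda>n. norm ((\<integral>p. cis (sqrt (real (m n)) * (t \<bullet> score n n (bern_Pi n (m n) (snd p)) (\<lambda>i. X i (fst p)) (\<lambda>i. e i (fst p)))) \<partial>(M \<Otimes>\<^sub>M measure_pmf (bern_sketch n (m n))))
       - complex_of_real (exp (- ?V / 2))) \<le> expectation (E n) + ?V * sqrt (?V / real n)) sequentially"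
      using ev by eventually_elim (use bern_char[of _ _ t] in \<open>simp add: E_def \<xi>_def\<close>)
  qed
qed

end

section \<open>Countsketch\<close>

lemma cs_Pi_sum:
  fixes f :: "nat \<Rightarrow> real"
  shows "(\<Sum>i<n. cs_Pi (glue n h s) k i * f i) = (\<Sum>i\<in>{i. i < n \<and> h i = k}. s i * f i)"
proof -
  have "(\<Sum>i<n. cs_Pi (glue n h s) k i * f i) = (\<Sum>i<n. if h i = k then s i * f i else 0)"
    by (rule sum.cong) (auto simp: cs_Pi_def glue_def)
  also have "\<dots> = (\<Sum>i\<in>{i \<in> {..<n}. h i = k}. s i * f i)" by (rule sum.inter_filter[symmetric]) simp
  finally show ?thesis by simp
qed

context regression_data
begin

definition nu :: "(real \<times> (real^'p)) measure" where
  "nu = distr (M \<Otimes>\<^sub>M measure_pmf (pmf_of_set {-1, 1})) borel (\<lambda>p. snd p *\<^sub>R D 0 (fst p))"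

text \<open>The sign carries the discrete sigma-algebra of a pmf, hence \<open>count_space\<close>
  in the second factor.\<close>

lemma measurable_sign_scale:
  "(\<lambda>q. snd q *\<^sub>R fst q) \<in> borel_measurable (borel \<Otimes>\<^sub>M count_space (UNIV :: real set) :: ((real \<times> (real^'p)) \<times> real) measure)"
proof -
  have "(\<lambda>q. snd q) \<in> borel_measurable (borel \<Otimes>\<^sub>M count_space (UNIV :: real set) :: ((real \<times> (real^'p)) \<times> real) measure)"
    by (rule measurable_compose[OF measurable_snd]) simp
  then show ?thesis by measurable
qed

text \<open>Only the distribution of the sign \<open>f\<close> matters. This identifies the laws for
  every index \<open>i\<close>, for a single coordinate of \<open>signs\<close>, and for the negated
  sign, which is the symmetry of \<open>nu\<close>.\<close>

lemma distr_sign_scale: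
  fixes f :: "'c \<Rightarrow> real"
  shows "distr (M \<Otimes>\<^sub>M measure_pmf Q) borel (\<lambda>p. f (snd p) *\<^sub>R D i (fst p))
     = distr (distr M borel (D 0) \<Otimes>\<^sub>M measure_pmf (map_pmf f Q)) borel (\<lambda>q. snd q *\<^sub>R fst q)"
proof -
  have 1: "measure_pmf (map_pmf f Q) = distr (measure_pmf Q) (count_space UNIV) f" by (rule map_pmf_rep_eq)
  have "distr M borel (D 0) \<Otimes>\<^sub>M measure_pmf (map_pmf f Q) = distr M borel (D i) \<Otimes>\<^sub>M distr (measure_pmf Q) (count_space UNIV) f"
    unfolding 1 using law_D[of i] by simp
  also have "\<dots> = distr (M \<Otimes>\<^sub>M measure_pmf Q) (borel \<Otimes>\<^sub>M count_space UNIV) (\<lambda>(x, y). (D i x, f y))"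
  proof (rule pair_measure_distr)
    show "sigma_finite_measure (distr (measure_pmf Q) (count_space UNIV) f)"
      unfolding 1[symmetric] by (rule measure_pmf.sigma_finite_measure_axioms)
  qed simp_all
  finally have 2: "distr M borel (D 0) \<Otimes>\<^sub>M measure_pmf (map_pmf f Q) = distr (M \<Otimes>\<^sub>M measure_pmf Q) (borel \<Otimes>\<^sub>M count_space UNIV) (\<lambda>(x, y). (D i x, f y))" .
  have m: "(\<lambda>(x, y). (D i x, f y)) \<in> (M \<Otimes>\<^sub>M measure_pmf Q) \<rightarrow>\<^sub>M (borel \<Otimes>\<^sub>M count_space UNIV)"
    unfolding case_prod_unfold
    by (intro measurable_Pair measurable_compose[OF measurable_fst rv_D] measurable_compose[OF measurable_snd]) simp
  show ?thesis unfolding 2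
    by (subst distr_distr[OF measurable_sign_scale m]) (simp add: comp_def case_prod_unfold)
qed

lemma nu_eq: "nu = distr (distr M borel (D 0) \<Otimes>\<^sub>M measure_pmf (pmf_of_set {-1, 1})) borel (\<lambda>q. snd q *\<^sub>R fst q)"
  unfolding nu_def using distr_sign_scale[of "pmf_of_set {-1, 1}" "\<lambda>s. s" 0] by simp

text \<open>An even power of a sign is 1, so symmetrising leaves moments of even degree as they
  were.\<close>

lemma nu_moment:
  fixes g :: "real \<times> (real^'p) \<Rightarrow> real"
  assumes g[measurable]: "g \<in> borel_measurable borel" and hom: "\<And>s d. g (s *\<^sub>R d) = s ^ (2 * k) * g d"
    and int: "integrable M (\<lambda>\<omega>. g (D 0 \<omega>))"
  shows "integrable nu g" "(\<integral>x. g x \<partial>nu) = expectation (\<lambda>\<omega>. g (D 0 \<omega>))"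
proof -
  let ?R = "measure_pmf (pmf_of_set {-1, 1 :: real})"
  have m: "(\<lambda>p. snd p *\<^sub>R D 0 (fst p)) \<in> borel_measurable (M \<Otimes>\<^sub>M ?R)"
  proof -
    have "(\<lambda>p. snd p) \<in> borel_measurable (M \<Otimes>\<^sub>M ?R)" by (rule measurable_compose[OF measurable_snd]) simp
    then show ?thesis by measurable
  qed
  have int_s: "integrable ?R (\<lambda>s. s ^ (2 * k))" by (rule integrable_measure_pmf_finite) (simp add: set_pmf_of_set)
  have es: "(\<integral>s. s ^ (2 * k) \<partial>?R) = 1" by (subst integral_pmf_of_set) auto
  note pim = pair_integral_mult[OF prob_space_axioms measure_pmf.prob_space_axioms int int_s]
  show "integrable nu g"
    unfolding nu_def using pim(1) by (subst integrable_distr_eq[OF m g]) (simp add: hom mult.commute)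
  show "(\<integral>x. g x \<partial>nu) = expectation (\<lambda>\<omega>. g (D 0 \<omega>))"
    unfolding nu_def using pim(2) es by (subst integral_distr[OF m g]) (simp add: hom mult.commute)
qed

lemma sym_iid_signs:
  assumes n: "n > 0"
  shows "sym_iid (M \<Otimes>\<^sub>M measure_pmf (signs n)) (\<lambda>i p. snd p i *\<^sub>R D i (fst p)) n nu"
proof -
  interpret PP: prob_space "M \<Otimes>\<^sub>M measure_pmf (signs n)"
    by (intro prob_space_pair measure_pmf.prob_space_axioms prob_space_axioms)
  show ?thesis
  proof (intro sym_iid.intro sym_iid_axioms.intro PP.prob_space_axioms)
    have "PP.indep_vars (\<lambda>i. borel \<Otimes>\<^sub>M count_space UNIV) (\<lambda>i p. (D i (fst p), snd p i)) {..<n}"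
    proof (rule indep_vars_pair[OF prob_space_axioms measure_pmf.prob_space_axioms])
      show "indep_vars (\<lambda>_. borel) D {..<n}" by (rule indep_vars_subset[OF indep_D]) simp
      show "prob_space.indep_vars (measure_pmf (signs n)) (\<lambda>i. count_space UNIV) (\<lambda>i b. b i) {..<n}"
        unfolding signs_def by (rule indep_vars_Pi_pmf) simp
    qed (use n in auto)
    then have "PP.indep_vars (\<lambda>_. borel) (\<lambda>i p. (\<lambda>q. snd q *\<^sub>R fst q) (D i (fst p), snd p i)) {..<n}"
      by (rule PP.indep_vars_compose2) (rule measurable_sign_scale)
    then show "PP.indep_vars (\<lambda>_. borel) (\<lambda>i p. snd p i *\<^sub>R D i (fst p)) {..<n}" by simp
    show "distr (M \<Otimes>\<^sub>M measure_pmf (signs n)) borel (\<lambda>p. snd p i *\<^sub>R D i (fst p)) = nu" if "i < n" for i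
    proof -
      have "map_pmf (\<lambda>s. s i) (signs n) = pmf_of_set {-1, 1}"
        unfolding signs_def using that by (subst Pi_pmf_component) auto
      then show ?thesis unfolding nu_eq distr_sign_scale[of "signs n" "\<lambda>s. s i" i] by simp
    qed
    show "sets nu = sets borel" by (simp add: nu_def)
    have P0: "prob_space (M \<Otimes>\<^sub>M measure_pmf (pmf_of_set {-1, 1 :: real}))"
      by (intro prob_space_pair measure_pmf.prob_space_axioms prob_space_axioms)
    have sm: "(\<lambda>p. snd p) \<in> borel_measurable (M \<Otimes>\<^sub>M measure_pmf (pmf_of_set {-1, 1 :: real}))"
      by (rule measurable_compose[OF measurable_snd]) simp
    have m: "(\<lambda>p. snd p *\<^sub>R D 0 (fst p)) \<in> borel_measurable (M \<Otimes>\<^sub>M measure_pmf (pmf_of_set {-1, 1 :: real}))"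
      using sm by measurable
    show "prob_space nu" unfolding nu_def by (rule prob_space.prob_space_distr[OF P0 m])
    have neg: "map_pmf uminus (pmf_of_set {-1, 1 :: real}) = pmf_of_set {-1, 1}"
      by (subst map_pmf_of_set_inj) (auto simp: insert_commute)
    have "distr nu borel uminus = distr (M \<Otimes>\<^sub>M measure_pmf (pmf_of_set {-1, 1 :: real})) borel (\<lambda>p. (- snd p) *\<^sub>R D 0 (fst p))"
      unfolding nu_def by (subst distr_distr[OF _ m]) (auto simp: comp_def)
    also have "\<dots> = nu"
      unfolding nu_eq distr_sign_scale[of "pmf_of_set {-1, 1}" uminus 0] neg ..
    finally show "distr nu borel uminus = nu" .
    show "integrable nu (\<lambda>x. norm x ^ 4)"
    proof (rule nu_moment(1)[where k=2])
      show "norm (s *\<^sub>R d) ^ 4 = s ^ (2 * 2) * norm d ^ 4" for s and d :: "real \<times> (real^'p)"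
        by (simp add: power_mult_distrib power_abs[symmetric])
    qed (use int4 in \<open>auto simp: D_def\<close>)
  qed
qed

lemma nu_moments:
  shows "sym_iid.cov nu u v = expectation (\<lambda>\<omega>. (u \<bullet> D 0 \<omega>) * (v \<bullet> D 0 \<omega>))"
    "sym_iid.m2 nu u = expectation (\<lambda>\<omega>. (u \<bullet> D 0 \<omega>) * (u \<bullet> D 0 \<omega>))"
    "sym_iid.m22 nu u v = expectation (\<lambda>\<omega>. ((u \<bullet> D 0 \<omega>) * (v \<bullet> D 0 \<omega>))\<^sup>2)"
proof -
  \<comment> \<open>These constants are functions of \<open>nu\<close> alone, so an instance with a
    single observation yields them for every sample size.\<close>
  interpret C: sym_iid "M \<Otimes>\<^sub>M measure_pmf (signs 1)" "\<lambda>i p. snd p i *\<^sub>R D i (fst p)" 1 nu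
    by (rule sym_iid_signs) simp
  have cov: "C.cov u v = expectation (\<lambda>\<omega>. (u \<bullet> D 0 \<omega>) * (v \<bullet> D 0 \<omega>))" for u v
    unfolding C.cov_def by (rule nu_moment(2)[where k=1]) (auto simp: integrable_mult power2_eq_square mult_ac)
  then show "C.cov u v = expectation (\<lambda>\<omega>. (u \<bullet> D 0 \<omega>) * (v \<bullet> D 0 \<omega>))" .
  show "C.m2 u = expectation (\<lambda>\<omega>. (u \<bullet> D 0 \<omega>) * (u \<bullet> D 0 \<omega>))"
    using cov[of u u] by (simp add: C.cov_def C.m2_def power2_eq_square)
  show "C.m22 u v = expectation (\<lambda>\<omega>. ((u \<bullet> D 0 \<omega>) * (v \<bullet> D 0 \<omega>))\<^sup>2)"
    unfolding C.m22_def
  proof (rule nu_moment(2)[where k=2])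
    show "((u \<bullet> s *\<^sub>R d) * (v \<bullet> s *\<^sub>R d))\<^sup>2 = s ^ (2 * 2) * ((u \<bullet> d) * (v \<bullet> d))\<^sup>2" for s d
      by (simp add: eval_nat_numeral)
  qed (simp_all only: integrable_square_mult, measurable)
qed

text \<open>Divided by n this is a Gram entry when \<open>u\<close> and \<open>v\<close> both select
  coordinates of X, and the score in a direction when \<open>v\<close> selects
  \<open>e\<close>.\<close>

definition cs_form :: "nat \<Rightarrow> nat \<Rightarrow> (real \<times> (real^'p)) \<Rightarrow> (real \<times> (real^'p)) \<Rightarrow> 'a \<times> (nat \<Rightarrow> nat \<times> real) \<Rightarrow> real" where
  "cs_form k n u v p = (\<Sum>j<k. (\<Sum>i<n. cs_Pi (snd p) j i * (u \<bullet> D i (fst p))) * (\<Sum>i<n. cs_Pi (snd p) j i * (v \<bullet> D i (fst p))))"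

lemma borel_measurable_cs_form [measurable]:
  "cs_form k n u v \<in> borel_measurable (M \<Otimes>\<^sub>M measure_pmf Q)"
proof -
  have [measurable]: "(\<lambda>p. cs_Pi (snd p) j i) \<in> borel_measurable (M \<Otimes>\<^sub>M measure_pmf Q)" for i j
    by (rule measurable_compose[OF measurable_snd]) simp
  show ?thesis unfolding cs_form_def[abs_def] by measurable
qed

lemma cs_form_glue:
  assumes n: "n > 0"
  shows "cs_form k n u v (fst p, glue n h (snd p)) =
    (\<Sum>j<k. sym_iid.S (\<lambda>i p. snd p i *\<^sub>R D i (fst p)) u (sym_iid.block n h j) p * sym_iid.S (\<lambda>i p. snd p i *\<^sub>R D i (fst p)) v (sym_iid.block n h j) p)"
proof -
  interpret C: sym_iid "M \<Otimes>\<^sub>M measure_pmf (signs n)" "\<lambda>i p. snd p i *\<^sub>R D i (fst p)" n nu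
    by (rule sym_iid_signs[OF n])
  show ?thesis by (simp add: cs_form_def cs_Pi_sum C.S_def C.block_def)
qed

text \<open>For every assignment of rows the conditional mean of \<open>cs_form\<close> is n times
  \<open>c u v\<close>, so the rows add no variance of their own. Chebyshev given the rows, followed
  by the mean of \<open>occ_pow 2\<close>, leaves 1/n + 1/k.\<close>

lemma cs_gram:
  assumes k: "0 < k" "k \<le> n" and \<epsilon>: "\<epsilon> > 0"
  defines "c \<equiv> (\<lambda>u v. expectation (\<lambda>\<omega>. (u \<bullet> D 0 \<omega>) * (v \<bullet> D 0 \<omega>)))"
  defines "C \<equiv> (\<lambda>u v. expectation (\<lambda>\<omega>. ((u \<bullet> D 0 \<omega>) * (v \<bullet> D 0 \<omega>))\<^sup>2) + c u u * c v v + 2 * (c u v)\<^sup>2)"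
  shows "measure (M \<Otimes>\<^sub>M measure_pmf (cs_sketch n k)) {p \<in> space (M \<Otimes>\<^sub>M measure_pmf (cs_sketch n k)).
       norm (1 / real n * cs_form k n u v p - c u v) \<ge> \<epsilon>} \<le> C u v * (1 / real n + 1 / real k) / \<epsilon>\<^sup>2"
proof -
  have n: "n > 0" using k by simp
  let ?P = "M \<Otimes>\<^sub>M measure_pmf (cs_sketch n k)" and ?Q = "M \<Otimes>\<^sub>M measure_pmf (signs n)"
  interpret C: sym_iid ?Q "\<lambda>i p. snd p i *\<^sub>R D i (fst p)" n nu by (rule sym_iid_signs[OF n])
  interpret PP: prob_space ?P
    by (intro prob_space_pair measure_pmf.prob_space_axioms prob_space_axioms)
  have cov: "C.cov u v = c u v" and m2: "C.m2 u = c u u" for u v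
    unfolding c_def by (rule nu_moments)+
  have Cuv: "C u v = C.m22 u v + C.m2 u * C.m2 v + 2 * (C.cov u v)\<^sup>2" by (simp add: C_def cov m2 nu_moments(3))
  have C0: "C u v \<ge> 0" unfolding Cuv C.m22_def C.m2_def by simp
  let ?Y = "\<lambda>h p. \<Sum>j<k. C.S u (C.block h j) p * C.S v (C.block h j) p"
  let ?E = "{p \<in> space ?P. norm (1 / real n * cs_form k n u v p - c u v) \<ge> \<epsilon>}"
  have Es[measurable]: "?E \<in> sets ?P" by measurable
  have "measure ?P ?E = (\<integral>p. indicator ?E p \<partial>?P)" by simp
  also have "\<dots> = measure_pmf.expectation (unif_rows n k) (\<lambda>h. \<integral>p. indicator ?E (fst p, glue n h (snd p)) \<partial>?Q)"
    by (rule integral_cs_sketch[OF prob_space_axioms k(1), where B=1]) (auto simp: indicator_def)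
  also have "\<dots> \<le> measure_pmf.expectation (unif_rows n k) (\<lambda>h. C u v / ((real n)\<^sup>2 * \<epsilon>\<^sup>2) * occ_pow 2 n k h)"
  proof (rule expectation_unif_rows_mono[OF k(1)])
    fix h assume h: "h \<in> set_pmf (unif_rows n k)"
    have hk: "\<And>i. i < n \<Longrightarrow> h i < k" using set_unif_rows[OF k(1) h] .
    note var = C.variance_blocks[of h k u v, OF hk]
    have Ym[measurable]: "?Y h \<in> borel_measurable ?Q"
      using C.rv_S[OF C.block_subset] by (intro borel_measurable_sum borel_measurable_times)
    have "(\<integral>p. (indicator ?E (fst p, glue n h (snd p)) :: real) \<partial>?Q) = (\<integral>p. indicator {p \<in> space ?Q. \<epsilon> * real n \<le> \<bar>?Y h p - real n * C.cov u v\<bar>} p \<partial>?Q)"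
    proof (rule Bochner_Integration.integral_cong[OF refl])
      fix p assume p: "p \<in> space ?Q"
      have "norm (1 / real n * cs_form k n u v (fst p, glue n h (snd p)) - c u v) = \<bar>?Y h p - real n * C.cov u v\<bar> / real n"
        unfolding cs_form_glue[OF n] cov using n by (simp add: field_simps abs_divide)
      then show "(indicator ?E (fst p, glue n h (snd p)) :: real) = indicator {p \<in> space ?Q. \<epsilon> * real n \<le> \<bar>?Y h p - real n * C.cov u v\<bar>} p"
        using p n by (auto simp: indicator_def space_pair_measure pos_le_divide_eq)
    qed
    also have "\<dots> = measure ?Q {p \<in> space ?Q. \<epsilon> * real n \<le> \<bar>?Y h p - real n * C.cov u v\<bar>}" by simp
    also have "\<dots> \<le> C.expectation (\<lambda>p. (?Y h p - real n * C.cov u v)\<^sup>2) / (\<epsilon> * real n)\<^sup>2"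
      using \<epsilon> n by (intro C.second_moment_method var(1)) auto
    also have "\<dots> \<le> C u v * occ_pow 2 n k h / (\<epsilon> * real n)\<^sup>2"
      using var(2) unfolding Cuv by (intro divide_right_mono) auto
    finally show "(\<integral>p. indicator ?E (fst p, glue n h (snd p)) \<partial>?Q) \<le> C u v / ((real n)\<^sup>2 * \<epsilon>\<^sup>2) * occ_pow 2 n k h"
      by (simp add: power_mult_distrib mult.commute)
  qed
  also have "\<dots> = C u v / ((real n)\<^sup>2 * \<epsilon>\<^sup>2) * (real n + real n * (real n - 1) / real k)"
    using k by (simp add: expectation_occ_square)
  also have "\<dots> \<le> C u v / ((real n)\<^sup>2 * \<epsilon>\<^sup>2) * (real n + real n * real n / real k)"
    using C0 by (intro mult_left_mono add_left_mono divide_right_mono) auto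
  also have "\<dots> = C u v * (1 / real n + 1 / real k) / \<epsilon>\<^sup>2"
    using n k \<epsilon> by (simp add: field_simps power2_eq_square)
  finally show ?thesis .
qed


text \<open>Three errors are added: the Lindeberg estimate given the rows, the truncation tail with
  384 = 2 * 192, which does not shrink with n, and the distance of the conditional variance from its
  limit. In the last, \<open>w\<close> times k/n is the vanishing share of the diagonal pairs, and
  the rest is the fluctuation of the occupancies.\<close>

lemma cs_char:
  assumes k: "0 < k" "k \<le> n" and K: "K \<ge> 0"
  defines "c \<equiv> (\<lambda>u v. expectation (\<lambda>\<omega>. (u \<bullet> D 0 \<omega>) * (v \<bullet> D 0 \<omega>)))"
  assumes c0: "c u v = 0"
  defines "w \<equiv> expectation (\<lambda>\<omega>. ((u \<bullet> D 0 \<omega>) * (v \<bullet> D 0 \<omega>))\<^sup>2)"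
  defines "C \<equiv> w + c u u * c v v"
  shows "cmod ((\<integral>p. cis (sqrt (real k) / real n * cs_form k n u v p) \<partial>(M \<Otimes>\<^sub>M measure_pmf (cs_sketch n k))) - complex_of_real (exp (- (c u u * c v v) / 2)))
    \<le> 5 * (1920 * K ^ 6 + C * sqrt C) / sqrt (real k) + 384 * (quartic_tail nu K u + quartic_tail nu K v)
      + (w * (real k / real n) + c u u * c v v * (sqrt (8 / real n) + 1 / real n)) / 2"
proof -
  have n: "n > 0" using k by simp
  let ?P = "M \<Otimes>\<^sub>M measure_pmf (cs_sketch n k)" and ?Q = "M \<Otimes>\<^sub>M measure_pmf (signs n)"
  interpret C: sym_iid ?Q "\<lambda>i p. snd p i *\<^sub>R D i (fst p)" n nu by (rule sym_iid_signs[OF n])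
  have cov: "C.cov u v = c u v" and m2: "C.m2 u = c u u" for u v
    unfolding c_def by (rule nu_moments)+
  have m22: "C.m22 u v = w" unfolding w_def by (rule nu_moments(3))
  have cov0: "C.cov u v = 0" by (simp add: cov c0)
  define \<tau> where "\<tau> = sqrt (real k) / real n"
  have \<tau>0: "\<tau> \<ge> 0" by (simp add: \<tau>_def)
  define v0 where "v0 = c u u * c v v"
  have v00: "v0 \<ge> 0" by (simp add: v0_def c_def)
  have w0: "w \<ge> 0" by (simp add: w_def)
  define L where "L = complex_of_real (exp (- v0 / 2))"
  define \<Phi> where "\<Phi> = (\<lambda>h. \<integral>p. cis (\<tau> * cs_form k n u v (fst p, glue n h (snd p))) \<partial>?Q)"
  define a where "a = 1920 * K ^ 6 + C * sqrt C"
  define tl where "tl = quartic_tail nu K u + quartic_tail nu K v"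
  have a0: "a \<ge> 0" using K w0 v00 by (simp add: a_def C_def v0_def[symmetric])
  have tl0: "tl \<ge> 0" by (simp add: tl_def quartic_tail_def)
  have fin: "finite (set_pmf (unif_rows n k))" by (rule finite_set_unif_rows[OF k(1)])
  have i\<Phi>: "integrable (measure_pmf (unif_rows n k)) \<Phi>" by (rule integrable_measure_pmf_finite[OF fin])
  have "(\<integral>p. cis (\<tau> * cs_form k n u v p) \<partial>?P) = measure_pmf.expectation (unif_rows n k) \<Phi>"
    unfolding \<Phi>_def by (rule integral_cs_sketch[OF prob_space_axioms k(1), where B=1])
      (intro measurable_compose[OF _ borel_measurable_cis] borel_measurable_times borel_measurable_const borel_measurable_cs_form, simp)
  then have "(\<integral>p. cis (\<tau> * cs_form k n u v p) \<partial>?P) - L = measure_pmf.expectation (unif_rows n k) (\<lambda>h. \<Phi> h - L)"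
    using i\<Phi> by simp
  then have "cmod ((\<integral>p. cis (\<tau> * cs_form k n u v p) \<partial>?P) - L) \<le> measure_pmf.expectation (unif_rows n k) (\<lambda>h. cmod (\<Phi> h - L))"
    by (simp only: integral_norm_bound)
  also have "\<dots> \<le> measure_pmf.expectation (unif_rows n k) (\<lambda>h. \<tau> ^ 3 * a * occ_pow 3 n k h + \<tau>\<^sup>2 * 192 * tl * occ_pow 2 n k h
      + (w * (real k / real n) + v0 * \<bar>\<tau>\<^sup>2 * (occ_pow 2 n k h - real n) - 1\<bar>) / 2)"
  proof (rule expectation_unif_rows_mono[OF k(1)])
    fix h assume h: "h \<in> set_pmf (unif_rows n k)"
    have hk: "\<And>i. i < n \<Longrightarrow> h i < k" using set_unif_rows[OF k(1) h] .
    define V where "V = \<tau>\<^sup>2 * (real n * w + (occ_pow 2 n k h - real n) * v0)"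
    have V0: "V \<ge> 0" unfolding V_def using occ_square_ge[OF k(1) h] w0 v00 by simp
    have 1: "cmod (\<Phi> h - complex_of_real (exp (- V / 2))) \<le> \<tau> ^ 3 * a * occ_pow 3 n k h + \<tau>\<^sup>2 * 192 * tl * occ_pow 2 n k h"
      using C.char_blocks[OF hk \<tau>0 K cov0] unfolding m22 m2 \<Phi>_def cs_form_glue[OF n] V_def v0_def a_def tl_def C_def .
    have "cmod (complex_of_real (exp (- V / 2)) - L) = \<bar>exp (- (V / 2)) - exp (- (v0 / 2))\<bar>"
      unfolding L_def of_real_diff[symmetric] norm_of_real by simp
    also have "\<dots> \<le> \<bar>V / 2 - v0 / 2\<bar>" using V0 v00 by (intro exp_minus_lipschitz) auto
    also have "\<dots> = \<bar>V - v0\<bar> / 2" by (simp add: diff_divide_distrib[symmetric] abs_divide del: diff_divide_distrib)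
    \<comment> \<open>The limit 1 of the scaled number of distinct pairs is subtracted inside, in
      the form that \<open>occ_pow_rates\<close> controls.\<close>
    also have "V - v0 = w * (real k / real n) + v0 * (\<tau>\<^sup>2 * (occ_pow 2 n k h - real n) - 1)"
    proof -
      have eq: "\<tau>\<^sup>2 * real n = real k / real n" using n by (simp add: \<tau>_def power_divide power2_eq_square)
      show ?thesis unfolding eq[symmetric] by (simp add: V_def algebra_simps)
    qed
    also have "\<bar>\<dots>\<bar> \<le> w * (real k / real n) + v0 * \<bar>\<tau>\<^sup>2 * (occ_pow 2 n k h - real n) - 1\<bar>"
      using abs_triangle_ineq[of "w * (real k / real n)" "v0 * (\<tau>\<^sup>2 * (occ_pow 2 n k h - real n) - 1)"] w0 v00
      by (simp add: abs_mult)
    finally have 2: "cmod (complex_of_real (exp (- V / 2)) - L) \<le> (w * (real k / real n) + v0 * \<bar>\<tau>\<^sup>2 * (occ_pow 2 n k h - real n) - 1\<bar>) / 2"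
      by simp
    have "cmod (\<Phi> h - L) \<le> cmod (\<Phi> h - complex_of_real (exp (- V / 2))) + cmod (complex_of_real (exp (- V / 2)) - L)"
      using norm_triangle_ineq[of "\<Phi> h - complex_of_real (exp (- V / 2))" "complex_of_real (exp (- V / 2)) - L"] by simp
    then show "cmod (\<Phi> h - L) \<le> \<tau> ^ 3 * a * occ_pow 3 n k h + \<tau>\<^sup>2 * 192 * tl * occ_pow 2 n k h
      + (w * (real k / real n) + v0 * \<bar>\<tau>\<^sup>2 * (occ_pow 2 n k h - real n) - 1\<bar>) / 2"
      using 1 2 by linarith
  qed
  also have "\<dots> = a * (\<tau> ^ 3 * measure_pmf.expectation (unif_rows n k) (occ_pow 3 n k)) + 192 * tl * (\<tau>\<^sup>2 * measure_pmf.expectation (unif_rows n k) (occ_pow 2 n k))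
      + (w * (real k / real n) + v0 * measure_pmf.expectation (unif_rows n k) (\<lambda>h. \<bar>\<tau>\<^sup>2 * (occ_pow 2 n k h - real n) - 1\<bar>)) / 2"
    using k(1) by simp
  also have "\<dots> \<le> a * (5 / sqrt (real k)) + 192 * tl * 2 + (w * (real k / real n) + v0 * (sqrt (8 / real n) + 1 / real n)) / 2"
    using a0 tl0 v00 occ_pow_rates[OF k, folded \<tau>_def]
    by (intro add_mono mult_left_mono divide_right_mono order_refl) auto
  finally show ?thesis by (simp add: L_def v0_def a_def tl_def \<tau>_def mult_ac)
qed

lemma cs_conv_distr:
  assumes model: "\<And>i \<omega>. y i \<omega> = X i \<omega> \<bullet> \<beta> + e i \<omega>" and inv: "invertible Sig"
    and m_inf: "filterlim m at_top sequentially" and m_n: "(\<lambda>n. real (m n) / real n) \<longlonglongrightarrow> 0"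
  shows "\<exists>G. normal_vec (matrix_inv Sig ** (expectation (\<lambda>\<omega>. (e 0 \<omega>)\<^sup>2) *\<^sub>R Sig) ** matrix_inv Sig) G \<and>
    conv_distr (\<lambda>n. M \<Otimes>\<^sub>M measure_pmf (cs_sketch n (m n)))
      (\<lambda>n (\<omega>, c). sqrt (real (m n)) *\<^sub>R (sketched_ols (m n) n (cs_Pi c) (\<lambda>i. X i \<omega>) (\<lambda>i. y i \<omega>) - ols n (\<lambda>i. X i \<omega>) (\<lambda>i. y i \<omega>))) G"
proof (rule sketch_conv_distr[OF model inv m_n, where S="\<lambda>n. cs_Pi"])
  have m_real: "filterlim (\<lambda>n. real (m n)) at_top sequentially"
    by (rule filterlim_compose[OF filterlim_real_sequentially m_inf])
  have sqrt_inf: "filterlim (\<lambda>n. sqrt (real (m n))) at_top sequentially"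
    by (rule filterlim_compose[OF sqrt_at_top m_real])
  note ev = eventually_sketch_size[OF m_inf m_n]
  define c where "c = (\<lambda>u v. expectation (\<lambda>\<omega>. (u \<bullet> D 0 \<omega>) * (v \<bullet> D 0 \<omega>)))"
  show "transpose (expectation (\<lambda>\<omega>. (e 0 \<omega>)\<^sup>2) *\<^sub>R Sig) = expectation (\<lambda>\<omega>. (e 0 \<omega>)\<^sup>2) *\<^sub>R Sig"
    using Sig_sym by (simp add: transpose_def vec_eq_iff)
  have form: "t \<bullet> ((expectation (\<lambda>\<omega>. (e 0 \<omega>)\<^sup>2) *\<^sub>R Sig) *v t) = expectation (\<lambda>\<omega>. (e 0 \<omega>)\<^sup>2) * (t \<bullet> (Sig *v t))" for t
    by (simp add: scaleR_matrix_vector_assoc[symmetric])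
  show "0 \<le> t \<bullet> ((expectation (\<lambda>\<omega>. (e 0 \<omega>)\<^sup>2) *\<^sub>R Sig) *v t)" for t
    unfolding form using Sig_psd[of t] by simp
  show "tendsto_prob (\<lambda>n. M \<Otimes>\<^sub>M measure_pmf (cs_sketch n (m n)))
    (\<lambda>n p. gram (m n) n (cs_Pi (snd p)) (\<lambda>i. X i (fst p)) $ a $ b) (Sig $ a $ b)" for a b
  proof -
    let ?u = "(0, axis a 1) :: real \<times> (real^'p)" and ?v = "(0, axis b 1) :: real \<times> (real^'p)"
    let ?C = "expectation (\<lambda>\<omega>. ((?u \<bullet> D 0 \<omega>) * (?v \<bullet> D 0 \<omega>))\<^sup>2) + c ?u ?u * c ?v ?v + 2 * (c ?u ?v)\<^sup>2"
    have gr: "gram (m n) n (cs_Pi (snd p)) (\<lambda>i. X i (fst p)) $ a $ b = 1 / real n * cs_form (m n) n ?u ?v p" for n p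
      by (simp add: gram_nth cs_form_def inner_D inner_axis')
    have sg: "Sig $ a $ b = c ?u ?v" by (simp add: Sig_nth c_def inner_D inner_axis')
    show ?thesis
    proof (rule tendsto_prob_chebyshev[where b="\<lambda>n. ?C * (1 / real n + 1 / real (m n))"])
      have "(\<lambda>n. 1 / real n + 1 / real (m n)) \<longlonglongrightarrow> 0 + 0"
        by (intro tendsto_add lim_const_over_n tendsto_divide_0[OF tendsto_const filterlim_at_top_imp_at_infinity[OF m_real]])
      then show "(\<lambda>n. ?C * (1 / real n + 1 / real (m n))) \<longlonglongrightarrow> 0"
        by (intro tendsto_mult_right_zero) simp
      fix \<epsilon> :: real assume \<epsilon>: "\<epsilon> > 0"
      show "eventually (\<lambda>n. measure (M \<Otimes>\<^sub>M measure_pmf (cs_sketch n (m n))) {x \<in> space (M \<Otimes>\<^sub>M measure_pmf (cs_sketch n (m n))).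
        norm (gram (m n) n (cs_Pi (snd x)) (\<lambda>i. X i (fst x)) $ a $ b - Sig $ a $ b) \<ge> \<epsilon>} \<le> ?C * (1 / real n + 1 / real (m n)) / \<epsilon>\<^sup>2) sequentially"
        using ev
      proof eventually_elim
        case (elim n)
        then show ?case unfolding gr sg using cs_gram[of "m n" n \<epsilon> ?u ?v] \<epsilon> by (simp only: c_def simp_thms)
      qed
    qed
  qed
  fix t
  let ?u = "(0, t) :: real \<times> (real^'p)" and ?v = "(1, 0) :: real \<times> (real^'p)"
  define w where "w = expectation (\<lambda>\<omega>. ((?u \<bullet> D 0 \<omega>) * (?v \<bullet> D 0 \<omega>))\<^sup>2)"
  define C where "C = w + c ?u ?u * c ?v ?v"
  have c0: "c ?u ?v = 0" using orth_inner[of t] by (simp add: c_def inner_D)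
  have v0: "t \<bullet> ((expectation (\<lambda>\<omega>. (e 0 \<omega>)\<^sup>2) *\<^sub>R Sig) *v t) = c ?u ?u * c ?v ?v"
    unfolding form Sig_form by (simp add: c_def inner_D power2_eq_square)
  define Err where "Err = (\<lambda>n. cmod ((\<integral>p. cis (sqrt (real (m n)) / real n * cs_form (m n) n ?u ?v p) \<partial>(M \<Otimes>\<^sub>M measure_pmf (cs_sketch n (m n)))) - complex_of_real (exp (- (c ?u ?u * c ?v ?v) / 2))))"
  have "Err \<longlonglongrightarrow> 0"
  proof (rule LIMSEQ_I)
    fix r :: real assume r: "r > 0"
    interpret C1: sym_iid "M \<Otimes>\<^sub>M measure_pmf (signs 1)" "\<lambda>i p. snd p i *\<^sub>R D i (fst p)" 1 nu
      by (rule sym_iid_signs) simp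
    \<comment> \<open>\<open>K\<close> is fixed here, before n grows, so that the tail takes less
      than r/2 uniformly in n; the remaining terms \<open>R\<close> vanish for this
      \<open>K\<close>.\<close>
    have "(\<lambda>K. 384 * (quartic_tail nu (real K) ?u + quartic_tail nu (real K) ?v)) \<longlonglongrightarrow> 384 * (0 + 0)"
      by (intro tendsto_mult tendsto_const tendsto_add quartic_tail_tendsto C1.sets_law C1.integrable_inner_power) simp_all
    then have "eventually (\<lambda>K. 384 * (quartic_tail nu (real K) ?u + quartic_tail nu (real K) ?v) < r / 2) sequentially"
      using r by (intro order_tendstoD) auto
    then obtain K :: nat where K: "384 * (quartic_tail nu (real K) ?u + quartic_tail nu (real K) ?v) < r / 2"
      by (auto simp: eventually_sequentially)
    define R where "R = (\<lambda>n. 5 * (1920 * real K ^ 6 + C * sqrt C) / sqrt (real (m n)) + (w * (real (m n) / real n) + c ?u ?u * c ?v ?v * (sqrt (8 / real n) + 1 / real n)) / 2)"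
    have "(\<lambda>n. 5 * (1920 * real K ^ 6 + C * sqrt C) / sqrt (real (m n))) \<longlonglongrightarrow> 0"
      by (rule tendsto_divide_0[OF tendsto_const filterlim_at_top_imp_at_infinity[OF sqrt_inf]])
    moreover have "(\<lambda>n. w * (real (m n) / real n)) \<longlonglongrightarrow> w * 0"
      by (intro tendsto_mult_left m_n)
    moreover have "(\<lambda>n. c ?u ?u * c ?v ?v * (sqrt (8 / real n) + 1 / real n)) \<longlonglongrightarrow> c ?u ?u * c ?v ?v * (sqrt 0 + 0)"
      by (intro tendsto_mult_left tendsto_add tendsto_real_sqrt lim_const_over_n)
    ultimately have "R \<longlonglongrightarrow> 0 + (w * 0 + c ?u ?u * c ?v ?v * (sqrt 0 + 0)) / 2"
      unfolding R_def by (intro tendsto_add tendsto_divide tendsto_const) simp_all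
    then have "eventually (\<lambda>n. R n < r / 2) sequentially"
      using r by (intro order_tendstoD) auto
    with ev have "eventually (\<lambda>n. Err n < r) sequentially"
    proof eventually_elim
      case (elim n)
      have "Err n \<le> R n + 384 * (quartic_tail nu (real K) ?u + quartic_tail nu (real K) ?v)"
        using cs_char[of "m n" n "real K" ?u ?v] elim(1) c0
        unfolding Err_def R_def C_def w_def c_def by simp
      then show ?case using elim(2) K by linarith
    qed
    then show "\<exists>no. \<forall>n\<ge>no. norm (Err n - 0) < r" by (simp add: eventually_sequentially Err_def)
  qed
  then have "(\<lambda>n. \<integral>p. cis (sqrt (real (m n)) / real n * cs_form (m n) n ?u ?v p) \<partial>(M \<Otimes>\<^sub>M measure_pmf (cs_sketch n (m n)))) \<longlonglongrightarrow> complex_of_real (exp (- (c ?u ?u * c ?v ?v) / 2))"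
    unfolding Err_def by (rule tendsto_norm_zero_cancel[THEN LIM_zero_cancel])
  moreover have "sqrt (real (m n)) * (t \<bullet> score (m n) n (cs_Pi (snd p)) (\<lambda>i. X i (fst p)) (\<lambda>i. e i (fst p))) = sqrt (real (m n)) / real n * cs_form (m n) n ?u ?v p" for n p
    by (simp add: inner_score cs_form_def inner_D)
  ultimately show "(\<lambda>n. \<integral>p. cis (sqrt (real (m n)) * (t \<bullet> score (m n) n (cs_Pi (snd p)) (\<lambda>i. X i (fst p)) (\<lambda>i. e i (fst p)))) \<partial>(M \<Otimes>\<^sub>M measure_pmf (cs_sketch n (m n))))
    \<longlonglongrightarrow> complex_of_real (exp (- (t \<bullet> ((expectation (\<lambda>\<omega>. (e 0 \<omega>)\<^sup>2) *\<^sub>R Sig) *v t)) / 2))"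
    by (simp only: v0)
qed

end

lemma sum_power4_le: "(a + b) ^ 4 \<le> 8 * (a ^ 4 + b ^ 4)" for a b :: real
proof -
  have "(a + b)\<^sup>2 \<le> 2 * (a\<^sup>2 + b\<^sup>2)" using sum_squares_ge_zero[of "a - b" 0] by (simp add: power2_eq_square algebra_simps)
  then have "((a + b)\<^sup>2)\<^sup>2 \<le> (2 * (a\<^sup>2 + b\<^sup>2))\<^sup>2" by (intro power_mono) auto
  also have "\<dots> \<le> 8 * ((a\<^sup>2)\<^sup>2 + (b\<^sup>2)\<^sup>2)" using sum_squares_ge_zero[of "a\<^sup>2 - b\<^sup>2" 0] by (simp add: power2_eq_square algebra_simps)
  finally show ?thesis by simp
qed

theorem theorem2p1:
  fixes M :: "'a measure"
    and y :: "nat \<Rightarrow> 'a \<Rightarrow> real"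
    and X :: "nat \<Rightarrow> 'a \<Rightarrow> real^'p"
    and e :: "nat \<Rightarrow> 'a \<Rightarrow> real"
    and \<beta>0 :: "real^'p"
    and m :: "nat \<Rightarrow> nat"
  assumes "prob_space M"
    and iid_indep: "prob_space.indep_vars M (\<lambda>_. borel) (\<lambda>i \<omega>. (y i \<omega>, X i \<omega>)) UNIV"
    and iid_dist: "\<And>i. distr M borel (\<lambda>\<omega>. (y i \<omega>, X i \<omega>)) = distr M borel (\<lambda>\<omega>. (y 0 \<omega>, X 0 \<omega>))"
    and model: "\<And>i \<omega>. y i \<omega> = X i \<omega> \<bullet> \<beta>0 + e i \<omega>"
    and y4: "integrable M (\<lambda>\<omega>. (y 0 \<omega>) ^ 4)"
    and X4: "integrable M (\<lambda>\<omega>. (norm (X 0 \<omega>)) ^ 4)"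
    and full_rank: "rank (integral\<^sup>L M (\<lambda>\<omega>. outer (X 0 \<omega>) (X 0 \<omega>))) = CARD('p)"
    and orth: "integral\<^sup>L M (\<lambda>\<omega>. e 0 \<omega> *\<^sub>R X 0 \<omega>) = 0"
    and m_inf: "filterlim m at_top sequentially"
    and m_n: "(\<lambda>n. real (m n) / real n) \<longlonglongrightarrow> 0"
  shows
   "(let \<Sigma> = integral\<^sup>L M (\<lambda>\<omega>. outer (X 0 \<omega>) (X 0 \<omega>));
         \<Omega> = integral\<^sup>L M (\<lambda>\<omega>. (e 0 \<omega>)\<^sup>2 *\<^sub>R outer (X 0 \<omega>) (X 0 \<omega>));
         V1 = matrix_inv \<Sigma> ** \<Omega> ** matrix_inv \<Sigma>;
         V0 = integral\<^sup>L M (\<lambda>\<omega>. (e 0 \<omega>)\<^sup>2) *\<^sub>R matrix_inv \<Sigma>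
     in (\<exists>G. normal_vec V1 G \<and>
           conv_distr (\<lambda>n. M \<Otimes>\<^sub>M measure_pmf (bern_sketch n (m n)))
             (\<lambda>n (\<omega>, b). sqrt (real (m n)) *\<^sub>R
                (sketched_ols n n (bern_Pi n (m n) b) (\<lambda>i. X i \<omega>) (\<lambda>i. y i \<omega>)
                 - ols n (\<lambda>i. X i \<omega>) (\<lambda>i. y i \<omega>))) G)
      \<and> (\<exists>G. normal_vec V0 G \<and>
           conv_distr (\<lambda>n. M \<Otimes>\<^sub>M measure_pmf (cs_sketch n (m n)))
             (\<lambda>n (\<omega>, c). sqrt (real (m n)) *\<^sub>R
                (sketched_ols (m n) n (cs_Pi c) (\<lambda>i. X i \<omega>) (\<lambda>i. y i \<omega>)
                 - ols n (\<lambda>i. X i \<omega>) (\<lambda>i. y i \<omega>))) G))"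
proof -
  interpret prob_space M by fact
  \<comment> \<open>The model recovers e from (y, X) by a fixed measurable map, which carries
    independence and equality of laws over to (e, X).\<close>
  define \<phi> where "\<phi> = (\<lambda>q::real \<times> (real^'p). (fst q - snd q \<bullet> \<beta>0, snd q))"
  have \<phi>m: "\<phi> \<in> borel_measurable borel"
    unfolding \<phi>_def by (intro borel_measurable_continuous_onI continuous_intros)
  have eX: "(\<lambda>\<omega>. (e i \<omega>, X i \<omega>)) = (\<lambda>\<omega>. \<phi> (y i \<omega>, X i \<omega>))" for i
    by (simp add: \<phi>_def model)
  have yXm: "random_variable borel (\<lambda>\<omega>. (y i \<omega>, X i \<omega>))" for i
    using iid_indep by (auto simp: indep_vars_def)
  have eXm: "random_variable borel (\<lambda>\<omega>. (e i \<omega>, X i \<omega>))" for i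
    unfolding eX by (rule measurable_compose[OF yXm \<phi>m])
  interpret regression_data M X e
  proof
    show "indep_vars (\<lambda>_. borel) (\<lambda>i \<omega>. (e i \<omega>, X i \<omega>)) UNIV"
      unfolding eX by (rule indep_vars_compose2[OF iid_indep \<phi>m])
    show "distr M borel (\<lambda>\<omega>. (e i \<omega>, X i \<omega>)) = distr M borel (\<lambda>\<omega>. (e 0 \<omega>, X 0 \<omega>))" for i
      using arg_cong[OF iid_dist[of i], of "\<lambda>N. distr N borel \<phi>"]
      unfolding eX by (simp add: distr_distr[OF \<phi>m yXm] comp_def)
    show "integrable M (\<lambda>\<omega>. norm (e 0 \<omega>, X 0 \<omega>) ^ 4)"
    proof (rule Bochner_Integration.integrable_bound)
      \<comment> \<open>The bound |e| \<le> |y| + |X| |\<beta>0| gives the joint fourth moment; 8 is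
        the convexity constant 2^3 of \<open>sum_power4_le\<close>.\<close>
      show "integrable M (\<lambda>\<omega>. 8 * ((y 0 \<omega>) ^ 4 + (norm \<beta>0 + 1) ^ 4 * norm (X 0 \<omega>) ^ 4))"
        using y4 X4 by simp
      show "random_variable borel (\<lambda>\<omega>. norm (e 0 \<omega>, X 0 \<omega>) ^ 4)"
        by (intro borel_measurable_power measurable_compose[OF eXm borel_measurable_norm])
      have "norm (e 0 \<omega>, X 0 \<omega>) ^ 4 \<le> 8 * ((y 0 \<omega>) ^ 4 + (norm \<beta>0 + 1) ^ 4 * norm (X 0 \<omega>) ^ 4)" for \<omega>
      proof -
        have "norm (e 0 \<omega>, X 0 \<omega>) \<le> \<bar>e 0 \<omega>\<bar> + norm (X 0 \<omega>)"
          using norm_triangle_ineq[of "(e 0 \<omega>, 0)" "(0, X 0 \<omega>)"] by simp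
        also have "\<bar>e 0 \<omega>\<bar> \<le> \<bar>y 0 \<omega>\<bar> + norm (X 0 \<omega>) * norm \<beta>0"
          using model[of 0 \<omega>] Cauchy_Schwarz_ineq2[of "X 0 \<omega>" \<beta>0] by linarith
        finally have "norm (e 0 \<omega>, X 0 \<omega>) \<le> \<bar>y 0 \<omega>\<bar> + (norm \<beta>0 + 1) * norm (X 0 \<omega>)"
          by (simp add: algebra_simps)
        then have "norm (e 0 \<omega>, X 0 \<omega>) ^ 4 \<le> (\<bar>y 0 \<omega>\<bar> + (norm \<beta>0 + 1) * norm (X 0 \<omega>)) ^ 4"
          by (rule power_mono) simp
        also have "\<dots> \<le> 8 * (\<bar>y 0 \<omega>\<bar> ^ 4 + ((norm \<beta>0 + 1) * norm (X 0 \<omega>)) ^ 4)" by (rule sum_power4_le)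
        finally show ?thesis by (simp add: power_mult_distrib)
      qed
      then show "AE \<omega> in M. norm (norm (e 0 \<omega>, X 0 \<omega>) ^ 4) \<le> norm (8 * ((y 0 \<omega>) ^ 4 + (norm \<beta>0 + 1) ^ 4 * norm (X 0 \<omega>) ^ 4))"
        by simp
    qed
  qed (rule orth)
  have inv: "invertible Sig"
    using full_rank det_eq_0_rank[of Sig] by (simp add: invertible_det_nz Sig_def)
  \<comment> \<open>When the middle factor is a multiple of \<open>Sig\<close>, the sandwich
    collapses to that multiple of the inverse; this is how the countsketch covariance takes the form
    V0.\<close>
  have V0: "matrix_inv Sig ** (s *\<^sub>R Sig) ** matrix_inv Sig = s *\<^sub>R matrix_inv Sig" for s
  proof -
    have "matrix_inv Sig ** (s *\<^sub>R Sig) = s *\<^sub>R (matrix_inv Sig ** Sig)"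
      by (simp add: matrix_matrix_mult_def vec_eq_iff sum_distrib_left mult_ac)
    then show ?thesis
      unfolding matrix_inv_mult[OF inv]
      by (simp add: matrix_matrix_mult_def mat_def vec_eq_iff if_distrib[of "\<lambda>z. z * _"] if_distrib[of "\<lambda>z. _ * z"] cong: if_cong)
  qed
  show ?thesis
    using bern_conv_distr[OF model inv m_inf m_n] cs_conv_distr[OF model inv m_inf m_n, unfolded V0]
    unfolding Let_def Sig_def Omg_def by blast
qed

end
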